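(* Let $d,m\in\mathbb{N}$, $d\ge2$. Let $\Omega\subset\mathbb{R}^d$ be an open and bounded Lipschitz domain. Let $\mathcal{A}(D)=\sum_{|\alpha|=m}A_\alpha\partial^\alpha$, $A_\alpha\in\mathbb{R}^{k\times n}$, be a homogeneous, constant coefficient, linear differential operator with symbol $\mathbb{A}(\xi)=\sum_{|\alpha|=m}A_\alpha\xi^\alpha$, and let $A,B\in\mathbb{R}^n$ be such that $A-B\in\Lambda_{\mathcal{A}}\setminus I_{\mathcal{A}}$. Let $p(\xi)=|\mathbb{A}(\xi)(A-B)|^2$ have maximal vanishing order on the unit sphere equal to $L\le m$, and assume further that $V=p^{-1}(0)$ is a finite union of vector spaces. For $\lambda\in(0,1)$ let $F_\lambda=\lambda A+(1-\lambda)B$. Then there exist constants $C=C(\mathcal{A}(D),A,B,d,m,\Omega,V)>0$ and $\epsilon_0=\epsilon_0(\mathcal{A}(D),\lambda,A,B,d,m,\Omega,V)>0$ such that for any $\epsilon\in(0,\epsilon_0)$ $$\inf_{\chi\in BV(\Omega;\{A,B\})}E_\epsilon^{\mathcal{A}}(\chi;F_\lambda)\ge C\min\{1-\lambda,\lambda\}^2\,\epsilon^{\frac{2L}{2L+1}}.$$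
   Context: Wave cone: $\Lambda_{\mathcal{A}}:=\bigcup_{\xi\in\mathbb{S}^{d-1}}\ker\mathbb{A}(\xi)$. Supercompatible states: $I_{\mathcal{A}}:=\bigcap_{\xi\in\mathbb{S}^{d-1}}\ker\mathbb{A}(\xi)$. Maximal vanishing order on the unit sphere: for a non-negative, $2m$-homogeneous polynomial $p\in\mathbb{R}[\xi]$ with zero set $V$, $$L[p]:=\min\Big\{\ell\in\mathbb{N}:\ \inf_{\xi\in\mathbb{S}^{d-1}\setminus V}\frac{p(\xi)}{\mathrm{dist}_V(\xi)^{2\ell}}>0\Big\},\qquad \mathrm{dist}_V(\xi):=\inf\{|\xi-\zeta|:\zeta\in V\}.$$ For $F\in\mathbb{R}^n$ let $$\mathcal{D}_F:=\{u\in L^2_{loc}(\mathbb{R}^d;\mathbb{R}^n):\ \mathcal{A}(D)u=0\text{ in }\mathcal{D}'(\mathbb{R}^d),\ u=F\text{ in }\mathbb{R}^d\setminus\overline\Omega\},$$ and for $\epsilon>0$ and $\chi\in BV(\Omega;\{A,B\})$ ($BV$ functions with values in $\{A,B\}$) let $$E_\epsilon^{\mathcal{A}}(\chi;F):=\inf_{u\in\mathcal{D}_F}\int_\Omega|u-\chi|^2\,dx+\epsilon\int_\Omega|\nabla\chi|,$$ where $\int_\Omega|\nabla\chi|$ is the total variation of the distributional gradient of $\chi$ in $\Omega$. *)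

theory Defs
  imports "HOL-Analysis.Analysis"
begin

definition partial_deriv ::
  "'d::finite \<Rightarrow> (real^'d \<Rightarrow> 'b::real_normed_vector) \<Rightarrow> real^'d \<Rightarrow> 'b" where
  "partial_deriv i f = (\<lambda>x. frechet_derivative f (at x) (axis i 1))"

definition iterated_partial ::
  "'d::finite list \<Rightarrow> (real^'d \<Rightarrow> 'b::real_normed_vector) \<Rightarrow> real^'d \<Rightarrow> 'b" where
  "iterated_partial is f = foldr partial_deriv is f"

text \<open>Differentiability of every iterated partial derivative on the whole space is the same as
  existence and continuity of all of them.\<close>

definition smooth :: "(real^'d::finite \<Rightarrow> 'b::real_normed_vector) \<Rightarrow> bool" where
  "smooth f \<longleftrightarrow> (\<forall>is. \<forall>x. iterated_partial is f differentiable (at x))"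

definition test_functions ::
  "(real^'d::finite) set \<Rightarrow> (real^'d \<Rightarrow> 'b::real_normed_vector) set" where
  "test_functions U = {\<phi>. smooth \<phi> \<and> compact (closure {x. \<phi> x \<noteq> 0})
     \<and> closure {x. \<phi> x \<noteq> 0} \<subseteq> U}"

definition multi_indices :: "nat \<Rightarrow> ('d::finite \<Rightarrow> nat) set" where
  "multi_indices m = {\<alpha>. (\<Sum>i\<in>UNIV. \<alpha> i) = m}"

text \<open>The index type carries no order, so some arrangement of the differentiations is chosen;
  it is only applied to smooth functions, for which all arrangements agree.\<close>

definition multi_deriv ::
  "('d::finite \<Rightarrow> nat) \<Rightarrow> (real^'d \<Rightarrow> 'b::real_normed_vector) \<Rightarrow> real^'d \<Rightarrow> 'b" where
  "multi_deriv \<alpha> f = iterated_partial (SOME is. \<forall>i. count_list is i = \<alpha> i) f"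

text \<open>An operator of order \<open>m\<close> is given by the family of its coefficient matrices; only the
  coefficients at multi-indices of order \<open>m\<close> are ever used.\<close>

definition op_symbol ::
  "nat \<Rightarrow> (('d::finite \<Rightarrow> nat) \<Rightarrow> real^'n::finite^'k::finite) \<Rightarrow> real^'d \<Rightarrow> real^'n^'k" where
  "op_symbol m a \<xi> = (\<Sum>\<alpha>\<in>multi_indices m. (\<Prod>i\<in>UNIV. (\<xi> $ i) ^ \<alpha> i) *\<^sub>R a \<alpha>)"

definition wave_cone ::
  "nat \<Rightarrow> (('d::finite \<Rightarrow> nat) \<Rightarrow> real^'n::finite^'k::finite) \<Rightarrow> (real^'n) set" where
  "wave_cone m a = (\<Union>\<xi>\<in>sphere 0 1. {v. op_symbol m a \<xi> *v v = 0})"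

definition supercompatible ::
  "nat \<Rightarrow> (('d::finite \<Rightarrow> nat) \<Rightarrow> real^'n::finite^'k::finite) \<Rightarrow> (real^'n) set" where
  "supercompatible m a = (\<Inter>\<xi>\<in>sphere 0 1. {v. op_symbol m a \<xi> *v v = 0})"

definition distr_op ::
  "nat \<Rightarrow> (('d::finite \<Rightarrow> nat) \<Rightarrow> real^'n::finite^'k::finite) \<Rightarrow> (real^'d \<Rightarrow> real^'n)
     \<Rightarrow> (real^'d \<Rightarrow> real) \<Rightarrow> real^'k" where
  "distr_op m a u \<phi> = (-1) ^ m *\<^sub>R
     (\<Sum>\<alpha>\<in>multi_indices m. integral\<^sup>L lebesgue (\<lambda>x. multi_deriv \<alpha> \<phi> x *\<^sub>R (a \<alpha> *v u x)))"

text \<open>Equality with \<open>enat L\<close> states that the minimum exists and equals \<open>L\<close>; the value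
  \<open>\<infinity>\<close> stands for a minimum over the empty set.\<close>

definition max_vanishing_order :: "(real^'d::finite \<Rightarrow> real) \<Rightarrow> enat" where
  "max_vanishing_order p =
     (let V = {\<xi>. p \<xi> = 0} in
      INF l\<in>{l::nat. (INF \<xi>\<in>sphere 0 1 - V. p \<xi> / infdist \<xi> V ^ (2 * l)) > 0}. enat l)"

text \<open>Near each boundary point, the set is the strict epigraph of a Lipschitz function over the
  hyperplane orthogonal to a unit vector \<open>\<nu>\<close>; the choice of \<open>\<nu>\<close> replaces the usual rotation
  of the coordinates.\<close>

definition lipschitz_boundary :: "'a::euclidean_space set \<Rightarrow> bool" where
  "lipschitz_boundary U \<longleftrightarrow>
     (\<forall>x\<in>frontier U. \<exists>r>0. \<exists>\<nu> g K. norm \<nu> = 1 \<and> K-lipschitz_on {z. z \<bullet> \<nu> = 0} (g :: 'a \<Rightarrow> real)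
        \<and> U \<inter> ball x r = {y \<in> ball x r. g (y - (y \<bullet> \<nu>) *\<^sub>R \<nu>) < y \<bullet> \<nu>})"

text \<open>Functions on \<open>U\<close> are represented by total functions whose values off \<open>U\<close> are never used.
  The variation takes the Frobenius norm on matrices, which is the norm of the type.\<close>

definition total_variation ::
  "(real^'d::finite) set \<Rightarrow> (real^'d \<Rightarrow> real^'n::finite) \<Rightarrow> ennreal" where
  "total_variation U f =
     (SUP \<phi>\<in>{\<phi> :: real^'d \<Rightarrow> real^'d^'n. \<phi> \<in> test_functions U \<and> (\<forall>x. norm (\<phi> x) \<le> 1)}.
        ennreal (integral\<^sup>L (lebesgue_on U)
          (\<lambda>x. \<Sum>j\<in>UNIV. \<Sum>i\<in>UNIV. f x $ j * partial_deriv i \<phi> x $ j $ i)))"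

definition BV ::
  "(real^'d::finite) set \<Rightarrow> (real^'n::finite) set \<Rightarrow> (real^'d \<Rightarrow> real^'n) set" where
  "BV U S = {f. integrable (lebesgue_on U) f \<and> total_variation U f < \<infinity>
     \<and> (AE x in lebesgue_on U. f x \<in> S)}"

definition L2_loc :: "('a::euclidean_space \<Rightarrow> 'b::euclidean_space) set" where
  "L2_loc = {u. u \<in> borel_measurable lebesgue \<and>
     (\<forall>K. compact K \<longrightarrow> integrable (lebesgue_on K) (\<lambda>x. (norm (u x))\<^sup>2))}"

definition admissible ::
  "nat \<Rightarrow> (('d::finite \<Rightarrow> nat) \<Rightarrow> real^'n::finite^'k::finite) \<Rightarrow> (real^'d) set \<Rightarrow> real^'n
     \<Rightarrow> (real^'d \<Rightarrow> real^'n) set" where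
  "admissible m a \<Omega> F = {u. u \<in> L2_loc \<and> (\<forall>\<phi>\<in>test_functions UNIV. distr_op m a u \<phi> = 0)
     \<and> (AE x in lebesgue. x \<notin> closure \<Omega> \<longrightarrow> u x = F)}"

definition energy ::
  "nat \<Rightarrow> (('d::finite \<Rightarrow> nat) \<Rightarrow> real^'n::finite^'k::finite) \<Rightarrow> (real^'d) set \<Rightarrow> real
     \<Rightarrow> (real^'d \<Rightarrow> real^'n) \<Rightarrow> real^'n \<Rightarrow> ennreal" where
  "energy m a \<Omega> \<epsilon> f F =
     (INF u\<in>admissible m a \<Omega> F. \<integral>\<^sup>+x. ennreal ((norm (u x - f x))\<^sup>2) \<partial>lebesgue_on \<Omega>)
     + ennreal \<epsilon> * total_variation \<Omega> f"

end

theory Submission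
  imports Defs "HOL-Probability.Probability"
begin

text \<open>
  Let \<open>E\<close> be the set on which the phase \<open>f\<close> equals \<open>A\<close>, and let \<open>\<theta> = 1\<^sub>E - lam 1\<^sub>\<Omega>\<close>, so that
  \<open>f - F = \<theta> (A - B)\<close> in \<open>\<Omega>\<close>.  If \<open>u\<close> is admissible, then \<open>u - F\<close> has compact support and is
  annihilated by the operator, hence its Fourier transform is annihilated by the symbol at every
  frequency (\<open>fourier_constraint\<close>).  With the residual \<open>w = f - u\<close> in \<open>\<Omega>\<close>, \<open>w = 0\<close> outside, this says that
  the symbol maps the transform of \<open>w\<close> to the transform of \<open>\<theta>\<close> times the symbol applied to \<open>A - B\<close>
  (\<open>elastic_residual\<close>), and the vanishing order gives
  \<open>dist\<^sub>V(\<xi>/|\<xi>|)^(2L) |\<theta>^(\<xi>)|\<^sup>2 \<le> C |w^(\<xi>)|\<^sup>2\<close> (\<open>symbol_lower_bound\<close>).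

  Since \<open>V\<close> is a finite union of proper subspaces, it lies in a finite union of hyperplanes
  \<open>\<nu>\<^sup>\<bottom>\<close>, and \<open>dist\<^sub>V\<close> is bounded below by the least \<open>|\<xi> \<bullet> \<nu>|/|\<xi>|\<close>.  For a large cut-off \<open>R\<close> the
  mass of \<open>\<theta>^\<close> splits into three parts.  At angular distance at least of order \<open>1/R\<close> from the hyperplanes
  it is at most \<open>C R^(2L)\<close> times the elastic energy.  In a thin slab around a hyperplane it is a small fraction
  of the whole, because \<open>\<theta>\<close> has bounded support (\<open>shift_average_spectrum\<close>, \<open>shift_average_square\<close>).  Frequencies
  far beyond \<open>R\<close> are damped by a cut-off, whose cost is the translation defect of \<open>\<theta>\<close> at scale \<open>1/R\<close>.  All three are
  combined in \<open>degenerate_multiplier_estimate\<close>.  The cut-off is Gaussian, which makes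
  Fourier inversion unnecessary: by Fubini's theorem and the explicit transform of a Gaussian, the weighted mass of the spectrum is
  exactly \<open>\<integral> \<theta>\<^sup>2\<close> minus half of the Gaussian average of the translation defects
  \<open>\<integral> (\<theta>(x + z) - \<theta>(x))\<^sup>2 dx\<close> (\<open>gaussian_plancherel\<close>).

  The translation defect is at most \<open>|z|\<close> times the variation of \<open>1\<^sub>E\<close> in \<open>\<Omega>\<close>, plus twice the volume of
  the points of \<open>\<Omega>\<close> within distance \<open>|z|\<close> of its complement (\<open>two_phase_shift_defect\<close>).  This
  volume tends to zero with \<open>|z|\<close>, uniformly in the phase, so that no bound on the perimeter of \<open>\<Omega>\<close> is
  used; the Lipschitz property serves only to make the boundary a null set.  Altogether
  \<open>min(1 - lam, lam)\<^sup>2 |\<Omega>| \<le> \<integral> \<theta>\<^sup>2 \<le> C (R^(2L) elastic + variation/R) + o(1)\<close>, and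
  \<open>R = \<epsilon>^(-1/(2L+1))\<close> balances the two terms.
\<close>

section \<open>Gaussians and their Fourier transforms\<close>

lemma lborel_prod_coordinates:
  fixes f :: "'a::euclidean_space \<Rightarrow> real \<Rightarrow> complex"
  assumes "\<And>b. b \<in> Basis \<Longrightarrow> integrable lborel (f b)"
  shows "integrable lborel (\<lambda>x. \<Prod>b\<in>Basis. f b (x \<bullet> b))"
    and "(\<integral>x. (\<Prod>b\<in>Basis. f b (x \<bullet> b)) \<partial>lborel) = (\<Prod>b\<in>Basis. integral\<^sup>L lborel (f b))"
proof -
  interpret product_sigma_finite "\<lambda>_::'a. lborel :: real measure" by standard
  have [measurable]: "\<And>b. b \<in> Basis \<Longrightarrow> f b \<in> borel_measurable borel"
    using assms borel_measurable_integrable by fastforce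
  have coord: "(\<Sum>b\<in>Basis. y b *\<^sub>R b) \<bullet> c = y c" if "c \<in> Basis" for y and c :: 'a
    using that by (simp add: inner_sum_left_Basis)
  have eq: "(\<Prod>b\<in>Basis. f b ((\<Sum>b\<in>Basis. y b *\<^sub>R b) \<bullet> b)) = (\<Prod>b\<in>Basis. f b (y b))" for y
    by (rule prod.cong) (auto simp: coord)
  have meas: "(\<lambda>y. \<Sum>b\<in>Basis. y b *\<^sub>R b) \<in> measurable (\<Pi>\<^sub>M b\<in>(Basis::'a set). lborel) borel"
    by measurable
  have int: "integrable (\<Pi>\<^sub>M b\<in>(Basis::'a set). lborel) (\<lambda>y. \<Prod>b\<in>Basis. f b (y b))"
    by (rule product_integrable_prod) (auto simp: assms)
  have fm: "(\<lambda>x. \<Prod>b\<in>Basis. f b (x \<bullet> b)) \<in> borel_measurable borel"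
    by measurable
  show "integrable lborel (\<lambda>x. \<Prod>b\<in>Basis. f b (x \<bullet> b))"
    by (subst lborel_eq, subst integrable_distr_eq[OF meas fm]) (use int in \<open>simp only: eq\<close>)
  show "(\<integral>x. (\<Prod>b\<in>Basis. f b (x \<bullet> b)) \<partial>lborel) = (\<Prod>b\<in>Basis. integral\<^sup>L lborel (f b))"
    by (subst lborel_eq, subst integral_distr[OF meas fm], simp only: eq)
       (rule product_integral_prod, auto simp: assms)
qed

lemma gaussian_fourier_real:
  fixes s z :: real
  assumes "s > 0"
  shows "integrable lborel (\<lambda>x. cis (x * z) * complex_of_real (exp (- s * x\<^sup>2 / 2)))"
    and "(\<integral>x. cis (x * z) * complex_of_real (exp (- s * x\<^sup>2 / 2)) \<partial>lborel)
      = complex_of_real (sqrt (2 * pi / s) * exp (- z\<^sup>2 / (2 * s)))"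
proof -
  define t where "t = z / sqrt s"
  define h where "h x = complex_of_real (exp (- x\<^sup>2 / 2)) * cis (t * x)" for x
  have bint: "integrable lborel (\<lambda>x. exp (- x\<^sup>2 / 2) :: real)"
  proof -
    have "integrable lborel (\<lambda>x. sqrt (2*pi) * std_normal_density x)"
      by (intro integrable_mult_right) simp
    then show ?thesis by (simp add: std_normal_density_def)
  qed
  have hint: "integrable lborel h"
  proof (rule Bochner_Integration.integrable_bound[OF bint])
    show "h \<in> borel_measurable lborel"
      unfolding h_def measurable_lborel2 by (intro borel_measurable_continuous_onI continuous_intros) auto
  qed (auto simp: h_def norm_mult)
  have "char std_normal_distribution t = (\<integral>x. std_normal_density x *\<^sub>R cis (t * x) \<partial>lborel)"
    unfolding char_def by (subst integral_density) (auto simp: cis_conv_exp)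
  also have "\<dots> = (\<integral>x. complex_of_real (1 / sqrt (2*pi)) * h x \<partial>lborel)"
    by (simp add: std_normal_density_def h_def scaleR_conv_of_real mult.assoc)
  also have "\<dots> = complex_of_real (1 / sqrt (2*pi)) * integral\<^sup>L lborel h" by simp
  finally have "complex_of_real (1 / sqrt (2*pi)) * integral\<^sup>L lborel h = complex_of_real (exp (- (t\<^sup>2)/2))"
    by (simp add: char_std_normal_distribution)
  then have h_val: "integral\<^sup>L lborel h = complex_of_real (sqrt (2*pi) * exp (- (t\<^sup>2)/2))"
    by (simp add: field_simps)
  have hs: "h (0 + sqrt s * x) = cis (x * z) * complex_of_real (exp (- s * x\<^sup>2 / 2))" for x
    using assms by (simp add: h_def t_def power_mult_distrib mult.commute)
  show "integrable lborel (\<lambda>x. cis (x * z) * complex_of_real (exp (- s * x\<^sup>2 / 2)))"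
    using lborel_integrable_real_affine[OF hint, of "sqrt s" 0] assms by (simp only: hs) simp
  have "integral\<^sup>L lborel h = sqrt s *\<^sub>R (\<integral>x. h (0 + sqrt s * x) \<partial>lborel)"
    using lborel_integral_real_affine[of "sqrt s" h 0] assms by simp
  then have "complex_of_real (sqrt s) * (\<integral>x. h (0 + sqrt s * x) \<partial>lborel)
     = complex_of_real (sqrt (2*pi) * exp (- (t\<^sup>2)/2))"
    by (simp add: h_val scaleR_conv_of_real)
  then have "(\<integral>x. h (0 + sqrt s * x) \<partial>lborel) = complex_of_real (sqrt (2*pi) / sqrt s * exp (- (t\<^sup>2)/2))"
    using assms by (simp add: field_simps)
  then show "(\<integral>x. cis (x * z) * complex_of_real (exp (- s * x\<^sup>2 / 2)) \<partial>lborel)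
      = complex_of_real (sqrt (2 * pi / s) * exp (- z\<^sup>2 / (2 * s)))"
    using assms by (simp only: hs) (simp add: t_def power_divide real_sqrt_divide field_simps)
qed

lemma gaussian_fourier:
  fixes z :: "'a::euclidean_space"
  assumes "s > 0"
  shows "integrable lborel (\<lambda>x::'a. exp (- s * (norm x)\<^sup>2 / 2))"
    and "(\<integral>x. exp (- s * (norm x)\<^sup>2 / 2) * cos (x \<bullet> z) \<partial>lborel)
      = sqrt (2 * pi / s) ^ DIM('a) * exp (- (norm z)\<^sup>2 / (2 * s))"
proof -
  define f where "f = (\<lambda>(b::'a) x. cis (x * (z \<bullet> b)) * complex_of_real (exp (- s * x\<^sup>2 / 2)))"
  have fi: "integrable lborel (f b)" and fv: "integral\<^sup>L lborel (f b) =
      complex_of_real (sqrt (2 * pi / s) * exp (- (z \<bullet> b)\<^sup>2 / (2 * s)))" for b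
    unfolding f_def using gaussian_fourier_real[OF assms, of "z \<bullet> b"] by auto
  have cis_prod: "cis (sum g B) = (\<Prod>b\<in>B. cis (g b))" if "finite B" for g and B :: "'a set"
    using that by induction (auto simp: cis_mult[symmetric])
  have sq: "(norm x)\<^sup>2 = (\<Sum>b\<in>Basis. (x \<bullet> b)\<^sup>2)" for x :: 'a
    by (simp only: power2_norm_eq_inner) (subst euclidean_inner, simp add: power2_eq_square)
  have prod: "(\<Prod>b\<in>Basis. f b (x \<bullet> b)) = complex_of_real (exp (- s * (norm x)\<^sup>2 / 2)) * cis (x \<bullet> z)" for x
  proof -
    have "(\<Prod>b\<in>Basis. f b (x \<bullet> b)) = cis (\<Sum>b\<in>Basis. (x \<bullet> b) * (z \<bullet> b))
       * complex_of_real (exp (\<Sum>b\<in>Basis. (- s * (x \<bullet> b)\<^sup>2 / 2)))"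
      by (simp add: f_def prod.distrib cis_prod exp_sum of_real_prod)
    also have "(\<Sum>b\<in>Basis. (- s * (x \<bullet> b)\<^sup>2 / 2)) = - s * (norm x)\<^sup>2 / 2"
      by (simp only: sq sum_distrib_left sum_divide_distrib)
    finally show ?thesis by (simp add: euclidean_inner[symmetric] mult.commute)
  qed
  have int: "integrable lborel (\<lambda>x. complex_of_real (exp (- s * (norm x)\<^sup>2 / 2)) * cis (x \<bullet> z))"
    using lborel_prod_coordinates(1)[of f] fi by (simp only: prod)
  from integrable_norm[OF int] show "integrable lborel (\<lambda>x::'a. exp (- s * (norm x)\<^sup>2 / 2))"
    by (simp add: norm_mult)
  have "(\<integral>x. complex_of_real (exp (- s * (norm x)\<^sup>2 / 2)) * cis (x \<bullet> z) \<partial>lborel)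
     = (\<Prod>b\<in>Basis. integral\<^sup>L lborel (f b))"
    using lborel_prod_coordinates(2)[of f] fi by (simp only: prod)
  also have "\<dots> = complex_of_real (\<Prod>b\<in>Basis. sqrt (2 * pi / s) * exp (- (z \<bullet> b)\<^sup>2 / (2 * s)))"
    by (simp only: fv of_real_prod)
  also have "(\<Prod>b\<in>Basis. sqrt (2 * pi / s) * exp (- (z \<bullet> b)\<^sup>2 / (2 * s))) =
     sqrt (2 * pi / s) ^ DIM('a) * exp (\<Sum>b\<in>Basis. (- (z \<bullet> b)\<^sup>2 / (2 * s)))"
    by (simp add: prod.distrib exp_sum)
  also have "(\<Sum>b\<in>Basis. (- (z \<bullet> b)\<^sup>2 / (2 * s))) = - (norm z)\<^sup>2 / (2 * s)"
    by (simp only: sq sum_divide_distrib sum_negf[symmetric])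
  finally have eq: "(\<integral>x. complex_of_real (exp (- s * (norm x)\<^sup>2 / 2)) * cis (x \<bullet> z) \<partial>lborel) =
     complex_of_real (sqrt (2 * pi / s) ^ DIM('a) * exp (- (norm z)\<^sup>2 / (2 * s)))" .
  have "(\<integral>x. exp (- s * (norm x)\<^sup>2 / 2) * cos (x \<bullet> z) \<partial>lborel) =
     (\<integral>x. Re (complex_of_real (exp (- s * (norm x)\<^sup>2 / 2)) * cis (x \<bullet> z)) \<partial>lborel)"
    by simp
  also have "\<dots> = Re (\<integral>x. complex_of_real (exp (- s * (norm x)\<^sup>2 / 2)) * cis (x \<bullet> z) \<partial>lborel)"
    by (rule integral_Re[OF int])
  finally show "(\<integral>x. exp (- s * (norm x)\<^sup>2 / 2) * cos (x \<bullet> z) \<partial>lborel)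
      = sqrt (2 * pi / s) ^ DIM('a) * exp (- (norm z)\<^sup>2 / (2 * s))"
    by (simp only: eq Re_complex_of_real)
qed


lemma lborel_shift:
  fixes f :: "'a::euclidean_space \<Rightarrow> real"
  assumes [measurable]: "f \<in> borel_measurable borel"
  shows "integrable lborel (\<lambda>x. f (c + x)) \<longleftrightarrow> integrable lborel f"
    and "(\<integral>x. f (c + x) \<partial>lborel) = integral\<^sup>L lborel f"
proof -
  have "integrable (distr lborel borel ((+) c)) f \<longleftrightarrow> integrable lborel (\<lambda>x. f (c + x))"
    by (rule integrable_distr_eq) auto
  then show "integrable lborel (\<lambda>x. f (c + x)) \<longleftrightarrow> integrable lborel f"
    by (simp add: lborel_distr_plus)
  have "integral\<^sup>L (distr lborel borel ((+) c)) f = (\<integral>x. f (c + x) \<partial>lborel)"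
    by (rule integral_distr) auto
  then show "(\<integral>x. f (c + x) \<partial>lborel) = integral\<^sup>L lborel f"
    by (simp add: lborel_distr_plus)
qed

lemma integrable_prod_mult:
  fixes f :: "'a::euclidean_space \<Rightarrow> real" and g :: "'b::euclidean_space \<Rightarrow> real"
  assumes "integrable lborel f" "integrable lborel g"
  shows "integrable (lborel \<Otimes>\<^sub>M lborel) (\<lambda>(x, y). f x * g y)"
proof (rule lborel_pair.Fubini_integrable)
  have [measurable]: "f \<in> borel_measurable borel" "g \<in> borel_measurable borel"
    using assms borel_measurable_integrable by fastforce+
  show "(\<lambda>(x, y). f x * g y) \<in> borel_measurable (lborel \<Otimes>\<^sub>M lborel)" by measurable
  show "integrable lborel (\<lambda>x. \<integral>y. norm (case (x, y) of (x, y) \<Rightarrow> f x * g y) \<partial>lborel)"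
    using assms by (simp add: abs_mult)
qed (use assms in auto)

text \<open>The centred Gaussian density with covariance \<open>s\<close> times the identity.\<close>

definition gauss_kernel :: "real \<Rightarrow> 'a::euclidean_space \<Rightarrow> real" where
  "gauss_kernel s z = exp (- (norm z)\<^sup>2 / (2 * s)) / sqrt (2 * pi * s) ^ DIM('a)"

lemma gauss_kernel_nonneg: "s > 0 \<Longrightarrow> gauss_kernel s z \<ge> 0"
  by (simp add: gauss_kernel_def)

lemma gauss_kernel_measurable [measurable]: "gauss_kernel s \<in> borel_measurable borel"
  unfolding gauss_kernel_def by measurable

lemma gauss_kernel_integral:
  assumes "s > 0"
  shows "integrable lborel (gauss_kernel s :: 'a::euclidean_space \<Rightarrow> real)"
    and "integral\<^sup>L lborel (gauss_kernel s :: 'a \<Rightarrow> real) = 1"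
proof -
  have eq: "gauss_kernel s = (\<lambda>z::'a. (1 / sqrt (2 * pi * s) ^ DIM('a)) * exp (- (1/s) * (norm z)\<^sup>2 / 2))"
    by (auto simp: gauss_kernel_def)
  show "integrable lborel (gauss_kernel s :: 'a \<Rightarrow> real)"
    unfolding eq by (intro integrable_mult_right gaussian_fourier(1)) (use assms in auto)
  show "integral\<^sup>L lborel (gauss_kernel s :: 'a \<Rightarrow> real) = 1"
    unfolding eq using gaussian_fourier(2)[of "1/s" "0::'a"] assms by simp
qed

lemma gauss_kernel_first_moment:
  assumes "s > 0"
  shows "integrable lborel (\<lambda>z. gauss_kernel s (z::'a::euclidean_space) * norm z)"
    and "(\<integral>z. gauss_kernel s (z::'a) * norm z \<partial>lborel) \<le> sqrt s * sqrt 2 ^ DIM('a)"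
proof -
  have bound: "gauss_kernel s z * norm z \<le> sqrt s * sqrt 2 ^ DIM('a) * gauss_kernel (2 * s) z" for z :: 'a
  proof -
    define y where "y = norm z / sqrt s"
    have z: "norm z = sqrt s * y" and ysq: "(norm z)\<^sup>2 = s * y\<^sup>2" "y \<ge> 0"
      using assms by (auto simp: y_def power_divide)
    have "0 \<le> (y / 2 - 1)\<^sup>2" by simp
    then have "y \<le> 1 + y\<^sup>2 / 4" by (simp add: power2_eq_square field_simps)
    also have "\<dots> \<le> exp (y\<^sup>2 / 4)" by (rule exp_ge_add_one_self)
    finally have "y * exp (- y\<^sup>2 / 2) \<le> exp (y\<^sup>2 / 4) * exp (- y\<^sup>2 / 2)" by simp
    also have "\<dots> = exp (- y\<^sup>2 / 4)" by (simp add: exp_add[symmetric])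
    finally have "y * exp (- y\<^sup>2 / 2) \<le> exp (- y\<^sup>2 / 4)" .
    then have "sqrt s * (y * exp (- y\<^sup>2 / 2)) / sqrt (2 * pi * s) ^ DIM('a)
        \<le> sqrt s * exp (- y\<^sup>2 / 4) / sqrt (2 * pi * s) ^ DIM('a)"
      using assms by (intro divide_right_mono mult_left_mono) auto
    also have "\<dots> = sqrt s * sqrt 2 ^ DIM('a) * (exp (- y\<^sup>2 / 4) / sqrt (2 * pi * (2 * s)) ^ DIM('a))"
    proof -
      have "2 * pi * (2 * s) = 2 * (2 * pi * s)" by simp
      then have "sqrt (2 * pi * (2 * s)) ^ DIM('a) = sqrt 2 ^ DIM('a) * sqrt (2 * pi * s) ^ DIM('a)"
        by (simp only: real_sqrt_mult[of 2] power_mult_distrib)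
      then show ?thesis by simp
    qed
    finally show ?thesis using assms by (simp add: gauss_kernel_def ysq) (simp add: z mult_ac)
  qed
  have int2: "integrable lborel (\<lambda>z::'a. sqrt s * sqrt 2 ^ DIM('a) * gauss_kernel (2 * s) z)"
    using assms by (intro integrable_mult_right gauss_kernel_integral) auto
  show int1: "integrable lborel (\<lambda>z::'a. gauss_kernel s z * norm z)"
    by (rule Bochner_Integration.integrable_bound[OF int2])
       (use bound assms in \<open>auto simp: gauss_kernel_nonneg abs_mult intro: order_trans[OF _ bound]\<close>)
  have "(\<integral>z. gauss_kernel s (z::'a) * norm z \<partial>lborel) \<le> (\<integral>z. sqrt s * sqrt 2 ^ DIM('a) * gauss_kernel (2 * s) (z::'a) \<partial>lborel)"
    by (rule integral_mono[OF int1 int2]) (rule bound)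
  also have "\<dots> = sqrt s * sqrt 2 ^ DIM('a)"
    using gauss_kernel_integral(2)[of "2 * s"] assms by simp
  finally show "(\<integral>z. gauss_kernel s (z::'a) * norm z \<partial>lborel) \<le> sqrt s * sqrt 2 ^ DIM('a)" .
qed

section \<open>Spectra and the Gaussian Plancherel identity\<close>

text \<open>The real and, up to sign, the imaginary part of the Fourier transform
  \<open>\<integral> exp (-i \<xi> \<bullet> x) g x dx\<close>, and the square of its modulus.\<close>

definition cos_transform :: "('a::euclidean_space \<Rightarrow> real) \<Rightarrow> 'a \<Rightarrow> real" where
  "cos_transform g \<xi> = (\<integral>x. cos (\<xi> \<bullet> x) * g x \<partial>lborel)"

definition sin_transform :: "('a::euclidean_space \<Rightarrow> real) \<Rightarrow> 'a \<Rightarrow> real" where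
  "sin_transform g \<xi> = (\<integral>x. sin (\<xi> \<bullet> x) * g x \<partial>lborel)"

definition spectrum :: "('a::euclidean_space \<Rightarrow> real) \<Rightarrow> 'a \<Rightarrow> real" where
  "spectrum g \<xi> = (cos_transform g \<xi>)\<^sup>2 + (sin_transform g \<xi>)\<^sup>2"

lemma spectrum_nonneg: "spectrum g \<xi> \<ge> 0"
  by (simp add: spectrum_def)

lemma integrable_trig_mult:
  fixes g :: "'a::euclidean_space \<Rightarrow> real"
  assumes "integrable lborel g"
  shows "integrable lborel (\<lambda>x. cos (\<xi> \<bullet> x) * g x)" "integrable lborel (\<lambda>x. sin (\<xi> \<bullet> x) * g x)"
proof -
  have [measurable]: "g \<in> borel_measurable borel" using assms borel_measurable_integrable by fastforce
  show "integrable lborel (\<lambda>x. cos (\<xi> \<bullet> x) * g x)"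
    by (rule Bochner_Integration.integrable_bound[OF assms]) (auto simp: abs_mult mult_left_le_one_le)
  show "integrable lborel (\<lambda>x. sin (\<xi> \<bullet> x) * g x)"
    by (rule Bochner_Integration.integrable_bound[OF assms]) (auto simp: abs_mult mult_left_le_one_le)
qed

lemma spectrum_double_integral:
  fixes g :: "'a::euclidean_space \<Rightarrow> real"
  assumes g: "integrable lborel g"
  shows "spectrum g \<xi> = (\<integral>p. g (fst p) * g (snd p) * cos (\<xi> \<bullet> (fst p - snd p)) \<partial>(lborel \<Otimes>\<^sub>M lborel))"
proof -
  let ?c = "\<lambda>x. cos (\<xi> \<bullet> x) * g x" and ?s = "\<lambda>x. sin (\<xi> \<bullet> x) * g x"
  note ci = integrable_trig_mult(1)[OF g, of \<xi>] and si = integrable_trig_mult(2)[OF g, of \<xi>]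
  have c2: "integrable (lborel \<Otimes>\<^sub>M lborel) (\<lambda>p. ?c (fst p) * ?c (snd p))"
    using integrable_prod_mult[OF ci ci] by (simp add: case_prod_beta')
  have s2: "integrable (lborel \<Otimes>\<^sub>M lborel) (\<lambda>p. ?s (fst p) * ?s (snd p))"
    using integrable_prod_mult[OF si si] by (simp add: case_prod_beta')
  have "(\<integral>p. g (fst p) * g (snd p) * cos (\<xi> \<bullet> (fst p - snd p)) \<partial>(lborel \<Otimes>\<^sub>M lborel))
     = (\<integral>p. ?c (fst p) * ?c (snd p) + ?s (fst p) * ?s (snd p) \<partial>(lborel \<Otimes>\<^sub>M lborel))"
    by (intro Bochner_Integration.integral_cong) (auto simp: inner_diff_right cos_diff algebra_simps)
  also have "\<dots> = (\<integral>p. ?c (fst p) * ?c (snd p) \<partial>(lborel \<Otimes>\<^sub>M lborel)) + (\<integral>p. ?s (fst p) * ?s (snd p) \<partial>(lborel \<Otimes>\<^sub>M lborel))"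
    by (rule Bochner_Integration.integral_add[OF c2 s2])
  also have "(\<integral>p. ?c (fst p) * ?c (snd p) \<partial>(lborel \<Otimes>\<^sub>M lborel)) = (cos_transform g \<xi>)\<^sup>2"
    using lborel_pair.integral_fst'[OF c2] by (simp add: cos_transform_def power2_eq_square)
  also have "(\<integral>p. ?s (fst p) * ?s (snd p) \<partial>(lborel \<Otimes>\<^sub>M lborel)) = (sin_transform g \<xi>)\<^sup>2"
    using lborel_pair.integral_fst'[OF s2] by (simp add: sin_transform_def power2_eq_square)
  finally show ?thesis by (simp add: spectrum_def)
qed

lemma gaussian_spectrum_double_integral:
  fixes g :: "'a::euclidean_space \<Rightarrow> real"
  assumes g: "integrable lborel g" and s: "s > 0"
  shows "integrable lborel (\<lambda>\<xi>. exp (- s * (norm \<xi>)\<^sup>2 / 2) * spectrum g \<xi>)"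
    and "(\<integral>\<xi>. exp (- s * (norm \<xi>)\<^sup>2 / 2) * spectrum g \<xi> \<partial>lborel)
      = (2 * pi) ^ DIM('a) * (\<integral>p. g (fst p) * g (snd p) * gauss_kernel s (snd p - fst p) \<partial>(lborel \<Otimes>\<^sub>M lborel))"
proof -
  let ?E = "\<lambda>\<xi>::'a. exp (- s * (norm \<xi>)\<^sup>2 / 2)"
  have [measurable]: "g \<in> borel_measurable borel" using g borel_measurable_integrable by fastforce
  define H where "H = (\<lambda>(\<xi>::'a, p::'a\<times>'a). ?E \<xi> * (g (fst p) * g (snd p) * cos (\<xi> \<bullet> (fst p - snd p))))"
  have gg: "integrable lborel (\<lambda>p::'a\<times>'a. g (fst p) * g (snd p))"
    using integrable_prod_mult[OF g g] by (simp add: case_prod_beta' lborel_prod)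
  have dom: "integrable (lborel \<Otimes>\<^sub>M lborel) (\<lambda>(\<xi>::'a, p::'a\<times>'a). ?E \<xi> * (g (fst p) * g (snd p)))"
    by (rule integrable_prod_mult[OF gaussian_fourier(1)[OF s] gg])
  have Hi: "integrable (lborel \<Otimes>\<^sub>M lborel) H"
  proof (rule Bochner_Integration.integrable_bound[OF dom])
    show "H \<in> borel_measurable (lborel \<Otimes>\<^sub>M lborel)"
      unfolding H_def measurable_lborel2 lborel_prod[symmetric] by measurable
    show "AE x in lborel \<Otimes>\<^sub>M lborel. norm (H x) \<le> norm (case x of (\<xi>, p) \<Rightarrow> ?E \<xi> * (g (fst p) * g (snd p)))"
      by (intro AE_I2) (auto simp: H_def abs_mult case_prod_beta intro!: mult_left_mono mult_right_le_one_le)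
  qed
  have inner: "(\<integral>p. H (\<xi>, p) \<partial>lborel) = ?E \<xi> * spectrum g \<xi>" for \<xi>
    unfolding H_def spectrum_double_integral[OF g] lborel_prod[symmetric] by simp
  show "integrable lborel (\<lambda>\<xi>. ?E \<xi> * spectrum g \<xi>)"
    using lborel_pair.integrable_fst'[OF Hi] by (simp only: inner)
  have "(\<integral>\<xi>. ?E \<xi> * spectrum g \<xi> \<partial>lborel) = (\<integral>\<xi>. (\<integral>p. H (\<xi>, p) \<partial>lborel) \<partial>lborel)"
    by (simp only: inner)
  also have "\<dots> = (\<integral>p. (\<integral>\<xi>. H (\<xi>, p) \<partial>lborel) \<partial>lborel)"
    using lborel_pair.Fubini_integral[of "\<lambda>\<xi> p. H (\<xi>, p)"] Hi by simp
  also have "(\<lambda>p. (\<integral>\<xi>. H (\<xi>, p) \<partial>lborel)) = (\<lambda>p. (2 * pi) ^ DIM('a) * (g (fst p) * g (snd p) * gauss_kernel s (snd p - fst p)))"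
  proof
    fix p :: "'a \<times> 'a"
    have "cos (\<xi> \<bullet> (fst p - snd p)) = cos (\<xi> \<bullet> (snd p - fst p))" for \<xi>
      by (metis cos_minus inner_minus_right minus_diff_eq)
    then have "H (\<xi>, p) = (g (fst p) * g (snd p)) * (?E \<xi> * cos (\<xi> \<bullet> (snd p - fst p)))" for \<xi>
      by (simp add: H_def mult_ac)
    then have "(\<integral>\<xi>. H (\<xi>, p) \<partial>lborel) = (g (fst p) * g (snd p)) * (\<integral>\<xi>. ?E \<xi> * cos (\<xi> \<bullet> (snd p - fst p)) \<partial>lborel)"
      by (simp only: integral_mult_right_zero)
    also have "\<dots> = (g (fst p) * g (snd p)) * (sqrt (2 * pi / s) ^ DIM('a) * exp (- (norm (snd p - fst p))\<^sup>2 / (2 * s)))"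
      by (subst gaussian_fourier(2)[OF s]) simp
    also have "sqrt (2 * pi / s) = (2 * pi) / sqrt (2 * pi * s)"
      using s by (simp add: real_sqrt_divide real_sqrt_mult field_simps)
    finally show "(\<integral>\<xi>. H (\<xi>, p) \<partial>lborel) = (2 * pi) ^ DIM('a) * (g (fst p) * g (snd p) * gauss_kernel s (snd p - fst p))"
      by (simp add: gauss_kernel_def power_divide)
  qed
  finally show "(\<integral>\<xi>. ?E \<xi> * spectrum g \<xi> \<partial>lborel)
      = (2 * pi) ^ DIM('a) * (\<integral>p. g (fst p) * g (snd p) * gauss_kernel s (snd p - fst p) \<partial>(lborel \<Otimes>\<^sub>M lborel))"
    by (simp add: lborel_prod)
qed

text \<open>The squared \<open>L\<^sup>2\<close> distance between a function and its translate by \<open>z\<close>.\<close>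

definition shift_defect :: "('a::euclidean_space \<Rightarrow> real) \<Rightarrow> 'a \<Rightarrow> real" where
  "shift_defect g z = (\<integral>x. (g (x + z) - g x)\<^sup>2 \<partial>lborel)"

lemma shift_defect_nonneg: "shift_defect g z \<ge> 0"
  by (simp add: shift_defect_def)

lemma product_le_squares: "\<bar>a * b\<bar> \<le> a\<^sup>2 + b\<^sup>2" for a b :: real
proof -
  have "0 \<le> (\<bar>a\<bar> - \<bar>b\<bar>)\<^sup>2" by simp
  then have "2 * (\<bar>a\<bar> * \<bar>b\<bar>) \<le> a\<^sup>2 + b\<^sup>2" by (simp add: power2_diff)
  moreover have "0 \<le> \<bar>a\<bar> * \<bar>b\<bar>" by simp
  ultimately show ?thesis by (simp only: abs_mult)
qed

text \<open>The correlation \<open>\<integral> g x * g (x + z) dx\<close> equals \<open>\<integral> g\<^sup>2\<close> minus half the translation defect, and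
  the Gaussian kernel has mass one.\<close>

lemma gaussian_plancherel:
  fixes g :: "'a::euclidean_space \<Rightarrow> real"
  assumes g: "integrable lborel g" and g2: "integrable lborel (\<lambda>x. (g x)\<^sup>2)" and s: "s > 0"
  shows "integrable lborel (\<lambda>z. gauss_kernel s z * shift_defect g z)"
    and "(\<integral>\<xi>. exp (- s * (norm \<xi>)\<^sup>2 / 2) * spectrum g \<xi> \<partial>lborel)
      = (2 * pi) ^ DIM('a) * ((\<integral>x. (g x)\<^sup>2 \<partial>lborel) - (\<integral>z. gauss_kernel s z * shift_defect g z \<partial>lborel) / 2)"
proof -
  have [measurable]: "g \<in> borel_measurable borel" using g borel_measurable_integrable by fastforce
  let ?G = "gauss_kernel s :: 'a \<Rightarrow> real"
  have Gi: "integrable lborel ?G" using gauss_kernel_integral(1)[OF s] .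
  have sh: "integrable lborel (\<lambda>x. (g (x + z))\<^sup>2)" "(\<integral>x. (g (x + z))\<^sup>2 \<partial>lborel) = (\<integral>x. (g x)\<^sup>2 \<partial>lborel)" for z
    using lborel_shift[of "\<lambda>x. (g x)\<^sup>2" z] g2 by (auto simp: add.commute)
  have a1: "integrable (lborel \<Otimes>\<^sub>M lborel) (\<lambda>(z, x). ?G z * (g x)\<^sup>2)"
    by (rule integrable_prod_mult[OF Gi g2])
  have a2: "integrable (lborel \<Otimes>\<^sub>M lborel) (\<lambda>(z, x). ?G z * (g (x + z))\<^sup>2)"
  proof (rule lborel_pair.Fubini_integrable)
    show "integrable lborel (\<lambda>z. \<integral>x. norm (case (z, x) of (z, x) \<Rightarrow> ?G z * (g (x + z))\<^sup>2) \<partial>lborel)"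
      using Gi by (simp add: abs_mult sh)
    show "AE z in lborel. integrable lborel (\<lambda>x. case (z, x) of (z, x) \<Rightarrow> ?G z * (g (x + z))\<^sup>2)"
      using sh by simp
  qed measurable
  have a3: "integrable (lborel \<Otimes>\<^sub>M lborel) (\<lambda>(z, x). ?G z * (g x * g (x + z)))"
  proof (rule Bochner_Integration.integrable_bound[OF Bochner_Integration.integrable_add[OF a1 a2]])
    have "\<bar>?G z * (g x * g (x + z))\<bar> \<le> \<bar>?G z * (g x)\<^sup>2 + ?G z * (g (x + z))\<^sup>2\<bar>" for z x
    proof -
      have "\<bar>?G z * (g x * g (x + z))\<bar> \<le> ?G z * ((g x)\<^sup>2 + (g (x + z))\<^sup>2)"
        unfolding abs_mult[of "?G z"] using gauss_kernel_nonneg[OF s, of z]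
        by (simp add: mult_left_mono product_le_squares)
      then show ?thesis by (simp add: distrib_left)
    qed
    then show "AE p in lborel \<Otimes>\<^sub>M lborel. norm (case p of (z, x) \<Rightarrow> ?G z * (g x * g (x + z)))
       \<le> norm ((case p of (z, x) \<Rightarrow> ?G z * (g x)\<^sup>2) + (case p of (z, x) \<Rightarrow> ?G z * (g (x + z))\<^sup>2))"
      by (intro AE_I2) (simp add: case_prod_beta)
  qed measurable
  have cross: "integrable lborel (\<lambda>x. g x * g (x + z))" for z
    by (rule Bochner_Integration.integrable_bound[OF Bochner_Integration.integrable_add[OF g2 sh(1)[of z]]])
       (auto intro: product_le_squares)
  have corr: "(\<integral>x. g x * g (x + z) \<partial>lborel) = (\<integral>x. (g x)\<^sup>2 \<partial>lborel) - shift_defect g z / 2" for z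
  proof -
    have "shift_defect g z = (\<integral>x. (g (x + z))\<^sup>2 + (g x)\<^sup>2 - 2 * (g x * g (x + z)) \<partial>lborel)"
      unfolding shift_defect_def by (intro Bochner_Integration.integral_cong) (auto simp: power2_diff)
    also have "\<dots> = (\<integral>x. (g x)\<^sup>2 \<partial>lborel) + (\<integral>x. (g x)\<^sup>2 \<partial>lborel) - 2 * (\<integral>x. g x * g (x + z) \<partial>lborel)"
      using g2 sh cross by simp
    finally show ?thesis by linarith
  qed
  have b3: "integrable lborel (\<lambda>z. ?G z * ((\<integral>x. (g x)\<^sup>2 \<partial>lborel) - shift_defect g z / 2))"
    using lborel_pair.integrable_fst'[OF a3] by (simp add: corr)
  have b1: "integrable lborel (\<lambda>z. ?G z * (\<integral>x. (g x)\<^sup>2 \<partial>lborel))"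
    using Gi by simp
  have "integrable lborel (\<lambda>z. 2 * (?G z * (\<integral>x. (g x)\<^sup>2 \<partial>lborel) - ?G z * ((\<integral>x. (g x)\<^sup>2 \<partial>lborel) - shift_defect g z / 2)))"
    by (intro integrable_mult_right Bochner_Integration.integrable_diff b1 b3)
  then show int: "integrable lborel (\<lambda>z. ?G z * shift_defect g z)"
    by (simp add: algebra_simps)
  have meas: "(\<lambda>p. g (fst p) * g (snd p) * ?G (snd p - fst p)) \<in> borel_measurable (lborel \<Otimes>\<^sub>M lborel)"
    by measurable
  have pint: "integrable (lborel \<Otimes>\<^sub>M lborel) (\<lambda>p. g (fst p) * g (snd p) * ?G (snd p - fst p))"
  proof -
    have gg: "integrable (lborel \<Otimes>\<^sub>M lborel) (\<lambda>(x, y). (g x * (1 / sqrt (2 * pi * s) ^ DIM('a))) * g y)"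
      using g by (intro integrable_prod_mult) auto
    have G_le: "\<bar>?G z\<bar> \<le> 1 / sqrt (2 * pi * s) ^ DIM('a)" for z
      using s by (auto simp: gauss_kernel_def abs_mult intro!: divide_right_mono)
    have "\<bar>g x * g y * ?G (y - x)\<bar> \<le> \<bar>g x\<bar> * (1 / \<bar>sqrt (2 * pi * s) ^ DIM('a)\<bar>) * \<bar>g y\<bar>" for x y
    proof -
      have "\<bar>g x * g y * ?G (y - x)\<bar> = (\<bar>g x\<bar> * \<bar>g y\<bar>) * \<bar>?G (y - x)\<bar>" by (simp add: abs_mult)
      also have "\<dots> \<le> (\<bar>g x\<bar> * \<bar>g y\<bar>) * (1 / sqrt (2 * pi * s) ^ DIM('a))"
        by (intro mult_left_mono G_le) auto
      also have "\<dots> = \<bar>g x\<bar> * (1 / \<bar>sqrt (2 * pi * s) ^ DIM('a)\<bar>) * \<bar>g y\<bar>" using s by simp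
      finally show ?thesis .
    qed
    then show ?thesis
      by (intro Bochner_Integration.integrable_bound[OF gg meas]) (auto simp: abs_mult)
  qed
  have "(\<integral>p. g (fst p) * g (snd p) * ?G (snd p - fst p) \<partial>(lborel \<Otimes>\<^sub>M lborel))
      = (\<integral>x. \<integral>y. g x * g y * ?G (y - x) \<partial>lborel \<partial>lborel)"
    using lborel_pair.integral_fst'[OF pint] by simp
  also have "\<dots> = (\<integral>x. \<integral>z. ?G z * (g x * g (x + z)) \<partial>lborel \<partial>lborel)"
  proof (rule Bochner_Integration.integral_cong[OF refl])
    fix x
    show "(\<integral>y. g x * g y * ?G (y - x) \<partial>lborel) = (\<integral>z. ?G z * (g x * g (x + z)) \<partial>lborel)"
      using lborel_shift(2)[of "\<lambda>y. g x * g y * ?G (y - x)" x] by (simp add: mult_ac)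
  qed
  also have "\<dots> = (\<integral>z. \<integral>x. ?G z * (g x * g (x + z)) \<partial>lborel \<partial>lborel)"
    by (rule lborel_pair.Fubini_integral[OF a3])
  also have "\<dots> = (\<integral>z. ?G z * (\<integral>x. (g x)\<^sup>2 \<partial>lborel) - (1/2) * (?G z * shift_defect g z) \<partial>lborel)"
    by (rule Bochner_Integration.integral_cong) (simp_all add: corr right_diff_distrib)
  also have "\<dots> = (\<integral>x. (g x)\<^sup>2 \<partial>lborel) - (\<integral>z. ?G z * shift_defect g z \<partial>lborel) / 2"
    using int Gi gauss_kernel_integral(2)[OF s, where 'a='a] by (subst Bochner_Integration.integral_diff) auto
  finally show "(\<integral>\<xi>. exp (- s * (norm \<xi>)\<^sup>2 / 2) * spectrum g \<xi> \<partial>lborel)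
      = (2 * pi) ^ DIM('a) * ((\<integral>x. (g x)\<^sup>2 \<partial>lborel) - (\<integral>z. ?G z * shift_defect g z \<partial>lborel) / 2)"
    using gaussian_spectrum_double_integral(2)[OF g s] by simp
qed

lemma gaussian_spectrum_le:
  fixes g :: "'a::euclidean_space \<Rightarrow> real"
  assumes "integrable lborel g" "integrable lborel (\<lambda>x. (g x)\<^sup>2)" "s > 0"
  shows "(\<integral>\<xi>. exp (- s * (norm \<xi>)\<^sup>2 / 2) * spectrum g \<xi> \<partial>lborel) \<le> (2 * pi) ^ DIM('a) * (\<integral>x. (g x)\<^sup>2 \<partial>lborel)"
proof -
  have "0 \<le> (\<integral>z. gauss_kernel s z * shift_defect g z \<partial>lborel)"
    using assms by (intro integral_nonneg_AE) (simp add: gauss_kernel_nonneg shift_defect_nonneg)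
  then show ?thesis unfolding gaussian_plancherel(2)[OF assms] by (intro mult_left_mono) auto
qed


section \<open>Multipliers that degenerate on hyperplanes\<close>

text \<open>The mean of \<open>n\<close> translates of \<open>g\<close>, spaced by \<open>h\<close>.  If the translates have disjoint supports,
  the mean has only the fraction \<open>1/n\<close> of the squared norm of \<open>g\<close>; at frequencies almost orthogonal to \<open>h\<close>,
  however, all translates are nearly in phase and the spectrum is not much reduced.  Together this
  shows that the spectrum of a function of bounded support has little mass in a thin slab.\<close>

definition shift_average :: "nat \<Rightarrow> 'a::euclidean_space \<Rightarrow> ('a \<Rightarrow> real) \<Rightarrow> 'a \<Rightarrow> real" where
  "shift_average n h g x = (\<Sum>k<n. g (x - real k *\<^sub>R h)) / real n"

lemma shift_average_integrable:
  fixes g :: "'a::euclidean_space \<Rightarrow> real"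
  assumes g: "integrable lborel g"
  shows "integrable lborel (shift_average n h g)"
proof -
  have [measurable]: "g \<in> borel_measurable borel" using g borel_measurable_integrable by fastforce
  have "integrable lborel (\<lambda>x. g (x - real k *\<^sub>R h))" for k
    using lborel_shift(1)[of g "- (real k *\<^sub>R h)"] g by simp
  then show ?thesis unfolding shift_average_def by auto
qed

lemma shift_average_spectrum:
  fixes g :: "'a::euclidean_space \<Rightarrow> real"
  assumes g: "integrable lborel g" and n: "n > 0" and small: "real n * \<bar>\<xi> \<bullet> h\<bar> \<le> 1"
  shows "spectrum g \<xi> \<le> 4 * spectrum (shift_average n h g) \<xi>"
proof -
  have [measurable]: "g \<in> borel_measurable borel" using g borel_measurable_integrable by fastforce
  define \<theta> where "\<theta> = \<xi> \<bullet> h"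
  define a where "a = (\<Sum>k<n. cos (real k * \<theta>)) / real n"
  define b where "b = (\<Sum>k<n. sin (real k * \<theta>)) / real n"
  have gk: "integrable lborel (\<lambda>x. g (x - real k *\<^sub>R h))" for k
    using lborel_shift(1)[of g "- (real k *\<^sub>R h)"] g by simp
  note ti = integrable_trig_mult[OF g, of \<xi>]
  have inner: "\<xi> \<bullet> (real k *\<^sub>R h + x) = \<xi> \<bullet> x + real k * \<theta>" for k x
    by (simp add: inner_add_right \<theta>_def)
  have ck: "(\<integral>x. cos (\<xi> \<bullet> x) * g (x - real k *\<^sub>R h) \<partial>lborel)
      = cos (real k * \<theta>) * cos_transform g \<xi> - sin (real k * \<theta>) * sin_transform g \<xi>" for k
  proof -
    have "(\<integral>x. cos (\<xi> \<bullet> x) * g (x - real k *\<^sub>R h) \<partial>lborel) = (\<integral>x. cos (\<xi> \<bullet> (real k *\<^sub>R h + x)) * g x \<partial>lborel)"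
      using lborel_shift(2)[of "\<lambda>x. cos (\<xi> \<bullet> x) * g (x - real k *\<^sub>R h)" "real k *\<^sub>R h"] by simp
    also have "\<dots> = (\<integral>x. cos (real k * \<theta>) * (cos (\<xi> \<bullet> x) * g x) - sin (real k * \<theta>) * (sin (\<xi> \<bullet> x) * g x) \<partial>lborel)"
      unfolding inner by (intro Bochner_Integration.integral_cong) (auto simp: cos_add algebra_simps)
    finally show ?thesis using ti by (simp add: cos_transform_def sin_transform_def)
  qed
  have sk: "(\<integral>x. sin (\<xi> \<bullet> x) * g (x - real k *\<^sub>R h) \<partial>lborel)
      = cos (real k * \<theta>) * sin_transform g \<xi> + sin (real k * \<theta>) * cos_transform g \<xi>" for k
  proof -
    have "(\<integral>x. sin (\<xi> \<bullet> x) * g (x - real k *\<^sub>R h) \<partial>lborel) = (\<integral>x. sin (\<xi> \<bullet> (real k *\<^sub>R h + x)) * g x \<partial>lborel)"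
      using lborel_shift(2)[of "\<lambda>x. sin (\<xi> \<bullet> x) * g (x - real k *\<^sub>R h)" "real k *\<^sub>R h"] by simp
    also have "\<dots> = (\<integral>x. cos (real k * \<theta>) * (sin (\<xi> \<bullet> x) * g x) + sin (real k * \<theta>) * (cos (\<xi> \<bullet> x) * g x) \<partial>lborel)"
      unfolding inner by (intro Bochner_Integration.integral_cong) (auto simp: sin_add algebra_simps)
    finally show ?thesis using ti by (simp add: cos_transform_def sin_transform_def)
  qed
  have "cos_transform (shift_average n h g) \<xi> = (\<integral>x. (\<Sum>k<n. cos (\<xi> \<bullet> x) * g (x - real k *\<^sub>R h)) / real n \<partial>lborel)"
    by (simp add: cos_transform_def shift_average_def sum_distrib_left)
  also have "\<dots> = (\<Sum>k<n. cos (real k * \<theta>) * cos_transform g \<xi> - sin (real k * \<theta>) * sin_transform g \<xi>) / real n"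
    using integrable_trig_mult[OF gk] by (simp add: ck)
  finally have C: "cos_transform (shift_average n h g) \<xi> = a * cos_transform g \<xi> - b * sin_transform g \<xi>"
    by (simp add: a_def b_def sum_subtractf sum_distrib_right diff_divide_distrib sum_divide_distrib)
  have "sin_transform (shift_average n h g) \<xi> = (\<integral>x. (\<Sum>k<n. sin (\<xi> \<bullet> x) * g (x - real k *\<^sub>R h)) / real n \<partial>lborel)"
    by (simp add: sin_transform_def shift_average_def sum_distrib_left)
  also have "\<dots> = (\<Sum>k<n. cos (real k * \<theta>) * sin_transform g \<xi> + sin (real k * \<theta>) * cos_transform g \<xi>) / real n"
    using integrable_trig_mult[OF gk] by (simp add: sk)
  finally have S: "sin_transform (shift_average n h g) \<xi> = a * sin_transform g \<xi> + b * cos_transform g \<xi>"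
    by (simp add: a_def b_def sum.distrib sum_distrib_right add_divide_distrib sum_divide_distrib)
  \<comment> \<open>All phases are at most one radian, less than a sixth of a turn.\<close>
  have "1/2 \<le> cos (real k * \<theta>)" if "k < n" for k
  proof -
    have "\<bar>real k * \<theta>\<bar> \<le> real n * \<bar>\<theta>\<bar>" using that by (simp add: abs_mult mult_right_mono)
    also have "\<dots> \<le> 1" using small by (simp add: \<theta>_def)
    also have "1 \<le> pi / 3" using pi_gt3 by simp
    finally have "cos (pi / 3) \<le> cos \<bar>real k * \<theta>\<bar>" by (intro cos_monotone_0_pi_le) auto
    then show ?thesis by (simp add: cos_60)
  qed
  then have "(\<Sum>k<n. 1/2) \<le> (\<Sum>k<n. cos (real k * \<theta>))" by (intro sum_mono) auto
  then have "1/2 \<le> a" using n by (simp add: a_def field_simps)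
  then have "(1/2)\<^sup>2 \<le> a\<^sup>2" by (intro power_mono) auto
  then have "1/4 \<le> a\<^sup>2" by (simp add: power_divide)
  then have "1/4 \<le> a\<^sup>2 + b\<^sup>2" using zero_le_power2[of b] by linarith
  moreover have "spectrum (shift_average n h g) \<xi> = (a\<^sup>2 + b\<^sup>2) * spectrum g \<xi>"
    unfolding spectrum_def C S by (simp add: power2_eq_square algebra_simps)
  ultimately show ?thesis
    using mult_right_mono[of "1/4" "a\<^sup>2 + b\<^sup>2" "spectrum g \<xi>"] spectrum_nonneg[of g \<xi>] by simp
qed

lemma shift_average_square:
  fixes g :: "'a::euclidean_space \<Rightarrow> real"
  assumes g: "integrable lborel g" and g2: "integrable lborel (\<lambda>x. (g x)\<^sup>2)"
    and supp: "\<And>x. g x \<noteq> 0 \<Longrightarrow> norm x < \<rho>" and h: "norm h = 2 * \<rho>" and n: "n > 0"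
  shows "integrable lborel (\<lambda>x. (shift_average n h g x)\<^sup>2)"
    and "(\<integral>x. (shift_average n h g x)\<^sup>2 \<partial>lborel) = (\<integral>x. (g x)\<^sup>2 \<partial>lborel) / real n"
proof -
  have [measurable]: "g \<in> borel_measurable borel" using g borel_measurable_integrable by fastforce
  have disj: "g (x - real k *\<^sub>R h) * g (x - real l *\<^sub>R h) = 0" if "k \<noteq> l" for k l x
  proof (rule ccontr)
    assume "\<not> ?thesis"
    then have *: "norm (x - real k *\<^sub>R h) < \<rho>" "norm (x - real l *\<^sub>R h) < \<rho>" using supp by auto
    have "norm ((x - real k *\<^sub>R h) - (x - real l *\<^sub>R h)) \<le> norm (x - real k *\<^sub>R h) + norm (x - real l *\<^sub>R h)"
      by (rule norm_triangle_ineq4)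
    also have "\<dots> < 2 * \<rho>" using * by simp
    also have "(x - real k *\<^sub>R h) - (x - real l *\<^sub>R h) = (real l - real k) *\<^sub>R h" by (simp add: algebra_simps)
    finally have "\<bar>real l - real k\<bar> * (2 * \<rho>) < 2 * \<rho>" by (simp add: h)
    moreover have "1 \<le> \<bar>real l - real k\<bar>" using that by linarith
    moreover have "0 \<le> 2 * \<rho>" using h norm_ge_zero[of h] by simp
    ultimately show False using mult_right_mono[of 1 "\<bar>real l - real k\<bar>" "2 * \<rho>"] by simp
  qed
  have sq: "(\<Sum>k<n. g (x - real k *\<^sub>R h))\<^sup>2 = (\<Sum>k<n. (g (x - real k *\<^sub>R h))\<^sup>2)" for x
  proof -
    have "(\<Sum>k<n. g (x - real k *\<^sub>R h))\<^sup>2 = (\<Sum>k<n. \<Sum>l<n. g (x - real k *\<^sub>R h) * g (x - real l *\<^sub>R h))"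
      by (simp add: power2_eq_square sum_product)
    also have "\<dots> = (\<Sum>k<n. \<Sum>l<n. if k = l then (g (x - real k *\<^sub>R h))\<^sup>2 else 0)"
      by (intro sum.cong refl) (simp add: disj power2_eq_square)
    finally show ?thesis by simp
  qed
  have gk: "integrable lborel (\<lambda>x. (g (x - real k *\<^sub>R h))\<^sup>2)"
    "(\<integral>x. (g (x - real k *\<^sub>R h))\<^sup>2 \<partial>lborel) = (\<integral>x. (g x)\<^sup>2 \<partial>lborel)" for k
    using lborel_shift[of "\<lambda>x. (g x)\<^sup>2" "- (real k *\<^sub>R h)"] g2 by auto
  show "integrable lborel (\<lambda>x. (shift_average n h g x)\<^sup>2)"
    unfolding shift_average_def power_divide sq using gk by auto
  show "(\<integral>x. (shift_average n h g x)\<^sup>2 \<partial>lborel) = (\<integral>x. (g x)\<^sup>2 \<partial>lborel) / real n"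
    unfolding shift_average_def power_divide sq using gk n by (simp add: power2_eq_square)
qed

text \<open>Away from the hyperplanes orthogonal to \<open>N\<close> the spectrum of \<open>g\<close> is dominated by that of \<open>w\<close>, with a
  constant that blows up like \<open>t^(-2L)\<close> at angular distance \<open>t\<close>.  The conclusion
  controls \<open>\<integral> g\<^sup>2\<close> by \<open>w\<close> and the oscillation of \<open>g\<close> at scale \<open>1/R\<close>.\<close>

lemma degenerate_multiplier_estimate:
  fixes N :: "'a::euclidean_space set" and \<rho> c :: real and L :: nat
  assumes N: "finite N" "\<And>\<nu>. \<nu> \<in> N \<Longrightarrow> norm \<nu> = 1" "N \<noteq> {}" and \<rho>: "\<rho> > 0" and c: "c \<ge> 0"
  shows "\<exists>C>0. \<forall>R\<ge>1. \<forall>g (w :: 'i::finite \<Rightarrow> 'a \<Rightarrow> real).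
     integrable lborel g \<longrightarrow> integrable lborel (\<lambda>x. (g x)\<^sup>2) \<longrightarrow> (\<forall>x. g x \<noteq> 0 \<longrightarrow> norm x < \<rho>) \<longrightarrow>
     (\<forall>i. integrable lborel (w i) \<and> integrable lborel (\<lambda>x. (w i x)\<^sup>2)) \<longrightarrow>
     (\<forall>\<xi> t. \<xi> \<noteq> 0 \<longrightarrow> 0 < t \<longrightarrow> (\<forall>\<nu>\<in>N. t * norm \<xi> \<le> \<bar>\<xi> \<bullet> \<nu>\<bar>) \<longrightarrow>
        t ^ (2 * L) * spectrum g \<xi> \<le> c * (\<Sum>i\<in>UNIV. spectrum (w i) \<xi>)) \<longrightarrow>
     (\<integral>x. (g x)\<^sup>2 \<partial>lborel) \<le> C * R ^ (2 * L) * (\<Sum>i\<in>UNIV. \<integral>x. (w i x)\<^sup>2 \<partial>lborel)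
        + (\<integral>z. gauss_kernel (1 / R\<^sup>2) z * shift_defect g z \<partial>lborel)"
proof -
  \<comment> \<open>The slabs together carry at most a quarter of the weighted mass, and so do the
    frequencies beyond \<open>3 * R\<close>; the left-hand side absorbs both.\<close>
  define n where "n = 16 * (card N + 1)"
  have n: "n > 0" "real (card N) * 16 \<le> real n" by (auto simp: n_def)
  define q where "q = 6 * \<rho> * real n"
  have q: "q > 0" using \<rho> n by (simp add: q_def)
  show ?thesis
  proof (intro exI[of _ "2 * c * q ^ (2 * L) + 1"] conjI allI impI)
    show "0 < 2 * c * q ^ (2 * L) + 1" using c q by (simp add: add_nonneg_pos)
    fix R :: real and g :: "'a \<Rightarrow> real" and w :: "'i \<Rightarrow> 'a \<Rightarrow> real"
    assume R: "1 \<le> R" and g: "integrable lborel g" and g2: "integrable lborel (\<lambda>x. (g x)\<^sup>2)"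
      and supp: "\<forall>x. g x \<noteq> 0 \<longrightarrow> norm x < \<rho>"
      and w: "\<forall>i. integrable lborel (w i) \<and> integrable lborel (\<lambda>x. (w i x)\<^sup>2)"
      and mult: "\<forall>\<xi> t. \<xi> \<noteq> 0 \<longrightarrow> 0 < t \<longrightarrow> (\<forall>\<nu>\<in>N. t * norm \<xi> \<le> \<bar>\<xi> \<bullet> \<nu>\<bar>) \<longrightarrow>
        t ^ (2 * L) * spectrum g \<xi> \<le> c * (\<Sum>i\<in>UNIV. spectrum (w i) \<xi>)"
    define s where "s = 1 / R\<^sup>2"
    have s: "s > 0" using R by (simp add: s_def)
    define M where "M = (\<integral>x. (g x)\<^sup>2 \<partial>lborel)"
    define W where "W = (\<Sum>i\<in>UNIV. \<integral>x. (w i x)\<^sup>2 \<partial>lborel)"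
    define D where "D = (\<integral>z. gauss_kernel s z * shift_defect g z \<partial>lborel)"
    have M0: "M \<ge> 0" and W0: "W \<ge> 0" by (auto simp: M_def W_def intro!: sum_nonneg)
    define A where "A \<nu> = shift_average n ((2 * \<rho>) *\<^sub>R \<nu>) g" for \<nu>
    define E where "E s \<xi> = exp (- s * (norm \<xi>)\<^sup>2 / 2)" for s and \<xi> :: 'a
    have E0: "E s \<xi> \<ge> 0" for s \<xi> by (simp add: E_def)
    define k where "k = (q * R) ^ (2 * L)"
    have k0: "k \<ge> 0" using q R by (simp add: k_def)
    have Aint: "integrable lborel (A \<nu>)" for \<nu> unfolding A_def by (rule shift_average_integrable[OF g])
    have Asq: "integrable lborel (\<lambda>x. (A \<nu> x)\<^sup>2)" "(\<integral>x. (A \<nu> x)\<^sup>2 \<partial>lborel) = M / real n" if "\<nu> \<in> N" for \<nu>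
      unfolding A_def M_def using shift_average_square[OF g g2, of \<rho> "(2 * \<rho>) *\<^sub>R \<nu>" n] supp N(2)[OF that] \<rho> n by auto
    \<comment> \<open>Every frequency is far from all the hyperplanes, in one of the slabs, or large.  For
      large ones half of the Gaussian weight is traded for the factor \<open>1/4\<close>.\<close>
    have point: "E s \<xi> * spectrum g \<xi> \<le> c * k * (\<Sum>i\<in>UNIV. E s \<xi> * spectrum (w i) \<xi>)
        + 4 * (\<Sum>\<nu>\<in>N. E s \<xi> * spectrum (A \<nu>) \<xi>) + (1/4) * (E (s/2) \<xi> * spectrum g \<xi>)" for \<xi>
    proof -
      have p1: "0 \<le> c * k * (\<Sum>i\<in>UNIV. E s \<xi> * spectrum (w i) \<xi>)"
        using c k0 by (intro mult_nonneg_nonneg sum_nonneg spectrum_nonneg E0) auto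
      have p2: "0 \<le> 4 * (\<Sum>\<nu>\<in>N. E s \<xi> * spectrum (A \<nu>) \<xi>)"
        by (intro mult_nonneg_nonneg sum_nonneg spectrum_nonneg E0) auto
      have p3: "0 \<le> (1/4) * (E (s/2) \<xi> * spectrum g \<xi>)"
        by (intro mult_nonneg_nonneg spectrum_nonneg E0) auto
      consider (far) "\<xi> \<noteq> 0" "\<forall>\<nu>\<in>N. (1 / (q * R)) * norm \<xi> \<le> \<bar>\<xi> \<bullet> \<nu>\<bar>"
        | (slab) \<nu> where "\<nu> \<in> N" "\<bar>\<xi> \<bullet> \<nu>\<bar> \<le> (1 / (q * R)) * norm \<xi>" "norm \<xi> \<le> 3 * R"
        | (large) "norm \<xi> > 3 * R"
      proof (cases "\<xi> = 0")
        case True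
        obtain \<nu> where "\<nu> \<in> N" using N(3) by blast
        then show ?thesis using True R that(2)[of \<nu>] by simp
      next
        case False
        then show ?thesis using that by (meson linorder_not_le less_imp_le)
      qed
      then show ?thesis
      proof cases
        case far
        have pos: "0 < 1 / (q * R)" using q R by simp
        have "(1 / (q * R)) ^ (2 * L) * spectrum g \<xi> \<le> c * (\<Sum>i\<in>UNIV. spectrum (w i) \<xi>)"
          using mult far pos by blast
        then have "spectrum g \<xi> \<le> c * k * (\<Sum>i\<in>UNIV. spectrum (w i) \<xi>)"
          using q R by (simp add: k_def power_one_over field_simps)
        then have "E s \<xi> * spectrum g \<xi> \<le> E s \<xi> * (c * k * (\<Sum>i\<in>UNIV. spectrum (w i) \<xi>))"
          by (intro mult_left_mono E0)
        also have "\<dots> = c * k * (\<Sum>i\<in>UNIV. E s \<xi> * spectrum (w i) \<xi>)"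
          by (simp only: sum_distrib_left mult_ac)
        finally show ?thesis using p2 p3 by linarith
      next
        case slab
        have "real n * \<bar>\<xi> \<bullet> ((2 * \<rho>) *\<^sub>R \<nu>)\<bar> = real n * (2 * \<rho>) * \<bar>\<xi> \<bullet> \<nu>\<bar>" using \<rho> by (simp add: abs_mult)
        also have "\<dots> \<le> real n * (2 * \<rho>) * ((1 / (q * R)) * (3 * R))"
          using slab q R \<rho> by (intro mult_left_mono order_trans[OF slab(2)]) auto
        also have "\<dots> = 1" using R n \<rho> by (simp add: q_def field_simps)
        finally have "spectrum g \<xi> \<le> 4 * spectrum (A \<nu>) \<xi>"
          unfolding A_def by (intro shift_average_spectrum[OF g n(1)])
        then have "E s \<xi> * spectrum g \<xi> \<le> 4 * (E s \<xi> * spectrum (A \<nu>) \<xi>)"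
          using mult_left_mono[OF _ E0[of s \<xi>], of "spectrum g \<xi>" "4 * spectrum (A \<nu>) \<xi>"] by simp
        moreover have "E s \<xi> * spectrum (A \<nu>) \<xi> \<le> (\<Sum>\<nu>\<in>N. E s \<xi> * spectrum (A \<nu>) \<xi>)"
          by (rule member_le_sum[of \<nu> N "\<lambda>\<nu>. E s \<xi> * spectrum (A \<nu>) \<xi>"])
             (use slab(1) N(1) in \<open>auto simp: spectrum_nonneg E0\<close>)
        ultimately show ?thesis using p1 p3 by linarith
      next
        case large
        have "(3 * R)\<^sup>2 \<le> (norm \<xi>)\<^sup>2" using large R by (intro power_mono) auto
        then have "9 \<le> s * (norm \<xi>)\<^sup>2" using R by (simp add: s_def field_simps)
        then have "E s \<xi> \<le> exp (- 2) * E (s/2) \<xi>" by (simp add: E_def exp_add[symmetric])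
        moreover have "exp (- 2) \<le> (1/4::real)"
        proof -
          have "(2::real) \<le> exp 1" using exp_ge_add_one_self[of 1] by simp
          then have "(2::real) * 2 \<le> exp 1 * exp 1" by (intro mult_mono) auto
          then show ?thesis by (simp add: exp_minus exp_add[symmetric] field_simps)
        qed
        from mult_right_mono[OF this E0[of "s/2" \<xi>]]
        have "exp (- 2) * E (s/2) \<xi> \<le> (1/4) * E (s/2) \<xi>" .
        ultimately have "E s \<xi> \<le> (1/4) * E (s/2) \<xi>" by linarith
        from mult_right_mono[OF this spectrum_nonneg[of g \<xi>]] show ?thesis using p1 p2 by linarith
      qed
    qed
    have i0: "integrable lborel (\<lambda>\<xi>. E s \<xi> * spectrum g \<xi>)" "integrable lborel (\<lambda>\<xi>. E (s/2) \<xi> * spectrum g \<xi>)"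
      "\<And>i. integrable lborel (\<lambda>\<xi>. E s \<xi> * spectrum (w i) \<xi>)" "\<And>\<nu>. integrable lborel (\<lambda>\<xi>. E s \<xi> * spectrum (A \<nu>) \<xi>)"
      unfolding E_def using w s
      by - ((rule gaussian_spectrum_double_integral(1); simp add: g Aint)+)
    let ?P = "(2 * pi) ^ DIM('a) :: real"
    have "?P * (M - D / 2) = (\<integral>\<xi>. E s \<xi> * spectrum g \<xi> \<partial>lborel)"
      unfolding M_def D_def E_def gaussian_plancherel(2)[OF g g2 s] by simp
    also have "\<dots> \<le> (\<integral>\<xi>. c * k * (\<Sum>i\<in>UNIV. E s \<xi> * spectrum (w i) \<xi>)
        + 4 * (\<Sum>\<nu>\<in>N. E s \<xi> * spectrum (A \<nu>) \<xi>) + (1/4) * (E (s/2) \<xi> * spectrum g \<xi>) \<partial>lborel)"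
      by (intro integral_mono i0(1) point Bochner_Integration.integrable_add integrable_mult_right Bochner_Integration.integrable_sum i0)
    also have "\<dots> = c * k * (\<Sum>i\<in>UNIV. \<integral>\<xi>. E s \<xi> * spectrum (w i) \<xi> \<partial>lborel)
        + 4 * (\<Sum>\<nu>\<in>N. \<integral>\<xi>. E s \<xi> * spectrum (A \<nu>) \<xi> \<partial>lborel) + (1/4) * (\<integral>\<xi>. E (s/2) \<xi> * spectrum g \<xi> \<partial>lborel)"
      using i0 by simp
    also have "\<dots> \<le> c * k * (\<Sum>i\<in>UNIV. ?P * (\<integral>x. (w i x)\<^sup>2 \<partial>lborel))
        + 4 * (\<Sum>\<nu>\<in>N. ?P * (\<integral>x. (A \<nu> x)\<^sup>2 \<partial>lborel)) + (1/4) * (?P * M)"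
    proof (intro add_mono mult_left_mono sum_mono)
      show "(\<integral>\<xi>. E s \<xi> * spectrum (w i) \<xi> \<partial>lborel) \<le> ?P * (\<integral>x. (w i x)\<^sup>2 \<partial>lborel)" for i
        unfolding E_def by (rule gaussian_spectrum_le) (use w s in auto)
      show "(\<integral>\<xi>. E s \<xi> * spectrum (A \<nu>) \<xi> \<partial>lborel) \<le> ?P * (\<integral>x. (A \<nu> x)\<^sup>2 \<partial>lborel)" if "\<nu> \<in> N" for \<nu>
        unfolding E_def by (rule gaussian_spectrum_le) (use Aint Asq(1)[OF that] s in auto)
      show "(\<integral>\<xi>. E (s / 2) \<xi> * spectrum g \<xi> \<partial>lborel) \<le> ?P * M"
        unfolding E_def M_def by (rule gaussian_spectrum_le) (use g g2 s in auto)
    qed (use c k0 in auto)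
    also have "\<dots> = ?P * (c * k * W + 4 * (real (card N) * (M / real n)) + (1/4) * M)"
      unfolding W_def by (simp add: Asq(2) sum_distrib_left algebra_simps)
    finally have "M - D / 2 \<le> c * k * W + 4 * (real (card N) * (M / real n)) + (1/4) * M"
      by (simp add: mult_le_cancel_left_pos)
    moreover have "4 * (real (card N) * (M / real n)) \<le> (1/4) * M"
    proof -
      have "16 * real (card N) * M \<le> real n * M" using n M0 by (intro mult_right_mono) auto
      then show ?thesis using n by (simp add: field_simps)
    qed
    ultimately have "M \<le> 2 * c * k * W + D" by simp
    also have "2 * c * k * W \<le> (2 * c * q ^ (2 * L) + 1) * R ^ (2 * L) * W"
      using W0 R by (simp add: k_def power_mult_distrib algebra_simps)
    finally show "(\<integral>x. (g x)\<^sup>2 \<partial>lborel) \<le> (2 * c * q ^ (2 * L) + 1) * R ^ (2 * L) * (\<Sum>i\<in>UNIV. \<integral>x. (w i x)\<^sup>2 \<partial>lborel)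
        + (\<integral>z. gauss_kernel (1 / R\<^sup>2) z * shift_defect g z \<partial>lborel)"
      by (simp add: M_def W_def D_def s_def)
  qed
qed

section \<open>Smooth functions\<close>

text \<open>The flat functions \<open>t^(-k) exp (-1/t)\<close>, extended by zero to \<open>t \<le> 0\<close>; the family is closed
  under differentiation up to linear combinations.\<close>

definition flat :: "nat \<Rightarrow> real \<Rightarrow> real" where
  "flat k t = (if t \<le> 0 then 0 else exp (- (1 / t)) / t ^ k)"

lemma flat_tendsto: "(flat k \<longlongrightarrow> 0) (at_right 0)"
proof -
  have "((\<lambda>t::real. exp (- (1 / t)) / t ^ k) \<longlongrightarrow> 0) (at_right 0)"
  proof -
    have "((\<lambda>u::real. u ^ k / exp u) \<longlongrightarrow> 0) at_top" by (rule tendsto_power_div_exp_0)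
    then have "((\<lambda>t::real. (inverse t) ^ k / exp (inverse t)) \<longlongrightarrow> 0) (at_right 0)"
      by (rule filterlim_compose[OF _ filterlim_inverse_at_top_right])
    then show ?thesis by (simp add: exp_minus field_simps)
  qed
  then show ?thesis
    by (rule Lim_transform_eventually) (auto simp: flat_def eventually_at_filter)
qed

lemma flat_deriv: "(flat k has_real_derivative (flat (k + 2) t - real k * flat (k + 1) t)) (at t)"
proof -
  consider "t < 0" | "t = 0" | "t > 0" by linarith
  then show ?thesis
  proof cases
    case 1
    have "((\<lambda>_. 0) has_real_derivative 0) (at t)" by simp
    then have "(flat k has_real_derivative 0) (at t)"
      by (rule has_field_derivative_transform_within_open[where S="{..<0}"]) (use 1 in \<open>auto simp: flat_def\<close>)
    then show ?thesis using 1 by (simp add: flat_def)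
  next
    case 2
    have "((\<lambda>h. (flat k (0 + h) - flat k 0) / h) \<longlongrightarrow> 0) (at 0)"
      unfolding filterlim_at_split
    proof
      show "((\<lambda>h. (flat k (0 + h) - flat k 0) / h) \<longlongrightarrow> 0) (at_left 0)"
        by (rule Lim_transform_eventually[OF tendsto_const]) (auto simp: flat_def eventually_at_filter)
      show "((\<lambda>h. (flat k (0 + h) - flat k 0) / h) \<longlongrightarrow> 0) (at_right 0)"
        by (rule Lim_transform_eventually[OF flat_tendsto[of "Suc k"]])
           (auto simp: flat_def eventually_at_filter field_simps)
    qed
    then show ?thesis using 2 by (simp add: DERIV_def flat_def)
  next
    case 3
    have "((\<lambda>t. exp (- (1 / t)) / t ^ k) has_real_derivative
       (exp (- (1 / t)) / t ^ (k + 2) - real k * (exp (- (1 / t)) / t ^ (k + 1)))) (at t)"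
      using 3 by (auto intro!: derivative_eq_intros simp: field_simps power2_eq_square)
        (cases k; simp add: field_simps)
    then have "(flat k has_real_derivative
       (exp (- (1 / t)) / t ^ (k + 2) - real k * (exp (- (1 / t)) / t ^ (k + 1)))) (at t)"
      by (rule has_field_derivative_transform_within_open[where S="{0<..}"]) (use 3 in \<open>auto simp: flat_def\<close>)
    then show ?thesis using 3 by (simp add: flat_def)
  qed
qed

text \<open>A class of functions rich enough to contain smooth cut-offs and Fourier modes, and closed
  under partial derivatives.  The closure is what yields smoothness without a product or a chain rule
  for iterated derivatives.\<close>

inductive elementary :: "(real^'d::finite \<Rightarrow> real) \<Rightarrow> bool" where
  const: "elementary (\<lambda>x. c)"
| linear: "elementary (\<lambda>x. x \<bullet> \<xi>)"
| add: "elementary f \<Longrightarrow> elementary g \<Longrightarrow> elementary (\<lambda>x. f x + g x)"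
| mult: "elementary f \<Longrightarrow> elementary g \<Longrightarrow> elementary (\<lambda>x. f x * g x)"
| flat: "elementary f \<Longrightarrow> elementary (\<lambda>x. flat k (f x))"
| cos: "elementary f \<Longrightarrow> elementary (\<lambda>x. cos (f x))"
| inverse: "elementary f \<Longrightarrow> (\<And>x. f x \<noteq> 0) \<Longrightarrow> elementary (\<lambda>x. inverse (f x))"

lemma partial_deriv_eq:
  assumes "(f has_derivative f') (at x)"
  shows "partial_deriv i f x = f' (axis i 1)"
  unfolding partial_deriv_def using frechet_derivative_at[OF assms] by simp

lemma elementary_derivative:
  assumes "elementary (f :: real^'d::finite \<Rightarrow> real)"
  shows "\<exists>D. (\<forall>h. elementary (\<lambda>x. D x h)) \<and> (\<forall>x. (f has_derivative D x) (at x))"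
  using assms
proof induction
  case (const c)
  show ?case by (rule exI[of _ "\<lambda>x h. 0"]) (auto intro: elementary.const)
next
  case (linear \<xi>)
  show ?case by (rule exI[of _ "\<lambda>x h. h \<bullet> \<xi>"]) (auto intro: elementary.const intro!: derivative_eq_intros)
next
  case (add f g)
  then obtain D E where "\<And>h. elementary (\<lambda>x. D x h)" "\<And>x. (f has_derivative D x) (at x)"
    "\<And>h. elementary (\<lambda>x. E x h)" "\<And>x. (g has_derivative E x) (at x)" by blast
  then show ?case
    by (intro exI[of _ "\<lambda>x h. D x h + E x h"]) (auto intro: elementary.add intro!: derivative_intros)
next
  case (mult f g)
  then obtain D E where "\<And>h. elementary (\<lambda>x. D x h)" "\<And>x. (f has_derivative D x) (at x)"
    "\<And>h. elementary (\<lambda>x. E x h)" "\<And>x. (g has_derivative E x) (at x)" by blast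
  then show ?case using mult.hyps
    by (intro exI[of _ "\<lambda>x h. f x * E x h + D x h * g x"])
       (auto intro!: elementary.add elementary.mult has_derivative_mult)
next
  case (flat f k)
  then obtain D where D: "\<And>h. elementary (\<lambda>x. D x h)" "\<And>x. (f has_derivative D x) (at x)" by blast
  have "elementary (\<lambda>x. (flat (k + 2) (f x) + (- real k) * flat (k + 1) (f x)) * D x h)" for h
    by (intro elementary.mult elementary.add elementary.flat elementary.const flat D)
  moreover have "((\<lambda>x. flat k (f x)) has_derivative (\<lambda>h. (flat (k + 2) (f x) + (- real k) * flat (k + 1) (f x)) * D x h)) (at x)" for x
    using has_derivative_compose[OF D(2)[of x] flat_deriv[of k "f x", unfolded has_field_derivative_def]] by simp
  ultimately show ?case by (intro exI[of _ "\<lambda>x h. (flat (k + 2) (f x) + (- real k) * flat (k + 1) (f x)) * D x h"]) auto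
next
  case (cos f)
  then obtain D where D: "\<And>h. elementary (\<lambda>x. D x h)" "\<And>x. (f has_derivative D x) (at x)" by blast
  have "elementary (\<lambda>x. cos (f x + pi / 2) * D x h)" for h
    by (intro elementary.mult elementary.add elementary.cos elementary.const cos D)
  moreover have "((\<lambda>x. cos (f x)) has_derivative (\<lambda>h. cos (f x + pi / 2) * D x h)) (at x)" for x
    by (rule derivative_eq_intros D refl)+ (simp add: cos_add mult.commute)
  ultimately show ?case by (intro exI[of _ "\<lambda>x h. cos (f x + pi / 2) * D x h"]) auto
next
  case (inverse f)
  then obtain D where D: "\<And>h. elementary (\<lambda>x. D x h)" "\<And>x. (f has_derivative D x) (at x)" by blast
  have "elementary (\<lambda>x. (-1) * (inverse (f x) * D x h * inverse (f x)))" for h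
    by (intro elementary.mult elementary.inverse elementary.const inverse D)
  moreover have "((\<lambda>x. inverse (f x)) has_derivative (\<lambda>h. (-1) * (inverse (f x) * D x h * inverse (f x)))) (at x)" for x
    using Deriv.has_derivative_inverse[OF inverse.hyps(2) D(2), of x] by simp
  ultimately show ?case by (intro exI[of _ "\<lambda>x h. (-1) * (inverse (f x) * D x h * inverse (f x))"]) auto
qed

lemma elementary_partial_deriv: "elementary f \<Longrightarrow> elementary (partial_deriv i f)"
proof -
  assume "elementary f"
  then obtain D where D: "\<And>h. elementary (\<lambda>x. D x h)" "\<And>x. (f has_derivative D x) (at x)"
    using elementary_derivative by blast
  have "partial_deriv i f = (\<lambda>x. D x (axis i 1))" using partial_deriv_eq[OF D(2)] by blast
  then show ?thesis using D(1) by simp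
qed

lemma iterated_partial_Nil [simp]: "iterated_partial [] f = f"
  by (simp add: iterated_partial_def)

lemma iterated_partial_Cons: "iterated_partial (i # is) f = partial_deriv i (iterated_partial is f)"
  by (simp add: iterated_partial_def)

lemma iterated_partial_append: "iterated_partial (is @ js) f = iterated_partial is (iterated_partial js f)"
  by (simp add: iterated_partial_def)

lemma elementary_smooth: "elementary f \<Longrightarrow> smooth f"
proof -
  assume "elementary f"
  then have "elementary (iterated_partial is f)" for "is"
    by (induction "is") (auto simp: iterated_partial_Cons intro: elementary_partial_deriv)
  then show ?thesis unfolding smooth_def differentiable_def using elementary_derivative by blast
qed

lemma smooth_differentiable: "smooth f \<Longrightarrow> f differentiable (at x)"
  unfolding smooth_def by (metis iterated_partial_Nil)

lemma smooth_has_derivative: "smooth f \<Longrightarrow> (f has_derivative frechet_derivative f (at x)) (at x)"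
  using smooth_differentiable frechet_derivative_works by blast

lemma smooth_continuous: "smooth f \<Longrightarrow> continuous_on A f"
  by (meson continuous_at_imp_continuous_on differentiable_imp_continuous_within smooth_differentiable)

lemma smooth_iterated_partial: "smooth f \<Longrightarrow> smooth (iterated_partial is f)"
  unfolding smooth_def by (metis iterated_partial_append)

lemma smooth_partial_deriv: "smooth f \<Longrightarrow> smooth (partial_deriv i f)"
  using smooth_iterated_partial[of f "[i]"] by (simp add: iterated_partial_Cons)

lemma partial_deriv_cong_open:
  assumes "open U" "\<And>x. x \<in> U \<Longrightarrow> f x = g x" "x \<in> U"
  shows "partial_deriv i f x = partial_deriv i g x"
proof -
  have "(f has_derivative D) (at x) \<longleftrightarrow> (g has_derivative D) (at x)" for D
    using has_derivative_transform_within_open[of f D x UNIV U g] has_derivative_transform_within_open[of g D x UNIV U f] assms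
    by auto
  then show ?thesis by (simp add: partial_deriv_def frechet_derivative_def)
qed

lemma iterated_partial_cong_open:
  assumes "open U" "\<And>x. x \<in> U \<Longrightarrow> f x = g x" "x \<in> U"
  shows "iterated_partial is f x = iterated_partial is g x"
  using assms(3)
proof (induction "is" arbitrary: x)
  case (Cons i "is")
  show ?case unfolding iterated_partial_Cons
    by (rule partial_deriv_cong_open[OF assms(1) Cons.IH Cons.prems])
qed (simp add: assms(2))

lemma partial_deriv_zero: "partial_deriv i (\<lambda>x. 0) = (\<lambda>x. 0)"
proof
  show "partial_deriv i (\<lambda>x. 0) x = 0" for x
    using partial_deriv_eq[of "\<lambda>x. 0" "\<lambda>h. 0" x i] by simp
qed

lemma zero_outside_support: "x \<notin> closure {x. f x \<noteq> 0} \<Longrightarrow> f x = 0"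
  using closure_subset[of "{x. f x \<noteq> 0}"] by blast

lemma compact_closed_subset: "compact S \<Longrightarrow> closed T \<Longrightarrow> T \<subseteq> S \<Longrightarrow> compact T"
  by (metis compact_Int_closed inf.absorb_iff2)

lemma partial_deriv_outside_support:
  assumes "x \<notin> closure {x. f x \<noteq> 0}"
  shows "partial_deriv i f x = 0"
proof -
  have "partial_deriv i f x = partial_deriv i (\<lambda>x. 0) x"
  proof (rule partial_deriv_cong_open)
    show "open (- closure {x. f x \<noteq> 0})" by (simp add: open_Compl)
    show "f y = 0" if "y \<in> - closure {x. f x \<noteq> 0}" for y
      by (rule zero_outside_support) (rule ComplD[OF that])
  qed (use assms in simp)
  then show ?thesis by (simp add: partial_deriv_zero)
qed

lemma iterated_partial_outside_support:
  assumes "x \<notin> closure {x. f x \<noteq> 0}"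
  shows "iterated_partial is f x = 0"
proof -
  have z: "iterated_partial is (\<lambda>x. 0) = (\<lambda>x. 0)"
    by (induction "is") (simp_all add: iterated_partial_Cons partial_deriv_zero)
  have "iterated_partial is f x = iterated_partial is (\<lambda>x. 0) x"
  proof (rule iterated_partial_cong_open)
    show "open (- closure {x. f x \<noteq> 0})" by (simp add: open_Compl)
    show "f y = 0" if "y \<in> - closure {x. f x \<noteq> 0}" for y
      by (rule zero_outside_support) (rule ComplD[OF that])
  qed (use assms in simp)
  then show ?thesis by (simp add: z)
qed

lemma test_functions_iterated_partial:
  assumes "\<phi> \<in> test_functions U" shows "iterated_partial is \<phi> \<in> test_functions U"
proof -
  have \<phi>: "smooth \<phi>" "compact (closure {x. \<phi> x \<noteq> 0})" "closure {x. \<phi> x \<noteq> 0} \<subseteq> U"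
    using assms unfolding test_functions_def by simp_all
  have "{x. iterated_partial is \<phi> x \<noteq> 0} \<subseteq> closure {x. \<phi> x \<noteq> 0}"
  proof
    fix x assume "x \<in> {x. iterated_partial is \<phi> x \<noteq> 0}"
    then show "x \<in> closure {x. \<phi> x \<noteq> 0}"
      using iterated_partial_outside_support[of x \<phi> "is"] by (metis mem_Collect_eq)
  qed
  then have cl: "closure {x. iterated_partial is \<phi> x \<noteq> 0} \<subseteq> closure {x. \<phi> x \<noteq> 0}"
    by (rule closure_minimal) simp
  have "compact (closure {x. iterated_partial is \<phi> x \<noteq> 0})"
    by (rule compact_closed_subset[OF \<phi>(2) _ cl]) simp
  moreover have "closure {x. iterated_partial is \<phi> x \<noteq> 0} \<subseteq> U" using cl \<phi>(3) by (rule subset_trans)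
  ultimately show ?thesis using smooth_iterated_partial[OF \<phi>(1)] unfolding test_functions_def by simp
qed

lemma smooth_translate:
  assumes "smooth (f :: real^'d::finite \<Rightarrow> real)" shows "smooth (\<lambda>x. f (x + c))"
proof -
  have pd: "partial_deriv i (\<lambda>x. f (x + c)) = (\<lambda>x. partial_deriv i f (x + c))" if "\<And>x. f differentiable (at x)" for i and f :: "real^'d \<Rightarrow> real"
  proof
    fix x
    have "(f has_derivative frechet_derivative f (at (x + c))) (at (x + c))"
      using that frechet_derivative_works by blast
    then have "((\<lambda>x. f (x + c)) has_derivative (\<lambda>h. frechet_derivative f (at (x + c)) h)) (at x)"
      by (rule has_derivative_compose[where f="\<lambda>x. x + c" and f'="\<lambda>h. h", rotated])
         (auto intro!: derivative_eq_intros)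
    from partial_deriv_eq[OF this] show "partial_deriv i (\<lambda>x. f (x + c)) x = partial_deriv i f (x + c)"
      by (simp add: partial_deriv_def)
  qed
  have it: "iterated_partial is (\<lambda>x. f (x + c)) = (\<lambda>x. iterated_partial is f (x + c))" for "is"
  proof (induction "is")
    case (Cons i "is")
    have "(iterated_partial is f) differentiable (at x)" for x using assms by (simp add: smooth_def)
    then show ?case unfolding iterated_partial_Cons Cons.IH by (rule pd)
  qed simp
  show ?thesis unfolding smooth_def it
  proof (intro allI)
    fix "is" x
    have "(iterated_partial is f) differentiable (at (x + c))" using assms by (simp add: smooth_def)
    then show "(\<lambda>x. iterated_partial is f (x + c)) differentiable (at x)"
      using differentiable_chain_at[of "\<lambda>x. x + c" x "iterated_partial is f"] by (simp add: o_def)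
  qed
qed

lemma smooth_scaleR_const:
  assumes "smooth (f :: real^'d::finite \<Rightarrow> real)"
  shows "smooth (\<lambda>x. f x *\<^sub>R (M :: 'b::real_normed_vector))"
    and "partial_deriv i (\<lambda>x. f x *\<^sub>R M) x = partial_deriv i f x *\<^sub>R M"
proof -
  have pd: "partial_deriv i (\<lambda>x. f x *\<^sub>R M) = (\<lambda>x. partial_deriv i f x *\<^sub>R M)" if "\<And>x. f differentiable (at x)" for i and f :: "real^'d \<Rightarrow> real"
  proof
    fix x
    have "(f has_derivative frechet_derivative f (at x)) (at x)"
      using that frechet_derivative_works by blast
    then have "((\<lambda>x. f x *\<^sub>R M) has_derivative (\<lambda>h. frechet_derivative f (at x) h *\<^sub>R M)) (at x)"
      by (rule has_derivative_scaleR_left)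
    from partial_deriv_eq[OF this] show "partial_deriv i (\<lambda>x. f x *\<^sub>R M) x = partial_deriv i f x *\<^sub>R M"
      by (simp add: partial_deriv_def)
  qed
  have it: "iterated_partial is (\<lambda>x. f x *\<^sub>R M) = (\<lambda>x. iterated_partial is f x *\<^sub>R M)" for "is"
  proof (induction "is")
    case (Cons i "is")
    have "(iterated_partial is f) differentiable (at x)" for x using assms by (simp add: smooth_def)
    then show ?case unfolding iterated_partial_Cons Cons.IH by (rule pd)
  qed simp
  show "smooth (\<lambda>x. f x *\<^sub>R M)" unfolding smooth_def it
  proof (intro allI)
    fix "is" x
    have "(iterated_partial is f) differentiable (at x)" using assms by (simp add: smooth_def)
    then show "(\<lambda>x. iterated_partial is f x *\<^sub>R M) differentiable (at x)"
      by (intro differentiable_scaleR) auto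
  qed
  show "partial_deriv i (\<lambda>x. f x *\<^sub>R M) x = partial_deriv i f x *\<^sub>R M"
    using pd[OF smooth_differentiable[OF assms], of i] by simp
qed


text \<open>A smooth transition from \<open>0\<close> for \<open>t \<le> 0\<close> to \<open>1\<close> for \<open>t \<ge> 1\<close>.\<close>

definition smooth_step :: "real \<Rightarrow> real" where
  "smooth_step t = flat 0 t * inverse (flat 0 t + flat 0 (1 - t))"

lemma flat_nonneg: "flat k t \<ge> 0" by (simp add: flat_def)

lemma flat_sum_pos: "flat 0 t + flat 0 (1 - t) > 0"
  by (auto simp: flat_def intro: add_pos_pos)

lemma smooth_step_bounds: "0 \<le> smooth_step t" "smooth_step t \<le> 1"
proof -
  have eq: "smooth_step t = flat 0 t / (flat 0 t + flat 0 (1 - t))"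
    unfolding smooth_step_def by (rule divide_inverse[symmetric])
  show "0 \<le> smooth_step t" "smooth_step t \<le> 1"
    unfolding eq using flat_sum_pos[of t] flat_nonneg[of 0 t] flat_nonneg[of 0 "1 - t"]
    by (simp_all add: divide_le_eq)
qed

lemma smooth_step_0: "t \<le> 0 \<Longrightarrow> smooth_step t = 0" by (simp add: smooth_step_def flat_def)

lemma smooth_step_1: "t \<ge> 1 \<Longrightarrow> smooth_step t = 1"
  using flat_sum_pos[of t] by (simp add: smooth_step_def flat_def)

lemma elementary_diff: "elementary f \<Longrightarrow> elementary g \<Longrightarrow> elementary (\<lambda>x. f x - g x)"
  using elementary.add[OF _ elementary.mult[OF elementary.const[of "-1"]], of f g] by simp

lemma elementary_smooth_step: "elementary f \<Longrightarrow> elementary (\<lambda>x. smooth_step (f x))"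
  unfolding smooth_step_def
  by (intro elementary.mult elementary.flat elementary.inverse elementary.add elementary_diff elementary.const)
     (assumption | rule not_sym[OF less_imp_neq[OF flat_sum_pos]])+

lemma elementary_sum: "(\<And>i. i \<in> I \<Longrightarrow> elementary (f i)) \<Longrightarrow> elementary (\<lambda>x. \<Sum>i\<in>I. f i x)"
  by (induction I rule: infinite_finite_induct) (auto intro: elementary.intros)

lemma elementary_dist_square: "elementary (\<lambda>x::real^'d::finite. (norm (x - c))\<^sup>2)"
proof -
  have "(norm (x - c))\<^sup>2 = (\<Sum>i\<in>UNIV. (x \<bullet> axis i 1 - c $ i) * (x \<bullet> axis i 1 - c $ i))" for x :: "real^'d"
  proof -
    have "(norm (x - c))\<^sup>2 = (\<Sum>i\<in>UNIV. (x $ i - c $ i) * (x $ i - c $ i))"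
      by (simp add: power2_norm_eq_inner inner_vec_def)
    then show ?thesis by (simp add: inner_axis)
  qed
  then show ?thesis
    by (simp only:) (intro elementary_sum elementary.mult elementary_diff elementary.linear elementary.const)
qed

lemma smooth_urysohn:
  fixes K U :: "(real^'d::finite) set"
  assumes K: "compact K" and U: "open U" "K \<subseteq> U"
  obtains \<psi> where "elementary \<psi>" "\<psi> \<in> test_functions U" "\<And>x. 0 \<le> \<psi> x" "\<And>x. \<psi> x \<le> 1" "\<And>x. x \<in> K \<Longrightarrow> \<psi> x = 1"
proof -
  have "\<forall>x\<in>K. \<exists>r>0. cball x r \<subseteq> U" using U open_contains_cball by blast
  then obtain r where r: "\<And>x. x \<in> K \<Longrightarrow> r x > 0" "\<And>x. x \<in> K \<Longrightarrow> cball x (r x) \<subseteq> U" by metis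
  have "K \<subseteq> (\<Union>x\<in>K. ball x (r x / 2))" using r(1) by force
  then obtain T where T: "T \<subseteq> K" "finite T" "K \<subseteq> (\<Union>x\<in>T. ball x (r x / 2))"
    using compactE_image[OF K, of K "\<lambda>x. ball x (r x / 2)"] by auto
  \<comment> \<open>The bump \<open>b c\<close> is \<open>1\<close> on the ball of half the radius and \<open>0\<close> off the ball of radius \<open>r c\<close>.\<close>
  define b where "b c x = smooth_step (2 - (2 / (r c)\<^sup>2) * (norm (x - c))\<^sup>2)" for c x :: "real^'d"
  define \<psi> where "\<psi> x = smooth_step (\<Sum>c\<in>T. b c x)" for x
  have el: "elementary \<psi>"
    unfolding \<psi>_def b_def
    by (intro elementary_smooth_step elementary_sum elementary_diff elementary.mult elementary.const elementary_dist_square)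
  have b0: "b c x = 0" if "c \<in> T" "x \<notin> cball c (r c)" for c x
  proof -
    have rc: "r c > 0" using that T r by auto
    have "r c \<le> norm (x - c)" using that by (simp add: dist_norm norm_minus_commute)
    then have "(r c)\<^sup>2 \<le> (norm (x - c))\<^sup>2" using rc by (intro power_mono) auto
    then show ?thesis unfolding b_def using rc by (intro smooth_step_0) (simp add: field_simps)
  qed
  have b1: "b c x = 1" if "c \<in> T" "x \<in> ball c (r c / 2)" for c x
  proof -
    have rc: "r c > 0" using that T r by auto
    have "norm (x - c) \<le> r c / 2" using that by (simp add: dist_norm norm_minus_commute)
    then have "(norm (x - c))\<^sup>2 \<le> (r c / 2)\<^sup>2" by (intro power_mono) auto
    then have "4 * (norm (x - c))\<^sup>2 \<le> (r c)\<^sup>2" by (simp add: power_divide)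
    then have "2 * (norm (x - c))\<^sup>2 \<le> (r c)\<^sup>2"
      using zero_le_power2[of "norm (x - c)"] by linarith
    then show ?thesis unfolding b_def using rc by (intro smooth_step_1) (simp add: field_simps)
  qed
  have one: "\<psi> x = 1" if xK: "x \<in> K" for x
  proof -
    obtain c where c: "c \<in> T" "x \<in> ball c (r c / 2)" using T(3) xK by blast
    have "b c x \<le> (\<Sum>c\<in>T. b c x)" using T(2) c(1)
      by (intro member_le_sum) (auto simp: b_def smooth_step_bounds)
    then show ?thesis unfolding \<psi>_def using b1[OF c] by (intro smooth_step_1) simp
  qed
  have "{x. \<psi> x \<noteq> 0} \<subseteq> (\<Union>c\<in>T. cball c (r c))"
  proof
    fix x assume x: "x \<in> {x. \<psi> x \<noteq> 0}"
    show "x \<in> (\<Union>c\<in>T. cball c (r c))"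
    proof (rule ccontr)
      assume "x \<notin> (\<Union>c\<in>T. cball c (r c))"
      then have "b c x = 0" if "c \<in> T" for c using b0 that by blast
      then have "(\<Sum>c\<in>T. b c x) = 0" by simp
      then show False using x by (simp add: \<psi>_def smooth_step_0)
    qed
  qed
  moreover have comp: "compact (\<Union>c\<in>T. cball c (r c))" using T(2) by (intro compact_UN) auto
  ultimately have cl: "closure {x. \<psi> x \<noteq> 0} \<subseteq> (\<Union>c\<in>T. cball c (r c))"
    by (intro closure_minimal) (simp_all add: compact_imp_closed)
  have "(\<Union>c\<in>T. cball c (r c)) \<subseteq> U" using T(1) r(2) by blast
  then have "\<psi> \<in> test_functions U"
    unfolding test_functions_def using elementary_smooth[OF el] cl compact_closed_subset[OF comp _ cl] by simp
  then show ?thesis using that el one by (simp add: \<psi>_def smooth_step_bounds)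
qed


lemma partial_deriv_cos:
  "partial_deriv i (\<lambda>x. c * cos (\<xi> \<bullet> x + \<tau>)) = (\<lambda>x. (c * \<xi> $ i) * cos (\<xi> \<bullet> x + (\<tau> + pi / 2)))"
proof
  fix x
  have "((\<lambda>x. c * cos (\<xi> \<bullet> x + \<tau>)) has_derivative (\<lambda>h. c * (- sin (\<xi> \<bullet> x + \<tau>) * (\<xi> \<bullet> h)))) (at x)"
    by (auto intro!: derivative_eq_intros)
  from partial_deriv_eq[OF this] show "partial_deriv i (\<lambda>x. c * cos (\<xi> \<bullet> x + \<tau>)) x = (c * \<xi> $ i) * cos (\<xi> \<bullet> x + (\<tau> + pi / 2))"
    by (simp add: inner_axis cos_add algebra_simps sin_add)
qed

lemma iterated_partial_cos:
  "iterated_partial is (\<lambda>x. cos (\<xi> \<bullet> x + \<tau>))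
     = (\<lambda>x. (\<Prod>i\<leftarrow>is. \<xi> $ i) * cos (\<xi> \<bullet> x + (\<tau> + real (length is) * (pi / 2))))"
proof (induction "is")
  case (Cons i "is")
  show ?case unfolding iterated_partial_Cons Cons.IH partial_deriv_cos
    by (simp add: algebra_simps add_divide_distrib)
qed simp

lemma prod_list_count:
  fixes \<xi> :: "'d::finite \<Rightarrow> 'a::comm_monoid_mult"
  shows "(\<Prod>i\<leftarrow>is. \<xi> i) = (\<Prod>i\<in>UNIV. \<xi> i ^ count_list is i)"
proof (induction "is")
  case (Cons j "is")
  have "(\<Prod>i\<in>UNIV. \<xi> i ^ count_list (j # is) i) = (\<Prod>i\<in>UNIV. (if i = j then \<xi> i else 1) * \<xi> i ^ count_list is i)"
    by (rule prod.cong) auto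
  also have "\<dots> = \<xi> j * (\<Prod>i\<in>UNIV. \<xi> i ^ count_list is i)"
    by (simp add: prod.distrib)
  finally show ?case using Cons by simp
qed simp

lemma length_count: "length is = (\<Sum>i\<in>UNIV. count_list is (i::'d::finite))"
  using sum_count_set[of "is" UNIV] by simp

text \<open>Every multi-index is realised by a list, so the choice in \<^const>\<open>multi_deriv\<close> is not vacuous.\<close>

lemma multi_index_list:
  fixes \<alpha> :: "'d::finite \<Rightarrow> nat"
  shows "\<forall>i. count_list (SOME is. \<forall>i. count_list is i = \<alpha> i) i = \<alpha> i"
proof (rule someI_ex)
  obtain xs :: "'d list" where xs: "set xs = UNIV" "distinct xs" using finite_distinct_list[OF finite[of UNIV]] by auto
  have rep: "count_list (replicate n a) b = (if a = b then n else 0)" for n and a b :: 'd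
    by (induction n) auto
  have "count_list (concat (map (\<lambda>j. replicate (\<alpha> j) j) ys)) i = (if i \<in> set ys then \<alpha> i else 0)"
    if "distinct ys" for ys i
    using that by (induction ys) (auto simp: rep)
  from this[OF xs(2)] show "\<exists>is. \<forall>i. count_list is i = \<alpha> i" using xs(1) by auto
qed

lemma multi_deriv_cos:
  fixes \<xi> :: "real^'d::finite"
  assumes "\<alpha> \<in> multi_indices m"
  shows "multi_deriv \<alpha> (\<lambda>x. cos (\<xi> \<bullet> x + \<tau>)) x = (\<Prod>i\<in>UNIV. (\<xi> $ i) ^ \<alpha> i) * cos (\<xi> \<bullet> x + (\<tau> + real m * (pi / 2)))"
  using assms unfolding multi_deriv_def iterated_partial_cos prod_list_count length_count
  by (simp add: multi_index_list multi_indices_def)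

section \<open>Translations of sets of finite perimeter\<close>

text \<open>The derivative of \<open>\<psi>\<close> in the direction \<open>\<nu>\<close>, as a combination of the partial derivatives.\<close>

definition dir_deriv :: "real^'d::finite \<Rightarrow> (real^'d \<Rightarrow> real) \<Rightarrow> real^'d \<Rightarrow> real" where
  "dir_deriv \<nu> \<psi> x = (\<Sum>i\<in>UNIV. \<nu> $ i * partial_deriv i \<psi> x)"

lemma dir_deriv_eq_frechet:
  assumes "smooth \<psi>" shows "dir_deriv \<nu> \<psi> x = frechet_derivative \<psi> (at x) \<nu>"
proof -
  have lin: "linear (frechet_derivative \<psi> (at x))"
    using smooth_has_derivative[OF assms] has_derivative_linear by blast
  have "frechet_derivative \<psi> (at x) \<nu> = frechet_derivative \<psi> (at x) (\<Sum>i\<in>UNIV. \<nu> $ i *\<^sub>R axis i 1)"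
    by (simp add: basis_expansion[of \<nu>, unfolded scalar_mult_eq_scaleR])
  also have "\<dots> = dir_deriv \<nu> \<psi> x"
    by (simp add: linear_sum[OF lin] linear_scale[OF lin] dir_deriv_def partial_deriv_def)
  finally show ?thesis by simp
qed

lemma DERIV_along_line:
  assumes "smooth \<psi>"
  shows "((\<lambda>t. \<psi> (x + t *\<^sub>R \<nu>)) has_real_derivative dir_deriv \<nu> \<psi> (x + t *\<^sub>R \<nu>)) (at t)"
proof -
  have lin: "linear (frechet_derivative \<psi> (at (x + t *\<^sub>R \<nu>)))"
    using smooth_has_derivative[OF assms] has_derivative_linear by blast
  have "((\<lambda>t. \<psi> (x + t *\<^sub>R \<nu>)) has_derivative (\<lambda>h. frechet_derivative \<psi> (at (x + t *\<^sub>R \<nu>)) (h *\<^sub>R \<nu>))) (at t)"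
    by (rule has_derivative_compose[OF _ smooth_has_derivative[OF assms], of "\<lambda>t. x + t *\<^sub>R \<nu>"])
       (auto intro!: derivative_eq_intros)
  then show ?thesis
    by (simp add: has_field_derivative_def dir_deriv_eq_frechet[OF assms] linear_scale[OF lin] mult_commute_abs)
qed

lemma test_function_bounded_support:
  assumes "\<psi> \<in> test_functions U"
  obtains \<rho> where "\<rho> > 0" "\<And>x. x \<notin> cball 0 \<rho> \<Longrightarrow> \<psi> x = 0"
proof -
  have "bounded (closure {x. \<psi> x \<noteq> 0})"
    using assms by (auto simp: test_functions_def dest: compact_imp_bounded)
  then obtain \<rho> where \<rho>: "\<rho> > 0" "\<forall>x\<in>closure {x. \<psi> x \<noteq> 0}. norm x \<le> \<rho>"
    unfolding bounded_pos by blast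
  show ?thesis
  proof (rule that[OF \<rho>(1)])
    show "\<psi> x = 0" if "x \<notin> cball 0 \<rho>" for x
    proof (rule zero_outside_support[of x \<psi>], rule notI)
      assume "x \<in> closure {x. \<psi> x \<noteq> 0}"
      from bspec[OF \<rho>(2) this] show False using that by simp
    qed
  qed
qed

lemma test_functions_smooth: "\<psi> \<in> test_functions U \<Longrightarrow> smooth \<psi>"
  by (simp add: test_functions_def)

lemma dir_deriv_bounded:
  assumes "\<psi> \<in> test_functions U"
  obtains M where "\<And>x. \<bar>dir_deriv \<nu> \<psi> x\<bar> \<le> M"
proof -
  obtain \<rho> where \<rho>: "\<rho> > 0" "\<And>x. x \<notin> cball 0 \<rho> \<Longrightarrow> \<psi> x = 0"
    using test_function_bounded_support[OF assms] by blast
  have cont: "continuous_on UNIV (dir_deriv \<nu> \<psi>)"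
    unfolding dir_deriv_def using test_functions_smooth[OF assms]
    by (intro continuous_intros smooth_continuous smooth_partial_deriv)
  have "compact (dir_deriv \<nu> \<psi> ` cball 0 \<rho>)"
    by (rule compact_continuous_image) (auto intro: continuous_on_subset[OF cont])
  then obtain M where M: "M > 0" "\<And>x. x \<in> cball 0 \<rho> \<Longrightarrow> \<bar>dir_deriv \<nu> \<psi> x\<bar> \<le> M"
    by (metis bounded_pos compact_imp_bounded imageI real_norm_def)
  have "dir_deriv \<nu> \<psi> x = 0" if "x \<notin> cball 0 \<rho>" for x
  proof -
    have "{x. \<psi> x \<noteq> 0} \<subseteq> cball 0 \<rho>" using \<rho>(2) by blast
    then have "closure {x. \<psi> x \<noteq> 0} \<subseteq> cball 0 \<rho>" by (intro closure_minimal) auto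
    then show ?thesis using that partial_deriv_outside_support[of x \<psi>] unfolding dir_deriv_def by fastforce
  qed
  then show ?thesis using M by (intro that[of M]) (metis abs_zero less_imp_le)
qed

lemma continuous_dir_deriv: "smooth \<psi> \<Longrightarrow> continuous_on A (dir_deriv \<nu> \<psi>)"
  unfolding dir_deriv_def by (intro continuous_intros smooth_continuous smooth_partial_deriv)

lemma DERIV_translated_integral:
  fixes f :: "real^'d::finite \<Rightarrow> real"
  assumes f [measurable]: "f \<in> borel_measurable borel" and fb: "\<And>x. \<bar>f x\<bar> \<le> 1"
    and \<psi>: "\<psi> \<in> test_functions U"
  shows "((\<lambda>t. \<integral>x. f x * \<psi> (x + t *\<^sub>R \<nu>) \<partial>lborel) has_real_derivative
     (\<integral>x. f x * dir_deriv \<nu> \<psi> (x + t *\<^sub>R \<nu>) \<partial>lborel)) (at t)"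
proof -
  have sm: "smooth \<psi>" using test_functions_smooth[OF \<psi>] .
  have [measurable]: "\<psi> \<in> borel_measurable borel" "dir_deriv \<nu> \<psi> \<in> borel_measurable borel"
    by (intro borel_measurable_continuous_onI smooth_continuous continuous_dir_deriv sm)+
  obtain \<rho> where \<rho>: "\<rho> > 0" "\<And>x. x \<notin> cball 0 \<rho> \<Longrightarrow> \<psi> x = 0"
    using test_function_bounded_support[OF \<psi>] by blast
  obtain M where M: "\<And>x. \<bar>dir_deriv \<nu> \<psi> x\<bar> \<le> M" using dir_deriv_bounded[OF \<psi>] by blast
  define \<rho>' where "\<rho>' = \<rho> + (\<bar>t\<bar> + 1) * norm \<nu>"
  have far: "\<psi> (x + (t + s) *\<^sub>R \<nu>) = 0" if "\<bar>s\<bar> < 1" "x \<notin> cball 0 \<rho>'" for s x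
  proof (rule \<rho>(2))
    have "norm x \<le> norm (x + (t + s) *\<^sub>R \<nu>) + norm ((t + s) *\<^sub>R \<nu>)"
      by (metis add_diff_cancel norm_triangle_ineq4)
    moreover have "norm ((t + s) *\<^sub>R \<nu>) \<le> (\<bar>t\<bar> + 1) * norm \<nu>" using that by (auto intro!: mult_right_mono)
    ultimately show "x + (t + s) *\<^sub>R \<nu> \<notin> cball 0 \<rho>" using that by (auto simp: \<rho>'_def)
  qed
  let ?q = "\<lambda>s x. (\<psi> (x + (t + s) *\<^sub>R \<nu>) - \<psi> (x + t *\<^sub>R \<nu>)) / s"
  have qb: "\<bar>?q s x\<bar> \<le> M * indicator (cball 0 \<rho>') x" if s: "\<bar>s\<bar> < 1" "s \<noteq> 0" for s x
  proof (cases "x \<in> cball 0 \<rho>'")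
    case True
    have "\<bar>\<psi> (x + (t + s) *\<^sub>R \<nu>) - \<psi> (x + t *\<^sub>R \<nu>)\<bar> \<le> M * \<bar>(t + s) - t\<bar>"
      using field_differentiable_bound[of UNIV "\<lambda>t. \<psi> (x + t *\<^sub>R \<nu>)" "\<lambda>t. dir_deriv \<nu> \<psi> (x + t *\<^sub>R \<nu>)" M "t + s" t]
        DERIV_along_line[OF sm] M by simp
    then show ?thesis using True s by (simp add: divide_le_eq)
  next
    case False
    then show ?thesis using far[of s x] far[of 0 x] s by simp
  qed
  have ball_fin: "integrable lborel (\<lambda>x::real^'d. M * indicator (cball 0 \<rho>') x)"
    by (intro integrable_mult_right integrable_real_indicator emeasure_lborel_cball_finite) auto
  have int: "integrable lborel (\<lambda>x. f x * \<psi> (x + (t + s) *\<^sub>R \<nu>))" if "\<bar>s\<bar> < 1" for s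
  proof -
    have "compact (\<psi> ` cball 0 \<rho>)"
      by (rule compact_continuous_image) (auto intro: smooth_continuous sm)
    then obtain M' where M': "M' > 0" "\<And>x. x \<in> cball 0 \<rho> \<Longrightarrow> \<bar>\<psi> x\<bar> \<le> M'"
      by (metis bounded_pos compact_imp_bounded imageI real_norm_def)
    then have all: "\<bar>\<psi> x\<bar> \<le> M'" for x using \<rho>(2)[of x] by (cases "x \<in> cball 0 \<rho>") auto
    show ?thesis
    proof (rule Bochner_Integration.integrable_bound)
      show "integrable lborel (\<lambda>x::real^'d. M' * indicator (cball 0 \<rho>') x)"
        by (intro integrable_mult_right integrable_real_indicator emeasure_lborel_cball_finite) auto
      have "\<bar>f x * \<psi> (x + (t + s) *\<^sub>R \<nu>)\<bar> \<le> \<bar>M' * indicator (cball 0 \<rho>') x\<bar>" for x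
        using all[of "x + (t + s) *\<^sub>R \<nu>"] far[OF that, of x] fb[of x] M'(1)
          mult_mono[of "\<bar>f x\<bar>" 1 "\<bar>\<psi> (x + (t + s) *\<^sub>R \<nu>)\<bar>" M'] by (auto simp: abs_mult indicator_def)
      then show "AE x in lborel. norm (f x * \<psi> (x + (t + s) *\<^sub>R \<nu>)) \<le> norm (M' * indicator (cball 0 \<rho>') x)"
        by (intro AE_I2) simp
    qed measurable
  qed
  have "((\<lambda>s. \<integral>x. f x * ?q s x \<partial>lborel) \<longlongrightarrow> (\<integral>x. f x * dir_deriv \<nu> \<psi> (x + t *\<^sub>R \<nu>) \<partial>lborel)) (at 0 within ball 0 1)"
    unfolding tendsto_at_iff_sequentially comp_def
  proof (intro allI impI)
    fix X :: "nat \<Rightarrow> real" assume X: "\<forall>i. X i \<in> ball 0 1 - {0}" "X \<longlonglongrightarrow> 0"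
    show "(\<lambda>i. \<integral>x. f x * ?q (X i) x \<partial>lborel) \<longlonglongrightarrow> (\<integral>x. f x * dir_deriv \<nu> \<psi> (x + t *\<^sub>R \<nu>) \<partial>lborel)"
    proof (rule integral_dominated_convergence[OF _ _ ball_fin])
      show "AE x in lborel. (\<lambda>i. f x * ?q (X i) x) \<longlonglongrightarrow> f x * dir_deriv \<nu> \<psi> (x + t *\<^sub>R \<nu>)"
      proof (intro AE_I2 tendsto_mult tendsto_const)
        fix x
        have "((\<lambda>s. ?q s x) \<longlongrightarrow> dir_deriv \<nu> \<psi> (x + t *\<^sub>R \<nu>)) (at 0)"
          using DERIV_along_line[OF sm, of x \<nu> t] by (simp add: DERIV_def)
        then show "(\<lambda>i. ?q (X i) x) \<longlonglongrightarrow> dir_deriv \<nu> \<psi> (x + t *\<^sub>R \<nu>)"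
          using X unfolding tendsto_at_iff_sequentially comp_def by auto
      qed
      fix i
      have "\<bar>f x * ?q (X i) x\<bar> \<le> M * indicator (cball 0 \<rho>') x" for x
        using mult_mono[OF fb[of x] qb[of "X i" x]] X(1) by (auto simp: abs_mult dist_real_def)
      then show "AE x in lborel. norm (f x * ?q (X i) x) \<le> M * indicator (cball 0 \<rho>') x"
        by (intro AE_I2) simp
    qed measurable
  qed
  then have lim: "((\<lambda>s. \<integral>x. f x * ?q s x \<partial>lborel) \<longlongrightarrow> (\<integral>x. f x * dir_deriv \<nu> \<psi> (x + t *\<^sub>R \<nu>) \<partial>lborel)) (at 0)"
    using at_within_open[of "0::real" "ball 0 1"] by simp
  show ?thesis unfolding DERIV_def
  proof (rule Lim_transform_eventually[OF lim])
    have "eventually (\<lambda>s::real. \<bar>s\<bar> < 1) (at 0)"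
      using eventually_at[of "\<lambda>s. \<bar>s\<bar> < 1" "0::real" UNIV] by (auto simp: dist_real_def intro!: exI[of _ 1])
    then show "\<forall>\<^sub>F s in at 0. (\<integral>x. f x * ?q s x \<partial>lborel)
       = ((\<integral>x. f x * \<psi> (x + (t + s) *\<^sub>R \<nu>) \<partial>lborel) - (\<integral>x. f x * \<psi> (x + t *\<^sub>R \<nu>) \<partial>lborel)) / s"
    proof eventually_elim
      case (elim s)
      have "(\<integral>x. f x * ?q s x \<partial>lborel) = (\<integral>x. (f x * \<psi> (x + (t + s) *\<^sub>R \<nu>) - f x * \<psi> (x + t *\<^sub>R \<nu>)) / s \<partial>lborel)"
        by (intro Bochner_Integration.integral_cong) (auto simp: right_diff_distrib)
      then show ?case using int[OF elim] int[of 0] by simp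
    qed
  qed
qed

text \<open>The integral of a translate does not depend on the translation.\<close>

lemma integral_dir_deriv_zero:
  fixes \<psi> :: "real^'d::finite \<Rightarrow> real"
  assumes \<psi>: "\<psi> \<in> test_functions U"
  shows "(\<integral>x. dir_deriv \<nu> \<psi> x \<partial>lborel) = 0"
proof -
  have [measurable]: "\<psi> \<in> borel_measurable borel"
    by (intro borel_measurable_continuous_onI smooth_continuous test_functions_smooth[OF \<psi>])
  have const: "(\<integral>x. 1 * \<psi> (x + t *\<^sub>R \<nu>) \<partial>lborel) = integral\<^sup>L lborel \<psi>" for t
    using lborel_shift(2)[of \<psi> "t *\<^sub>R \<nu>"] by (simp add: add.commute)
  have "((\<lambda>t. integral\<^sup>L lborel \<psi>) has_real_derivative (\<integral>x. 1 * dir_deriv \<nu> \<psi> (x + 0 *\<^sub>R \<nu>) \<partial>lborel)) (at 0)"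
    using DERIV_translated_integral[OF _ _ \<psi>, of "\<lambda>x. 1" \<nu> 0] unfolding const by simp
  then have "(\<integral>x. 1 * dir_deriv \<nu> \<psi> (x + 0 *\<^sub>R \<nu>) \<partial>lborel) = 0"
    using DERIV_unique DERIV_const by blast
  then show ?thesis by simp
qed

lemma dir_deriv_translate:
  assumes "smooth \<psi>" shows "dir_deriv \<nu> (\<lambda>x. \<psi> (x + c)) x = dir_deriv \<nu> \<psi> (x + c)"
proof -
  have "((\<lambda>x. \<psi> (x + c)) has_derivative (\<lambda>h. frechet_derivative \<psi> (at (x + c)) h)) (at x)"
    by (rule has_derivative_compose[OF _ smooth_has_derivative[OF assms], of "\<lambda>x. x + c"]) (auto intro!: derivative_eq_intros)
  from partial_deriv_eq[OF this] show ?thesis by (simp add: dir_deriv_def partial_deriv_def)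
qed

lemma bounded_fmeasurable:
  fixes S :: "'a::euclidean_space set"
  shows "bounded S \<Longrightarrow> S \<in> sets borel \<Longrightarrow> S \<in> fmeasurable lborel"
  using emeasure_bounded_finite[of S] by (intro fmeasurableI) auto

lemma compact_inner_approximation:
  fixes P :: "'a::euclidean_space set"
  assumes "P \<in> sets borel" "bounded P" "e > 0"
  obtains K where "compact K" "K \<subseteq> P" "measure lborel P < measure lborel K + e"
proof -
  have P: "P \<in> lmeasurable"
    using assms by (intro bounded_set_imp_lmeasurable) (auto intro: sets_completionI_sets)
  obtain K where K: "closed K" "K \<subseteq> P" "P - K \<in> lmeasurable" "emeasure lebesgue (P - K) < ennreal e"
    using sets_lebesgue_inner_closed[of P e] assms by auto
  have cK: "compact K" using K assms by (meson bounded_subset compact_eq_bounded_closed)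
  have "measure lebesgue (P - K) = measure lebesgue P - measure lebesgue K"
    using P K cK by (intro measure_Diff) (auto simp: fmeasurable_def dest: lmeasurable_compact)
  moreover have "measure lebesgue (P - K) < e"
    using K(3,4) assms(3) by (simp add: emeasure_eq_measure2 ennreal_less_iff)
  ultimately show ?thesis using that[OF cK K(2)] assms(1) cK by (simp add: compact_imp_closed)
qed

text \<open>If \<open>T\<close> bounds the variation of \<open>1\<^sub>E\<close> in \<open>\<Omega>\<close>, then the translation by \<open>z\<close> changes \<open>1\<^sub>E\<close> on a set of
  measure at most \<open>|z| T\<close>, as far as the points with distance more than \<open>|z|\<close> to the complement of \<open>\<Omega>\<close>
  are concerned.  The sign of the difference is tested with a smooth \<open>\<psi>\<close> which is \<open>1\<close> and \<open>-1\<close> on compact sets that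
  almost exhaust the two parts \<open>P\<close> and \<open>Q\<close> of the difference set, and the mean value theorem is applied to the
  translates of \<open>\<psi>\<close>.\<close>

lemma difference_set_measure:
  fixes E \<Omega> :: "(real^'d::finite) set"
  assumes E: "E \<in> sets borel" and \<Omega>: "open \<Omega>" "bounded \<Omega>" and T: "T \<ge> 0"
    and dual: "\<And>\<psi> \<nu>. \<psi> \<in> test_functions \<Omega> \<Longrightarrow> (\<And>x. \<bar>\<psi> x\<bar> \<le> 1) \<Longrightarrow> norm \<nu> = 1 \<Longrightarrow>
       (\<integral>x. indicator E x * dir_deriv \<nu> \<psi> x \<partial>lborel) \<le> T"
  shows "measure lborel {x. infdist x (- \<Omega>) > norm z \<and> (x \<in> E) \<noteq> (x + z \<in> E)} \<le> norm z * T"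
proof (cases "z = 0")
  case False
  define r where "r = norm z"
  have r: "r > 0" using False by (simp add: r_def)
  \<comment> \<open>Translating the set by \<open>z\<close> amounts to translating test functions in the opposite direction.\<close>
  define \<nu> where "\<nu> = (- 1 / r) *\<^sub>R z"
  have \<nu>: "norm \<nu> = 1" "r *\<^sub>R \<nu> = - z" using r by (auto simp: \<nu>_def r_def)
  define U where "U = {x. infdist x (- \<Omega>) > r}"
  have U: "open U" unfolding U_def by (intro open_Collect_less continuous_intros)
  have near: "y \<in> \<Omega>" if "x \<in> U" "dist x y \<le> r" for x y
    using that infdist_le[of y "- \<Omega>" x] by (force simp: U_def)
  have U\<Omega>: "U \<subseteq> \<Omega>" using near r by fastforce
  have bU: "bounded U" using U\<Omega> \<Omega> bounded_subset by blast
  have [measurable]: "E \<in> sets borel" "U \<in> sets borel" using E U by auto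
  define P where "P = {x \<in> U. x + z \<in> E \<and> x \<notin> E}"
  define Q where "Q = {x \<in> U. x \<in> E \<and> x + z \<notin> E}"
  have PQ [measurable]: "P \<in> sets borel" "Q \<in> sets borel"
    unfolding P_def Q_def by measurable
  have bd: "bounded P" "bounded Q" using bU by (auto simp: P_def Q_def intro: bounded_subset)
  have fin: "P \<in> fmeasurable lborel" "Q \<in> fmeasurable lborel"
    using PQ bd by (simp_all add: bounded_fmeasurable)
  let ?\<mu> = "measure (lborel :: (real^'d) measure)"
  have main: "?\<mu> P + ?\<mu> Q \<le> r * T + e" if e: "e > 0" for e
  proof -
    obtain K where K: "compact K" "K \<subseteq> P" "?\<mu> P < ?\<mu> K + e/4"
      using compact_inner_approximation[of P "e/4"] PQ bd e by auto
    obtain J where J: "compact J" "J \<subseteq> Q" "?\<mu> Q < ?\<mu> J + e/4"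
      using compact_inner_approximation[of Q "e/4"] PQ bd e by auto
    have KJ: "K \<inter> J = {}" using K J by (auto simp: P_def Q_def)
    obtain G H where GH: "open G" "open H" "K \<subseteq> G" "J \<subseteq> H" "G \<inter> H = {}"
      by (rule separation_normal_compact[OF K(1) compact_imp_closed[OF J(1)] KJ])
    have "K \<subseteq> G \<inter> U" "J \<subseteq> H \<inter> U" using K J GH by (auto simp: P_def Q_def)
    then obtain \<psi>1 \<psi>2 where
      1: "elementary \<psi>1" "\<psi>1 \<in> test_functions (G \<inter> U)" "\<And>x. 0 \<le> \<psi>1 x" "\<And>x. \<psi>1 x \<le> 1" "\<And>x. x \<in> K \<Longrightarrow> \<psi>1 x = 1" and
      2: "elementary \<psi>2" "\<psi>2 \<in> test_functions (H \<inter> U)" "\<And>x. 0 \<le> \<psi>2 x" "\<And>x. \<psi>2 x \<le> 1" "\<And>x. x \<in> J \<Longrightarrow> \<psi>2 x = 1"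
      using smooth_urysohn[OF K(1), of "G \<inter> U"] smooth_urysohn[OF J(1), of "H \<inter> U"] GH U by (metis open_Int)
    have supp1: "\<psi>1 x = 0" if "x \<notin> G \<inter> U" for x
      using 1(2) that zero_outside_support[of x \<psi>1] by (auto simp: test_functions_def)
    have supp2: "\<psi>2 x = 0" if "x \<notin> H \<inter> U" for x
      using 2(2) that zero_outside_support[of x \<psi>2] by (auto simp: test_functions_def)
    define \<psi> where "\<psi> x = \<psi>1 x - \<psi>2 x" for x
    have \<psi>_le: "\<bar>\<psi> x\<bar> \<le> 1" for x
      unfolding \<psi>_def using 1(3,4)[of x] 2(3,4)[of x] by linarith
    have sm: "smooth \<psi>" unfolding \<psi>_def by (intro elementary_smooth elementary_diff 1 2)
    define S where "S = closure {x. \<psi>1 x \<noteq> 0} \<union> closure {x. \<psi>2 x \<noteq> 0}"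
    have S: "compact S" "S \<subseteq> U" using 1(2) 2(2) by (auto simp: S_def test_functions_def)
    have \<psi>S: "\<psi> x = 0" if "x \<notin> S" for x
      using that zero_outside_support[of x \<psi>1] zero_outside_support[of x \<psi>2] by (auto simp: S_def \<psi>_def)
    have test: "(\<lambda>x. \<psi> (x + t *\<^sub>R \<nu>)) \<in> test_functions \<Omega>" if t: "0 \<le> t" "t \<le> r" for t
    proof -
      let ?S = "(\<lambda>x. x - t *\<^sub>R \<nu>) ` S"
      have cS: "compact ?S" using S(1) by (intro compact_continuous_image continuous_intros)
      have "{x. \<psi> (x + t *\<^sub>R \<nu>) \<noteq> 0} \<subseteq> ?S"
      proof
        fix x assume "x \<in> {x. \<psi> (x + t *\<^sub>R \<nu>) \<noteq> 0}"
        then have "x + t *\<^sub>R \<nu> \<in> S" using \<psi>S by blast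
        then show "x \<in> ?S" by (intro image_eqI[of _ _ "x + t *\<^sub>R \<nu>"]) auto
      qed
      then have cl: "closure {x. \<psi> (x + t *\<^sub>R \<nu>) \<noteq> 0} \<subseteq> ?S"
        using cS by (intro closure_minimal) (auto simp: compact_imp_closed)
      moreover have "?S \<subseteq> \<Omega>"
        using S(2) near \<nu>(1) t by (force simp: dist_norm)
      ultimately show ?thesis unfolding test_functions_def
        using smooth_translate[OF sm] compact_closed_subset[OF cS _ cl] by auto
    qed
    have t0: "\<psi> \<in> test_functions \<Omega>" using test[of 0] r by simp
    define F where "F t = (\<integral>x. indicator E x * \<psi> (x + t *\<^sub>R \<nu>) \<partial>lborel)" for t
    have DF: "(F has_real_derivative (\<integral>x. indicator E x * dir_deriv \<nu> \<psi> (x + t *\<^sub>R \<nu>) \<partial>lborel)) (at t)" for t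
      unfolding F_def by (rule DERIV_translated_integral[OF _ _ t0]) (auto simp: indicator_def)
    obtain t where t: "0 < t" "t < r"
      and Ft: "F r - F 0 = (r - 0) * (\<integral>x. indicator E x * dir_deriv \<nu> \<psi> (x + t *\<^sub>R \<nu>) \<partial>lborel)"
      using MVT2[OF r, of F "\<lambda>t. \<integral>x. indicator E x * dir_deriv \<nu> \<psi> (x + t *\<^sub>R \<nu>) \<partial>lborel"] DF by blast
    have "(\<integral>x. indicator E x * dir_deriv \<nu> \<psi> (x + t *\<^sub>R \<nu>) \<partial>lborel) \<le> T"
      using dual[OF test[of t], of \<nu>] \<psi>_le \<nu> t by (simp add: dir_deriv_translate[OF sm])
    then have upper: "F r - F 0 \<le> r * T" unfolding Ft using r by (simp add: mult_left_mono)
    have m\<psi> [measurable]: "\<psi> \<in> borel_measurable borel"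
      by (intro borel_measurable_continuous_onI smooth_continuous sm)
    have Fr: "F r = (\<integral>x. indicator E (x + z) * \<psi> x \<partial>lborel)"
    proof -
      have "(\<integral>x. indicator E (z + x) * \<psi> ((z + x) + r *\<^sub>R \<nu>) \<partial>lborel) = F r"
        unfolding F_def by (rule lborel_shift(2)) measurable
      then show ?thesis by (simp add: \<nu> add.commute)
    qed
    have Sfin: "emeasure lborel S < \<infinity>"
      using emeasure_bounded_finite[OF compact_imp_bounded[OF S(1)]] by simp
    have Sm [measurable]: "S \<in> sets borel" using S(1) by (simp add: compact_imp_closed)
    have ints: "integrable lborel (\<lambda>x. indicator E (x + y) * \<psi> x :: real)" for y
    proof (rule Bochner_Integration.integrable_bound)
      show "integrable lborel (indicator S :: real^'d \<Rightarrow> real)"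
        using Sfin by (intro integrable_real_indicator) auto
      show "AE x in lborel. norm (indicator E (x + y) * \<psi> x :: real) \<le> norm (indicator S x :: real)"
        using \<psi>_le \<psi>S by (intro AE_I2) (auto simp: indicator_def)
    qed measurable
    have "F r - F 0 = (\<integral>x. (indicator E (x + z) - indicator E x) * \<psi> x \<partial>lborel)"
      unfolding Fr using ints[of z] ints[of 0] by (simp add: F_def left_diff_distrib)
    moreover have "(\<integral>x. 2 * indicator K x + 2 * indicator J x - indicator P x - indicator Q x \<partial>lborel)
       \<le> (\<integral>x. (indicator E (x + z) - indicator E x) * \<psi> x \<partial>lborel)"
    proof (rule integral_mono)
      have fKJ: "K \<in> fmeasurable lborel" "J \<in> fmeasurable lborel"
        using K(1) J(1) by (auto simp: fmeasurable_compact)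
      show "integrable lborel (\<lambda>x::real^'d. 2 * indicator K x + 2 * indicator J x - indicator P x - indicator Q x :: real)"
        using fin fKJ by (intro Bochner_Integration.integrable_add Bochner_Integration.integrable_diff integrable_mult_right integrable_real_indicator) (auto simp: fmeasurable_def)
      show "integrable lborel (\<lambda>x. (indicator E (x + z) - indicator E x) * \<psi> x :: real)"
        using ints[of z] ints[of 0] by (simp add: left_diff_distrib)
      fix x
      show "2 * indicator K x + 2 * indicator J x - indicator P x - indicator Q x
         \<le> (indicator E (x + z) - indicator E x) * \<psi> x"
      proof (cases "x \<in> K \<or> x \<in> J")
        case True
        then show ?thesis
        proof
          assume x: "x \<in> K"
          then have "x \<in> P" "x \<notin> J" "x \<notin> Q" "x \<notin> H" using K J GH by (auto simp: P_def Q_def)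
          then show ?thesis using x 1(5) supp2[of x] by (auto simp: \<psi>_def P_def)
        next
          assume x: "x \<in> J"
          then have "x \<in> Q" "x \<notin> K" "x \<notin> P" "x \<notin> G" using K J GH by (auto simp: P_def Q_def)
          then show ?thesis using x 2(5) supp1[of x] by (auto simp: \<psi>_def Q_def)
        qed
      next
        case False
        moreover have "\<psi> x = 0" if "x \<notin> U" using \<psi>S[of x] S(2) that by blast
        ultimately show ?thesis using \<psi>_le[of x]
          by (cases "x \<in> U") (auto simp: P_def Q_def indicator_def abs_le_iff)
      qed
    qed
    moreover have "(\<integral>x. 2 * indicator K x + 2 * indicator J x - indicator P x - indicator Q x \<partial>lborel)
       = 2 * ?\<mu> K + 2 * ?\<mu> J - ?\<mu> P - ?\<mu> Q"
    proof -
      have "integrable lborel (indicator X :: real^'d \<Rightarrow> real)" if "X \<in> fmeasurable lborel" for X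
        using that by (intro integrable_real_indicator) (auto simp: fmeasurable_def)
      then show ?thesis using fin K(1) J(1) by (simp add: fmeasurable_compact)
    qed
    ultimately show ?thesis using upper K(3) J(3) by linarith
  qed
  have "?\<mu> P + ?\<mu> Q \<le> r * T" by (rule field_le_epsilon) (rule main)
  moreover have "?\<mu> (P \<union> Q) \<le> ?\<mu> P + ?\<mu> Q" using PQ by (intro measure_Un_le) auto
  moreover have "{x. infdist x (- \<Omega>) > norm z \<and> (x \<in> E) \<noteq> (x + z \<in> E)} = P \<union> Q"
    by (auto simp: P_def Q_def U_def r_def)
  ultimately show ?thesis by (simp add: r_def)
qed auto

section \<open>Two-phase functions\<close>

text \<open>The points of \<open>\<Omega>\<close> within distance \<open>r\<close> of its complement.\<close>

definition inner_strip :: "'a::euclidean_space set \<Rightarrow> real \<Rightarrow> 'a set" where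
  "inner_strip \<Omega> r = {x \<in> \<Omega>. infdist x (- \<Omega>) \<le> r}"

lemma inner_strip_measurable: "open \<Omega> \<Longrightarrow> inner_strip \<Omega> r \<in> sets borel"
proof -
  assume "open \<Omega>"
  moreover have "closed {x. infdist x (- \<Omega>) \<le> r}" by (intro closed_Collect_le continuous_intros)
  moreover have "inner_strip \<Omega> r = \<Omega> \<inter> {x. infdist x (- \<Omega>) \<le> r}" by (auto simp: inner_strip_def)
  ultimately show ?thesis by auto
qed

lemma inner_strip_small:
  fixes \<Omega> :: "'a::euclidean_space set"
  assumes \<Omega>: "open \<Omega>" "bounded \<Omega>" and "\<eta> > 0"
  obtains r where "r > 0" "measure lborel (inner_strip \<Omega> r) < \<eta>"
proof -
  have ne: "- \<Omega> \<noteq> {}" using \<Omega>(2) not_bounded_UNIV by (metis Compl_UNIV_eq double_complement)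
  let ?A = "\<lambda>n. inner_strip \<Omega> (inverse (real (Suc n)))"
  have "(\<lambda>n. measure lborel (?A n)) \<longlonglongrightarrow> measure lborel (\<Inter>n. ?A n)"
  proof (rule Lim_measure_decseq)
    show "range ?A \<subseteq> sets lborel" using inner_strip_measurable[OF \<Omega>(1)] by auto
    show "decseq ?A" unfolding decseq_def inner_strip_def
      by (auto intro: order_trans simp: le_imp_inverse_le)
    have "bounded (?A n)" for n using \<Omega>(2) by (auto simp: inner_strip_def intro: bounded_subset)
    then show "emeasure lborel (?A n) \<noteq> \<infinity>" for n using emeasure_bounded_finite by (metis infinity_ennreal_def less_irrefl)
  qed
  moreover have "(\<Inter>n. ?A n) = {}"
  proof (rule ccontr)
    assume "\<not> ?thesis"
    then obtain x where x: "\<And>n. x \<in> ?A n" by blast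
    then have "x \<in> \<Omega>" by (simp add: inner_strip_def)
    then have "infdist x (- \<Omega>) > 0"
      using \<Omega>(1) ne in_closed_iff_infdist_zero[of "- \<Omega>" x] infdist_nonneg[of x "- \<Omega>"] by (auto simp: less_le)
    then obtain n where "inverse (real (Suc n)) < infdist x (- \<Omega>)" using reals_Archimedean by blast
    then show False using x[of n] by (simp add: inner_strip_def)
  qed
  ultimately have "(\<lambda>n. measure lborel (?A n)) \<longlonglongrightarrow> 0" by simp
  then have "eventually (\<lambda>n. measure lborel (?A n) < \<eta>) sequentially"
    using assms(3) by (simp add: order_tendstoD(2))
  then obtain n where "measure lborel (?A n) < \<eta>" by (auto simp: eventually_sequentially)
  then show ?thesis by (intro that[of "inverse (real (Suc n))"]) auto
qed

lemma inner_strip_linear_bound: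
  fixes \<Omega> :: "'a::euclidean_space set"
  assumes \<Omega>: "open \<Omega>" "bounded \<Omega>" and r: "r > 0" "measure lborel (inner_strip \<Omega> r) < \<eta>"
  shows "t \<ge> 0 \<Longrightarrow> measure lborel (inner_strip \<Omega> t) \<le> \<eta> + measure lborel \<Omega> / r * t"
proof (cases "t \<le> r")
  case True
  assume "t \<ge> 0"
  have "measure lborel (inner_strip \<Omega> t) \<le> measure lborel (inner_strip \<Omega> r)"
    using True \<Omega> inner_strip_measurable[OF \<Omega>(1)]
    by (intro measure_mono_fmeasurable bounded_fmeasurable) (auto simp: inner_strip_def intro: bounded_subset)
  moreover have "0 \<le> measure lborel \<Omega> / r * t" using r \<open>t \<ge> 0\<close> by simp
  ultimately show ?thesis using r(2) by linarith
next
  case False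
  assume "t \<ge> 0"
  have "measure lborel (inner_strip \<Omega> t) \<le> measure lborel \<Omega>"
    using \<Omega> inner_strip_measurable[OF \<Omega>(1)]
    by (intro measure_mono_fmeasurable bounded_fmeasurable) (auto simp: inner_strip_def)
  also have "\<dots> \<le> measure lborel \<Omega> / r * t"
    using False r mult_left_mono[of r t "measure lborel \<Omega>"] by (simp add: field_simps)
  also have "0 \<le> \<eta>" using r(2) measure_nonneg[of lborel "inner_strip \<Omega> r"] by linarith
  then have "measure lborel \<Omega> / r * t \<le> \<eta> + measure lborel \<Omega> / r * t" by simp
  finally show ?thesis .
qed

text \<open>For \<open>E \<subseteq> \<Omega>\<close> this is \<open>1 - lam\<close> on \<open>E\<close>, \<open>- lam\<close> on \<open>\<Omega> - E\<close> and \<open>0\<close> elsewhere.\<close>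

definition two_phase :: "real \<Rightarrow> 'a::euclidean_space set \<Rightarrow> 'a set \<Rightarrow> 'a \<Rightarrow> real" where
  "two_phase lam \<Omega> E x = indicator E x - lam * indicator \<Omega> x"

lemma two_phase_integrable:
  assumes "open \<Omega>" "bounded \<Omega>" "E \<in> sets borel" "E \<subseteq> \<Omega>"
  shows "integrable lborel (two_phase lam \<Omega> E)" "integrable lborel (\<lambda>x. (two_phase lam \<Omega> E x)\<^sup>2)"
proof -
  have f: "E \<in> fmeasurable lborel" "\<Omega> \<in> fmeasurable lborel"
    using assms by (auto intro!: bounded_fmeasurable intro: bounded_subset)
  then have i: "integrable lborel (indicator E :: 'a \<Rightarrow> real)" "integrable lborel (indicator \<Omega> :: 'a \<Rightarrow> real)"
    by (auto intro!: integrable_real_indicator simp: fmeasurable_def)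
  show "integrable lborel (two_phase lam \<Omega> E)" unfolding two_phase_def using i by auto
  have "(two_phase lam \<Omega> E x)\<^sup>2 = (1 - 2 * lam) * indicator E x + lam\<^sup>2 * indicator \<Omega> x" for x
    using assms(4) by (auto simp: two_phase_def indicator_def power2_eq_square algebra_simps)
  then show "integrable lborel (\<lambda>x. (two_phase lam \<Omega> E x)\<^sup>2)" using i by simp
qed

lemma two_phase_square_ge:
  assumes "open \<Omega>" "bounded \<Omega>" "E \<in> sets borel" "E \<subseteq> \<Omega>" and lam: "0 < lam" "lam < 1"
  shows "(min (1 - lam) lam)\<^sup>2 * measure lborel \<Omega> \<le> (\<integral>x. (two_phase lam \<Omega> E x)\<^sup>2 \<partial>lborel)"
proof -
  have "\<Omega> \<in> fmeasurable lborel" using assms by (auto intro!: bounded_fmeasurable)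
  then have i: "integrable lborel (indicator \<Omega> :: 'a \<Rightarrow> real)"
    by (auto intro!: integrable_real_indicator simp: fmeasurable_def)
  have "(min (1 - lam) lam)\<^sup>2 * measure lborel \<Omega> = (\<integral>x. (min (1 - lam) lam)\<^sup>2 * indicator \<Omega> x \<partial>lborel)"
    using assms(1) by simp
  also have "\<dots> \<le> (\<integral>x. (two_phase lam \<Omega> E x)\<^sup>2 \<partial>lborel)"
  proof (rule integral_mono)
    show "(min (1 - lam) lam)\<^sup>2 * indicator \<Omega> x \<le> (two_phase lam \<Omega> E x)\<^sup>2" for x
    proof -
      have "(min (1 - lam) lam)\<^sup>2 \<le> (1 - lam)\<^sup>2" "(min (1 - lam) lam)\<^sup>2 \<le> lam\<^sup>2"
        using lam by (auto intro!: power_mono)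
      then show ?thesis by (auto simp: two_phase_def indicator_def)
    qed
  qed (use i two_phase_integrable[OF assms(1-4)] in auto)
  finally show ?thesis .
qed

text \<open>A difference of values is at most \<open>1\<close> in modulus.  It is nonzero only if \<open>x\<close> or \<open>x + z\<close> lies in the
  strip, or if both lie in \<open>\<Omega>\<close> and \<open>E\<close> contains exactly one of them.\<close>

lemma two_phase_shift_defect:
  fixes E \<Omega> :: "(real^'d::finite) set"
  assumes E: "E \<in> sets borel" "E \<subseteq> \<Omega>" and \<Omega>: "open \<Omega>" "bounded \<Omega>" and T: "T \<ge> 0" and lam: "0 < lam" "lam < 1"
    and dual: "\<And>\<psi> \<nu>. \<psi> \<in> test_functions \<Omega> \<Longrightarrow> (\<And>x. \<bar>\<psi> x\<bar> \<le> 1) \<Longrightarrow> norm \<nu> = 1 \<Longrightarrow>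
       (\<integral>x. indicator E x * dir_deriv \<nu> \<psi> x \<partial>lborel) \<le> T"
  shows "shift_defect (two_phase lam \<Omega> E) z \<le> norm z * T + 2 * measure lborel (inner_strip \<Omega> (norm z))"
proof -
  let ?\<theta> = "two_phase lam \<Omega> E" and ?S = "inner_strip \<Omega> (norm z)"
  define D where "D = {x. infdist x (- \<Omega>) > norm z \<and> (x \<in> E) \<noteq> (x + z \<in> E)}"
  have [measurable]: "E \<in> sets borel" "\<Omega> \<in> sets borel" "?S \<in> sets borel"
    using E \<Omega> inner_strip_measurable by auto
  have D\<Omega>: "D \<subseteq> \<Omega>"
  proof
    fix x assume "x \<in> D"
    then have "norm z < infdist x (- \<Omega>)" by (simp add: D_def)
    then have "infdist x (- \<Omega>) > 0" using norm_ge_zero[of z] by linarith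
    then show "x \<in> \<Omega>" by (metis ComplI infdist_zero less_irrefl)
  qed
  have "open {x. infdist x (- \<Omega>) > norm z}" by (intro open_Collect_less continuous_intros)
  then have Dm0: "{x. infdist x (- \<Omega>) > norm z} \<in> sets borel" by auto
  have Dm [measurable]: "D \<in> sets borel"
  proof -
    have "{x. (x \<in> E) \<noteq> (x + z \<in> E)} \<in> sets borel" by measurable
    moreover have "D = {x. infdist x (- \<Omega>) > norm z} \<inter> {x. (x \<in> E) \<noteq> (x + z \<in> E)}" by (auto simp: D_def)
    ultimately show ?thesis using Dm0 by auto
  qed
  have fin: "D \<in> fmeasurable lborel" "?S \<in> fmeasurable lborel"
    using bounded_subset[OF \<Omega>(2) D\<Omega>] bounded_subset[OF \<Omega>(2), of ?S]
    by (auto intro!: bounded_fmeasurable simp: inner_strip_def[of \<Omega> "norm z", symmetric]) (auto simp: inner_strip_def)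
  then have i: "integrable lborel (indicator D :: _ \<Rightarrow> real)" "integrable lborel (indicator ?S :: _ \<Rightarrow> real)"
    by (auto intro!: integrable_real_indicator simp: fmeasurable_def)
  have sh: "integrable lborel (\<lambda>x. indicator ?S (z + x) :: real)"
    "(\<integral>x. indicator ?S (z + x) \<partial>lborel) = (\<integral>x. indicator ?S x \<partial>lborel :: real)"
    using lborel_shift[of "indicator ?S" z] i(2) by auto
  have near: "infdist x (- \<Omega>) \<le> norm z" if "x \<notin> \<Omega> \<or> x + z \<notin> \<Omega>" for x
    using that infdist_le[of "x + z" "- \<Omega>" x] by (auto simp: dist_norm)
  have near': "infdist (x + z) (- \<Omega>) \<le> norm z" if "x \<notin> \<Omega>" for x
    using that infdist_le[of x "- \<Omega>" "x + z"] by (auto simp: dist_norm)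
  have point: "(?\<theta> (x + z) - ?\<theta> x)\<^sup>2 \<le> indicator D x + indicator ?S x + indicator ?S (z + x)" for x
  proof -
    have sq1: "(?\<theta> (x + z) - ?\<theta> x)\<^sup>2 \<le> 1"
    proof -
      have "\<bar>?\<theta> (x + z) - ?\<theta> x\<bar> \<le> 1" using lam E(2) by (auto simp: two_phase_def indicator_def)
      then show ?thesis by (simp add: abs_square_le_1)
    qed
    consider "x \<in> ?S" | "x + z \<in> ?S" | "x \<in> \<Omega>" "infdist x (- \<Omega>) > norm z" | "x \<notin> \<Omega>" "x + z \<notin> \<Omega>"
    proof (cases "x \<in> \<Omega>")
      case True
      then show ?thesis using that(1,3) by (cases "infdist x (- \<Omega>) \<le> norm z") (auto simp: inner_strip_def)
    next
      case False
      then show ?thesis using that(2,4) near'[OF False] by (cases "x + z \<in> \<Omega>") (auto simp: inner_strip_def)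
    qed
    then show ?thesis
    proof cases
      case 3
      then have "x + z \<in> \<Omega>" using near[of x] by auto
      then show ?thesis using sq1 3 by (cases "x \<in> D") (auto simp: indicator_def D_def two_phase_def)
    next
      case 4
      then have "x \<notin> E" "x + z \<notin> E" using E by auto
      then show ?thesis using 4 by (simp add: two_phase_def)
    qed (use sq1 in \<open>auto simp: indicator_def add.commute\<close>)
  qed
  have "shift_defect ?\<theta> z \<le> (\<integral>x. indicator D x + indicator ?S x + indicator ?S (z + x) \<partial>lborel)"
    unfolding shift_defect_def
  proof (rule integral_mono_AE')
    show "integrable lborel (\<lambda>x. indicator D x + indicator ?S x + indicator ?S (z + x) :: real)"
      using i sh by auto
  qed (use point in auto)
  also have "\<dots> = measure lborel D + 2 * measure lborel ?S" using i sh by simp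
  also have "measure lborel D \<le> norm z * T"
    unfolding D_def by (rule difference_set_measure[OF E(1) \<Omega> T dual])
  finally show ?thesis by simp
qed

lemma two_phase_gauss_defect:
  fixes E \<Omega> :: "(real^'d::finite) set"
  assumes E: "E \<in> sets borel" "E \<subseteq> \<Omega>" and \<Omega>: "open \<Omega>" "bounded \<Omega>" and T: "T \<ge> 0" and lam: "0 < lam" "lam < 1"
    and dual: "\<And>\<psi> \<nu>. \<psi> \<in> test_functions \<Omega> \<Longrightarrow> (\<And>x. \<bar>\<psi> x\<bar> \<le> 1) \<Longrightarrow> norm \<nu> = 1 \<Longrightarrow>
       (\<integral>x. indicator E x * dir_deriv \<nu> \<psi> x \<partial>lborel) \<le> T"
    and r: "r > 0" "measure lborel (inner_strip \<Omega> r) < \<eta>" and R: "R > 0"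
  shows "(\<integral>z. gauss_kernel (1 / R\<^sup>2) z * shift_defect (two_phase lam \<Omega> E) z \<partial>lborel)
    \<le> 2 * \<eta> + (T + 2 * measure lborel \<Omega> / r) * sqrt 2 ^ CARD('d) / R"
proof -
  let ?G = "gauss_kernel (1 / R\<^sup>2) :: real^'d \<Rightarrow> real" and ?\<theta> = "two_phase lam \<Omega> E"
  let ?k = "T + 2 * measure lborel \<Omega> / r"
  have s: "1 / R\<^sup>2 > 0" using R by simp
  have k0: "?k \<ge> 0" using T r by simp
  note gi = gauss_kernel_integral[OF s, where 'a="real^'d"] gauss_kernel_first_moment[OF s, where 'a="real^'d"]
  have point: "?G z * shift_defect ?\<theta> z \<le> 2 * \<eta> * ?G z + ?k * (?G z * norm z)" for z
  proof -
    have "shift_defect ?\<theta> z \<le> norm z * T + 2 * measure lborel (inner_strip \<Omega> (norm z))"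
      by (rule two_phase_shift_defect[OF E \<Omega> T lam dual])
    also have "\<dots> \<le> norm z * T + 2 * (\<eta> + measure lborel \<Omega> / r * norm z)"
      using inner_strip_linear_bound[OF \<Omega> r, of "norm z"] by simp
    finally have "?G z * shift_defect ?\<theta> z \<le> ?G z * (norm z * T + 2 * (\<eta> + measure lborel \<Omega> / r * norm z))"
      by (intro mult_left_mono gauss_kernel_nonneg[OF s])
    then show ?thesis by (simp add: algebra_simps)
  qed
  have "(\<integral>z. ?G z * shift_defect ?\<theta> z \<partial>lborel) \<le> (\<integral>z. 2 * \<eta> * ?G z + ?k * (?G z * norm z) \<partial>lborel)"
    using gi gaussian_plancherel(1)[OF two_phase_integrable[OF \<Omega> E] s] by (intro integral_mono point) auto
  also have "\<dots> = 2 * \<eta> + ?k * (\<integral>z. ?G z * norm z \<partial>lborel)" using gi by simp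
  also have "\<dots> \<le> 2 * \<eta> + ?k * (sqrt (1 / R\<^sup>2) * sqrt 2 ^ DIM(real^'d))"
    using gi(4) k0 by (intro add_left_mono mult_left_mono)
  finally show ?thesis using R by (simp add: real_sqrt_divide)
qed

section \<open>The boundary of a Lipschitz domain\<close>

lemma lipschitz_frontier_negligible:
  fixes U :: "'a::euclidean_space set"
  assumes U: "open U" and lip: "lipschitz_boundary U"
  shows "negligible (frontier U)"
proof (subst locally_negligible_alt, rule ballI)
  fix x assume "x \<in> frontier U"
  then have "\<exists>r>0. \<exists>\<nu> g K. norm \<nu> = 1 \<and> K-lipschitz_on {z. z \<bullet> \<nu> = 0} (g :: 'a \<Rightarrow> real)
        \<and> U \<inter> ball x r = {y \<in> ball x r. g (y - (y \<bullet> \<nu>) *\<^sub>R \<nu>) < y \<bullet> \<nu>}"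
    by (rule bspec[OF lip[unfolded lipschitz_boundary_def]])
  then obtain r \<nu> g K where r: "r > 0" and \<nu>: "norm \<nu> = 1"
    and g: "K-lipschitz_on {z. z \<bullet> \<nu> = 0} (g :: 'a \<Rightarrow> real)"
    and epi: "U \<inter> ball x r = {y \<in> ball x r. g (y - (y \<bullet> \<nu>) *\<^sub>R \<nu>) < y \<bullet> \<nu>}"
    by (elim exE conjE) (rule that; assumption)
  define \<pi> where "\<pi> y = y - (y \<bullet> \<nu>) *\<^sub>R \<nu>" for y
  have \<nu>\<nu>: "\<nu> \<bullet> \<nu> = 1" using \<nu> by (simp add: norm_eq_1)
  have \<pi>: "\<pi> y \<in> {z. z \<bullet> \<nu> = 0}" for y by (simp add: \<pi>_def inner_diff_left \<nu>\<nu>)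
  have cont: "continuous_on UNIV (\<lambda>y. g (\<pi> y))"
  proof (rule continuous_on_compose2[OF lipschitz_on_continuous_on[OF g]])
    show "continuous_on UNIV \<pi>" unfolding \<pi>_def by (intro continuous_intros)
  qed (use \<pi> in auto)
  have in_U: "w \<in> U \<longleftrightarrow> g (\<pi> w) < w \<bullet> \<nu>" if "w \<in> ball x r" for w
  proof -
    have "w \<in> U \<inter> ball x r \<longleftrightarrow> w \<in> {y \<in> ball x r. g (\<pi> y) < y \<bullet> \<nu>}"
      unfolding \<pi>_def by (simp only: epi)
    then show ?thesis using that by simp
  qed
  let ?Z = "{z. z \<bullet> \<nu> = 0}" and ?f = "\<lambda>z. z + g z *\<^sub>R \<nu>"
  \<comment> \<open>Locally the boundary lies in the graph of \<open>g\<close>, a Lipschitz image of a hyperplane.\<close>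
  have graph: "frontier U \<inter> ball x r \<subseteq> ?f ` ?Z"
  proof
    fix y assume y: "y \<in> frontier U \<inter> ball x r"
    have "y \<notin> U" using y U by (simp add: frontier_def interior_open)
    then have ge: "y \<bullet> \<nu> \<le> g (\<pi> y)" using in_U y by simp
    have "\<not> y \<bullet> \<nu> < g (\<pi> y)"
    proof
      assume lt: "y \<bullet> \<nu> < g (\<pi> y)"
      have "open ({y. y \<bullet> \<nu> < g (\<pi> y)} \<inter> ball x r)"
        by (intro open_Int open_Collect_less continuous_intros cont) auto
      moreover have "y \<in> {y. y \<bullet> \<nu> < g (\<pi> y)} \<inter> ball x r" using lt y by simp
      moreover have "y \<in> closure U" using y by (simp add: frontier_def)
      ultimately have "({y. y \<bullet> \<nu> < g (\<pi> y)} \<inter> ball x r) \<inter> U \<noteq> {}"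
        using open_Int_closure_eq_empty by blast
      then obtain w where "w \<in> U" "w \<in> ball x r" "w \<bullet> \<nu> < g (\<pi> w)" by blast
      then show False using in_U by simp
    qed
    then have "g (\<pi> y) = y \<bullet> \<nu>" using ge by simp
    then have "y = ?f (\<pi> y)" by (simp add: \<pi>_def)
    then show "y \<in> ?f ` ?Z" using \<pi> by blast
  qed
  have "negligible (?f ` ?Z)"
  proof (rule negligible_locally_Lipschitz_image)
    have "\<nu> \<noteq> 0" using \<nu> by auto
    then show "negligible ?Z" using negligible_hyperplane[of \<nu> 0] by (simp add: inner_commute)
    fix z assume z: "z \<in> ?Z"
    have "norm (?f y - ?f z) \<le> (1 + K) * norm (y - z)" if "y \<in> ?Z" for y
    proof -
      have "norm (?f y - ?f z) = norm ((y - z) + (g y - g z) *\<^sub>R \<nu>)" by (simp add: algebra_simps)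
      also have "\<dots> \<le> norm (y - z) + \<bar>g y - g z\<bar>"
        using norm_triangle_ineq[of "y - z" "(g y - g z) *\<^sub>R \<nu>"] \<nu> by simp
      also have "\<bar>g y - g z\<bar> \<le> K * norm (y - z)"
        using lipschitz_onD[OF g that z] by (simp add: dist_norm)
      finally show ?thesis by (simp add: algebra_simps)
    qed
    then show "\<exists>T B. open T \<and> z \<in> T \<and> (\<forall>y\<in>?Z \<inter> T. norm (?f y - ?f z) \<le> B * norm (y - z))"
      by (intro exI[of _ UNIV] exI[of _ "1 + K"]) auto
  qed simp
  then have "negligible (frontier U \<inter> ball x r)" using graph negligible_subset by blast
  moreover have "openin (top_of_set (frontier U)) (frontier U \<inter> ball x r)"
    by (simp add: openin_open_Int)
  ultimately show "\<exists>T. openin (top_of_set (frontier U)) T \<and> x \<in> T \<and> negligible T"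
    using \<open>x \<in> frontier U\<close> r by (intro exI[of _ "frontier U \<inter> ball x r"]) auto
qed

section \<open>The symbol\<close>

lemma subspaces_in_hyperplanes:
  fixes W :: "'a::euclidean_space set set"
  assumes "finite W" "\<And>S. S \<in> W \<Longrightarrow> subspace S" "\<Union>W \<noteq> UNIV"
  obtains N where "finite N" "\<And>\<nu>. \<nu> \<in> N \<Longrightarrow> norm \<nu> = 1" "\<And>v. v \<in> \<Union>W \<Longrightarrow> \<exists>\<nu>\<in>N. v \<bullet> \<nu> = 0"
proof -
  have "\<exists>\<nu>. norm \<nu> = 1 \<and> (\<forall>v\<in>S. v \<bullet> \<nu> = 0)" if "S \<in> W" for S
  proof -
    have S: "subspace S" "S \<noteq> UNIV" using assms that by auto
    have "dim S < DIM('a)"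
      using S dim_eq_full[of S] dim_subset_UNIV[of S] by (metis le_neq_implies_less span_eq_iff)
    then obtain x where x: "x \<noteq> 0" "\<And>y. y \<in> span S \<Longrightarrow> orthogonal x y"
      using orthogonal_to_subspace_exists by blast
    show ?thesis
    proof (intro exI[of _ "x /\<^sub>R norm x"] conjI ballI)
      show "v \<bullet> (x /\<^sub>R norm x) = 0" if "v \<in> S" for v
        using x(2)[OF span_base[OF that]] by (simp add: orthogonal_def inner_commute)
    qed (use x(1) in simp)
  qed
  then obtain n where n: "\<And>S. S \<in> W \<Longrightarrow> norm (n S) = 1 \<and> (\<forall>v\<in>S. v \<bullet> n S = 0)" by metis
  show ?thesis by (rule that[of "n ` W"]) (use assms(1) n in auto)
qed

lemma op_symbol_scale:
  fixes \<omega> :: "real^'d::finite"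
  shows "op_symbol m a (t *\<^sub>R \<omega>) = t ^ m *\<^sub>R op_symbol m a \<omega>"
proof -
  have "(\<Prod>i\<in>UNIV. ((t *\<^sub>R \<omega>) $ i) ^ \<alpha> i) = t ^ m * (\<Prod>i\<in>UNIV. (\<omega> $ i) ^ \<alpha> i)" if "\<alpha> \<in> multi_indices m" for \<alpha>
    using that by (simp add: power_mult_distrib prod.distrib power_sum[symmetric] multi_indices_def)
  then show ?thesis unfolding op_symbol_def by (simp add: scaleR_sum_right)
qed

lemma matrix_vector_mult_norm_le:
  fixes M :: "real^'n::finite^'k::finite"
  shows "norm (M *v x) \<le> norm M * norm x"
proof -
  have "norm (M *v x) = L2_set (\<lambda>i. norm ((M $ i) \<bullet> x)) UNIV"
    by (simp add: norm_vec_def matrix_vector_mul_component)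
  also have "\<dots> \<le> L2_set (\<lambda>i. norm (M $ i) * norm x) UNIV"
    by (intro L2_set_mono) (auto intro: Cauchy_Schwarz_ineq2)
  also have "\<dots> = norm M * norm x"
    by (simp add: L2_set_left_distrib[symmetric] norm_vec_def)
  finally show ?thesis .
qed

lemma op_symbol_sphere_bounded:
  fixes a :: "('d::finite \<Rightarrow> nat) \<Rightarrow> real^'n::finite^'k::finite"
  obtains K where "K > 0" "\<And>\<omega> x. norm \<omega> = 1 \<Longrightarrow> norm (op_symbol m a \<omega> *v x) \<le> K * norm x"
proof (rule that[of "(\<Sum>\<alpha>\<in>multi_indices m. norm (a \<alpha>)) + 1"])
  show "(\<Sum>\<alpha>\<in>multi_indices m. norm (a \<alpha>)) + 1 > 0" by (intro add_nonneg_pos sum_nonneg) auto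
  fix \<omega> :: "real^'d" and x assume \<omega>: "norm \<omega> = 1"
  have "norm (op_symbol m a \<omega>) \<le> (\<Sum>\<alpha>\<in>multi_indices m. norm (a \<alpha>))"
    unfolding op_symbol_def
  proof (rule sum_norm_le)
    fix \<alpha> :: "'d \<Rightarrow> nat"
    have "\<bar>\<Prod>i\<in>UNIV. (\<omega> $ i) ^ \<alpha> i\<bar> \<le> 1"
      unfolding abs_prod power_abs
      using component_le_norm_cart[of \<omega>] \<omega> by (intro prod_le_1) (auto intro!: power_le_one)
    then show "norm ((\<Prod>i\<in>UNIV. (\<omega> $ i) ^ \<alpha> i) *\<^sub>R a \<alpha>) \<le> norm (a \<alpha>)"
      by (simp add: mult_left_le_one_le)
  qed
  then show "norm (op_symbol m a \<omega> *v x) \<le> ((\<Sum>\<alpha>\<in>multi_indices m. norm (a \<alpha>)) + 1) * norm x"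
    using matrix_vector_mult_norm_le[of "op_symbol m a \<omega>" x]
    by (meson mult_right_mono norm_ge_zero order_trans le_add_same_cancel1 zero_le_one)
qed

text \<open>The infimum of a nonempty set of extended naturals is attained.\<close>

lemma max_vanishing_order_lower_bound:
  fixes p :: "real^'d::finite \<Rightarrow> real"
  assumes "max_vanishing_order p = enat L" and p0: "\<And>\<xi>. p \<xi> \<ge> 0" and V: "V = {\<xi>. p \<xi> = 0}"
  obtains c where "c > 0" "\<And>\<omega>. norm \<omega> = 1 \<Longrightarrow> \<omega> \<notin> V \<Longrightarrow> c \<le> p \<omega> / infdist \<omega> V ^ (2 * L)"
proof -
  let ?q = "\<lambda>l \<xi>. p \<xi> / infdist \<xi> V ^ (2 * l)"
  let ?A = "{l::nat. (INF \<xi>\<in>sphere 0 1 - V. ?q l \<xi>) > 0}"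
  have inf: "Inf (enat ` ?A) = enat L"
    using assms(1) unfolding max_vanishing_order_def V[symmetric] Let_def by simp
  have ne: "enat ` ?A \<noteq> {}"
  proof
    assume "enat ` ?A = {}"
    then have "Inf (enat ` ?A) = Inf {}" by (simp only:)
    then show False using inf by (simp add: Inf_enat_def)
  qed
  have "Inf (enat ` ?A) \<in> enat ` ?A"
  proof -
    obtain y where "y \<in> enat ` ?A" using ne by blast
    then have "(LEAST x. x \<in> enat ` ?A) \<in> enat ` ?A" by (rule LeastI[of "\<lambda>x. x \<in> enat ` ?A"])
    then show ?thesis unfolding Inf_enat_def using ne by (simp only: if_False)
  qed
  then have pos: "(INF \<xi>\<in>sphere 0 1 - V. ?q L \<xi>) > 0" using inf by auto
  have "bdd_below (?q L ` (sphere 0 1 - V))"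
    by (rule bdd_belowI[of _ 0]) (auto simp: p0)
  then have "(INF \<xi>\<in>sphere 0 1 - V. ?q L \<xi>) \<le> ?q L \<omega>" if "norm \<omega> = 1" "\<omega> \<notin> V" for \<omega>
    using that by (intro cINF_lower) auto
  then show ?thesis using that pos by blast
qed

text \<open>In the application \<open>X\<close> and \<open>x\<close> are the transforms of the residual and of the two-phase
  function at \<open>\<xi>\<close>.  By homogeneity the relation between them can be moved to the unit sphere.\<close>

lemma symbol_lower_bound:
  fixes a :: "('d::finite \<Rightarrow> nat) \<Rightarrow> real^'n::finite^'k::finite" and b :: "real^'n"
  assumes p: "p = (\<lambda>\<xi>. (norm (op_symbol m a \<xi> *v b))\<^sup>2)"
    and L: "max_vanishing_order p = enat L" and V: "V = {\<xi>. p \<xi> = 0}" "V \<noteq> {}"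
    and N: "\<And>\<nu>. \<nu> \<in> N \<Longrightarrow> norm \<nu> = 1" "\<And>v. v \<in> V \<Longrightarrow> \<exists>\<nu>\<in>N. v \<bullet> \<nu> = 0"
  obtains C where "C > 0"
    "\<And>\<xi> t x X. \<xi> \<noteq> 0 \<Longrightarrow> 0 < t \<Longrightarrow> (\<And>\<nu>. \<nu> \<in> N \<Longrightarrow> t * norm \<xi> \<le> \<bar>\<xi> \<bullet> \<nu>\<bar>) \<Longrightarrow>
       op_symbol m a \<xi> *v X = x *\<^sub>R (op_symbol m a \<xi> *v b) \<Longrightarrow> t ^ (2 * L) * x\<^sup>2 \<le> C * (norm X)\<^sup>2"
proof -
  obtain K where K: "K > 0" "\<And>\<omega> x. norm \<omega> = 1 \<Longrightarrow> norm (op_symbol m a \<omega> *v x) \<le> K * norm x"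
    using op_symbol_sphere_bounded[of m a] by blast
  have p0: "p \<xi> \<ge> 0" for \<xi> by (simp add: p)
  obtain c where c: "c > 0" "\<And>\<omega>. norm \<omega> = 1 \<Longrightarrow> \<omega> \<notin> V \<Longrightarrow> c \<le> p \<omega> / infdist \<omega> V ^ (2 * L)"
    using max_vanishing_order_lower_bound[OF L p0 V(1)] by blast
  show ?thesis
  proof (rule that[of "K\<^sup>2 / c"])
    show "K\<^sup>2 / c > 0" using K c by simp
    fix \<xi> t x X
    assume \<xi>: "\<xi> \<noteq> 0" and t: "0 < t" "\<And>\<nu>. \<nu> \<in> N \<Longrightarrow> t * norm \<xi> \<le> \<bar>\<xi> \<bullet> \<nu>\<bar>"
      and eq: "op_symbol m a \<xi> *v X = x *\<^sub>R (op_symbol m a \<xi> *v b)"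
    define \<omega> where "\<omega> = \<xi> /\<^sub>R norm \<xi>"
    have \<omega>: "norm \<omega> = 1" "\<xi> = norm \<xi> *\<^sub>R \<omega>" using \<xi> by (auto simp: \<omega>_def)
    have t\<omega>: "t \<le> \<bar>\<omega> \<bullet> \<nu>\<bar>" if "\<nu> \<in> N" for \<nu>
      using t(2)[OF that] \<xi> by (simp add: \<omega>_def abs_mult field_simps)
    have dist: "t \<le> infdist \<omega> V"
      unfolding infdist_notempty[OF V(2)]
    proof (rule cINF_greatest[OF V(2)])
      fix v assume "v \<in> V"
      then obtain \<nu> where \<nu>: "\<nu> \<in> N" "v \<bullet> \<nu> = 0" using N(2) by blast
      have "\<bar>\<omega> \<bullet> \<nu>\<bar> = \<bar>(\<omega> - v) \<bullet> \<nu>\<bar>" using \<nu>(2) by (simp add: inner_diff_left)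
      also have "\<dots> \<le> norm (\<omega> - v) * norm \<nu>" by (rule Cauchy_Schwarz_ineq2)
      finally show "t \<le> dist \<omega> v" using t\<omega>[OF \<nu>(1)] N(1)[OF \<nu>(1)] by (simp add: dist_norm)
    qed
    then have pos: "infdist \<omega> V > 0" using t(1) by simp
    then have "\<omega> \<notin> V" by (metis infdist_zero less_irrefl)
    then have "c * infdist \<omega> V ^ (2 * L) \<le> p \<omega>" using c(2)[OF \<omega>(1)] pos by (simp add: field_simps)
    moreover have "c * t ^ (2 * L) \<le> c * infdist \<omega> V ^ (2 * L)"
      using c(1) t(1) dist by (intro mult_left_mono power_mono) auto
    ultimately have lower: "c * t ^ (2 * L) \<le> p \<omega>" by simp
    have "norm \<xi> ^ m *\<^sub>R (op_symbol m a \<omega> *v X) = norm \<xi> ^ m *\<^sub>R (x *\<^sub>R (op_symbol m a \<omega> *v b))"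
      using eq by (subst (asm) (1 2) \<omega>(2)) (simp add: op_symbol_scale scaleR_matrix_vector_assoc mult.commute)
    moreover have "norm \<xi> ^ m \<noteq> 0" using \<xi> by simp
    ultimately have "op_symbol m a \<omega> *v X = x *\<^sub>R (op_symbol m a \<omega> *v b)"
      by (rule scaleR_left_imp_eq[rotated])
    then have "x\<^sup>2 * p \<omega> = (norm (op_symbol m a \<omega> *v X))\<^sup>2" by (simp add: p power_mult_distrib)
    also have "\<dots> \<le> (K * norm X)\<^sup>2" using K(2)[OF \<omega>(1)] by (intro power_mono) auto
    finally have "x\<^sup>2 * p \<omega> \<le> K\<^sup>2 * (norm X)\<^sup>2" by (simp add: power_mult_distrib)
    moreover have "x\<^sup>2 * (c * t ^ (2 * L)) \<le> x\<^sup>2 * p \<omega>" using lower by (intro mult_left_mono) auto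
    ultimately have "x\<^sup>2 * (c * t ^ (2 * L)) \<le> K\<^sup>2 * (norm X)\<^sup>2" by linarith
    then show "t ^ (2 * L) * x\<^sup>2 \<le> K\<^sup>2 / c * (norm X)\<^sup>2" using c(1) by (simp add: field_simps)
  qed
qed

section \<open>The differential constraint on the Fourier side\<close>

lemma test_function_integrable:
  fixes \<psi> :: "real^'d::finite \<Rightarrow> real"
  assumes "\<psi> \<in> test_functions U"
  shows "\<psi> \<in> borel_measurable borel" "integrable lborel \<psi>"
proof -
  have sm: "smooth \<psi>" and comp: "compact (closure {x. \<psi> x \<noteq> 0})"
    using assms unfolding test_functions_def by simp_all
  show m: "\<psi> \<in> borel_measurable borel"
    by (intro borel_measurable_continuous_onI smooth_continuous sm)
  have "integrable lborel (\<lambda>x. indicator (closure {x. \<psi> x \<noteq> 0}) x *\<^sub>R \<psi> x)"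
    by (rule borel_integrable_compact[OF comp smooth_continuous[OF sm]])
  moreover have "(\<lambda>x. indicator (closure {x. \<psi> x \<noteq> 0}) x *\<^sub>R \<psi> x) = \<psi>"
  proof
    show "indicator (closure {x. \<psi> x \<noteq> 0}) x *\<^sub>R \<psi> x = \<psi> x" for x
      using zero_outside_support[of x \<psi>] by (cases "x \<in> closure {x. \<psi> x \<noteq> 0}") simp_all
  qed
  ultimately show "integrable lborel \<psi>" by simp
qed

lemma multi_deriv_test_function:
  fixes \<phi> :: "real^'d::finite \<Rightarrow> real"
  assumes "\<phi> \<in> test_functions U" "\<alpha> \<in> multi_indices m" "m \<ge> 1"
  shows "multi_deriv \<alpha> \<phi> \<in> test_functions U" "(\<integral>x. multi_deriv \<alpha> \<phi> x \<partial>lborel) = 0"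
proof -
  show "multi_deriv \<alpha> \<phi> \<in> test_functions U"
    unfolding multi_deriv_def by (rule test_functions_iterated_partial[OF assms(1)])
  define xs where "xs = (SOME is. \<forall>i. count_list is i = \<alpha> i)"
  have "\<forall>i. count_list xs i = \<alpha> i" unfolding xs_def by (rule multi_index_list)
  then have "length xs = m" using assms(2) by (simp add: length_count multi_indices_def)
  then obtain i ys where xs: "xs = i # ys" using assms(3) by (cases xs) auto
  have "multi_deriv \<alpha> \<phi> = partial_deriv i (iterated_partial ys \<phi>)"
    by (simp add: multi_deriv_def xs_def[symmetric] xs iterated_partial_Cons)
  also have "\<dots> = dir_deriv (axis i 1) (iterated_partial ys \<phi>)"
    by (auto simp: dir_deriv_def axis_def if_distrib if_distribR cong: if_cong)
  finally show "(\<integral>x. multi_deriv \<alpha> \<phi> x \<partial>lborel) = 0"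
    using integral_dir_deriv_zero[OF test_functions_iterated_partial[OF assms(1)]] by simp
qed

text \<open>The distributional constraint is tested with Fourier modes cut off away from the support of \<open>v\<close>.
  The constant \<open>F\<close> drops out because the operator has positive order.\<close>

lemma fourier_constraint:
  fixes a :: "('d::finite \<Rightarrow> nat) \<Rightarrow> real^'n::finite^'k::finite"
  assumes u: "u \<in> admissible m a \<Omega> F" and \<Omega>: "bounded \<Omega>" and m: "m \<ge> 1"
    and v: "v = (\<lambda>x. indicator (closure \<Omega>) x *\<^sub>R (u x - F))"
  shows "integrable lebesgue v"
    and "op_symbol m a \<xi> *v (\<integral>x. cos (\<xi> \<bullet> x + \<tau>) *\<^sub>R v x \<partial>lebesgue) = 0"
proof -
  define K where "K = closure \<Omega>"
  have K: "compact K" using \<Omega> by (simp add: K_def)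
  have Km: "K \<in> sets lebesgue" using K by (simp add: lmeasurable_compact fmeasurableD)
  have uL: "u \<in> L2_loc" and pde: "\<And>\<phi>. \<phi> \<in> test_functions UNIV \<Longrightarrow> distr_op m a u \<phi> = 0"
    and out: "AE x in lebesgue. x \<notin> K \<longrightarrow> u x = F"
    using u unfolding admissible_def K_def by auto
  have um [measurable]: "u \<in> borel_measurable lebesgue" using uL by (simp add: L2_loc_def)
  have u2: "integrable lebesgue (\<lambda>x. indicator K x * (norm (u x))\<^sup>2)"
    using uL K Km integrable_restrict_space[of K lebesgue "\<lambda>x. (norm (u x))\<^sup>2"] by (simp add: L2_loc_def)
  have Ki: "integrable lebesgue (indicator K :: _ \<Rightarrow> real)"
    using lmeasurable_compact[OF K] by (intro integrable_real_indicator) (auto simp: fmeasurable_def)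
  show vi: "integrable lebesgue v"
  proof (rule Bochner_Integration.integrable_bound)
    show "integrable lebesgue (\<lambda>x. (1 + norm F) * indicator K x + indicator K x * (norm (u x))\<^sup>2)"
      using Ki u2 by auto
    show "v \<in> borel_measurable lebesgue" unfolding v K_def[symmetric] using Km by measurable
    have "norm (v x) \<le> norm ((1 + norm F) * indicator K x + indicator K x * (norm (u x))\<^sup>2)" for x
    proof (cases "x \<in> K")
      case True
      have "norm (u x) \<le> 1 + (norm (u x))\<^sup>2"
        using product_le_squares[of "norm (u x)" 1] by simp
      moreover have "norm (u x - F) \<le> norm (u x) + norm F" by (rule norm_triangle_ineq4)
      ultimately show ?thesis using True by (simp add: v K_def[symmetric] add_nonneg_nonneg)
    qed (simp add: v K_def[symmetric])
    then show "AE x in lebesgue. norm (v x) \<le> norm ((1 + norm F) * indicator K x + indicator K x * (norm (u x))\<^sup>2)"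
      by simp
  qed
  have uv: "AE x in lebesgue. u x = v x + F"
    using out by eventually_elim (auto simp: v K_def[symmetric] indicator_def)
  obtain \<rho> where \<rho>: "\<rho> > 0" "K \<subseteq> ball 0 \<rho>"
    using compact_imp_bounded[OF K] bounded_subset_ballD[of K 0] by auto
  obtain \<eta> :: "real^'d \<Rightarrow> real" where \<eta>: "elementary \<eta>" "\<eta> \<in> test_functions UNIV" "\<And>x. x \<in> cball 0 \<rho> \<Longrightarrow> \<eta> x = 1"
    using smooth_urysohn[OF compact_cball open_UNIV subset_UNIV, of "0::real^'d" \<rho>] by metis
  \<comment> \<open>Each differentiation of a cosine advances its phase by a quarter turn.\<close>
  define \<sigma> where "\<sigma> = \<tau> - real m * (pi / 2)"
  define \<phi> where "\<phi> x = \<eta> x * cos (\<xi> \<bullet> x + \<sigma>)" for x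
  have "elementary (\<lambda>x. cos (x \<bullet> \<xi> + \<sigma>))"
    by (intro elementary.cos elementary.add elementary.linear elementary.const)
  then have el: "elementary \<phi>"
    unfolding \<phi>_def using \<eta>(1) by (intro elementary.mult) (simp_all add: inner_commute)
  have \<phi>: "\<phi> \<in> test_functions UNIV"
  proof -
    have \<eta>c: "compact (closure {x. \<eta> x \<noteq> 0})" using \<eta>(2) unfolding test_functions_def by simp
    have "{x. \<phi> x \<noteq> 0} \<subseteq> {x. \<eta> x \<noteq> 0}" by (auto simp: \<phi>_def)
    then have "closure {x. \<phi> x \<noteq> 0} \<subseteq> closure {x. \<eta> x \<noteq> 0}" by (rule closure_mono)
    from compact_closed_subset[OF \<eta>c closed_closure this]
    show ?thesis unfolding test_functions_def using elementary_smooth[OF el] by simp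
  qed
  have \<phi>_deriv: "multi_deriv \<alpha> \<phi> x = (\<Prod>i\<in>UNIV. (\<xi> $ i) ^ \<alpha> i) * cos (\<xi> \<bullet> x + \<tau>)"
    if "\<alpha> \<in> multi_indices m" "x \<in> K" for \<alpha> x
  proof -
    have "multi_deriv \<alpha> \<phi> x = multi_deriv \<alpha> (\<lambda>x. cos (\<xi> \<bullet> x + \<sigma>)) x"
      unfolding multi_deriv_def
      by (rule iterated_partial_cong_open[of "ball 0 \<rho>"]) (use \<eta>(3) \<rho> that in \<open>auto simp: \<phi>_def\<close>)
    then show ?thesis using multi_deriv_cos[OF that(1), of \<xi> \<sigma> x] by (simp add: \<sigma>_def)
  qed
  define I where "I = (\<integral>x. cos (\<xi> \<bullet> x + \<tau>) *\<^sub>R v x \<partial>lebesgue)"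
  have cosm: "(\<lambda>x. cos (\<xi> \<bullet> x + \<tau>)) \<in> borel_measurable lebesgue"
    by (rule measurable_completion) simp
  have ci: "integrable lebesgue (\<lambda>x. cos (\<xi> \<bullet> x + \<tau>) *\<^sub>R v x)"
    by (rule Bochner_Integration.integrable_bound[OF vi])
       (use cosm vi in \<open>auto intro!: borel_measurable_scaleR simp: mult_left_le_one_le\<close>)
  have summand: "(\<integral>x. multi_deriv \<alpha> \<phi> x *\<^sub>R (a \<alpha> *v u x) \<partial>lebesgue) = (\<Prod>i\<in>UNIV. (\<xi> $ i) ^ \<alpha> i) *\<^sub>R (a \<alpha> *v I)"
    if \<alpha>: "\<alpha> \<in> multi_indices m" for \<alpha>
  proof -
    note D = multi_deriv_test_function[OF \<phi> \<alpha> m]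
    let ?c = "(\<Prod>i\<in>UNIV. (\<xi> $ i) ^ \<alpha> i)"
    have bl: "bounded_linear ((*v) (a \<alpha>))" by (rule matrix_vector_mul_bounded_linear)
    have Di: "integrable lebesgue (\<lambda>x. multi_deriv \<alpha> \<phi> x *\<^sub>R (a \<alpha> *v F))"
      using test_function_integrable[OF D(1)] by (intro integrable_scaleR_left) (simp add: integrable_completion)
    have Dz: "(\<integral>x. multi_deriv \<alpha> \<phi> x *\<^sub>R (a \<alpha> *v F) \<partial>lebesgue) = 0"
      using test_function_integrable[OF D(1)] D(2) by (simp add: integral_completion)
    have ai: "integrable lebesgue (\<lambda>x. a \<alpha> *v (cos (\<xi> \<bullet> x + \<tau>) *\<^sub>R v x))"
      by (rule integrable_bounded_linear[OF bl ci])
    have aI: "(\<integral>x. a \<alpha> *v (cos (\<xi> \<bullet> x + \<tau>) *\<^sub>R v x) \<partial>lebesgue) = a \<alpha> *v I"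
      unfolding I_def by (rule integral_bounded_linear[OF bl ci])
    have eq: "multi_deriv \<alpha> \<phi> x *\<^sub>R (a \<alpha> *v v x) = ?c *\<^sub>R (a \<alpha> *v (cos (\<xi> \<bullet> x + \<tau>) *\<^sub>R v x))" for x
      using \<phi>_deriv[OF \<alpha>, of x] by (cases "x \<in> K") (auto simp: v K_def[symmetric] matrix_vector_mult_scaleR)
    have "(\<integral>x. multi_deriv \<alpha> \<phi> x *\<^sub>R (a \<alpha> *v u x) \<partial>lebesgue)
        = (\<integral>x. ?c *\<^sub>R (a \<alpha> *v (cos (\<xi> \<bullet> x + \<tau>) *\<^sub>R v x)) + multi_deriv \<alpha> \<phi> x *\<^sub>R (a \<alpha> *v F) \<partial>lebesgue)"
    proof (rule integral_cong_AE)
      have dm: "multi_deriv \<alpha> \<phi> \<in> borel_measurable lebesgue"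
        by (rule measurable_completion) (use test_function_integrable(1)[OF D(1)] in simp)
      have "(\<lambda>x. a \<alpha> *v u x) \<in> borel_measurable lebesgue"
        by (rule measurable_compose[OF um]) (intro borel_measurable_continuous_onI linear_continuous_on bl)
      then show "(\<lambda>x. multi_deriv \<alpha> \<phi> x *\<^sub>R (a \<alpha> *v u x)) \<in> borel_measurable lebesgue"
        using dm by (rule borel_measurable_scaleR[rotated])
      show "(\<lambda>x. ?c *\<^sub>R (a \<alpha> *v (cos (\<xi> \<bullet> x + \<tau>) *\<^sub>R v x)) + multi_deriv \<alpha> \<phi> x *\<^sub>R (a \<alpha> *v F)) \<in> borel_measurable lebesgue"
        using ai Di by (intro borel_measurable_integrable Bochner_Integration.integrable_add integrable_scaleR_right)
      show "AE x in lebesgue. multi_deriv \<alpha> \<phi> x *\<^sub>R (a \<alpha> *v u x)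
          = ?c *\<^sub>R (a \<alpha> *v (cos (\<xi> \<bullet> x + \<tau>) *\<^sub>R v x)) + multi_deriv \<alpha> \<phi> x *\<^sub>R (a \<alpha> *v F)"
        using uv
      proof eventually_elim
        case (elim x)
        then show ?case by (simp add: eq[symmetric] matrix_vector_right_distrib scaleR_add_right)
      qed
    qed
    also have "\<dots> = ?c *\<^sub>R (a \<alpha> *v I)"
      using ai Di by (simp add: Dz aI)
    finally show ?thesis .
  qed
  have "(\<Sum>\<alpha>\<in>multi_indices m. integral\<^sup>L lebesgue (\<lambda>x. multi_deriv \<alpha> \<phi> x *\<^sub>R (a \<alpha> *v u x))) = 0"
    using pde[OF \<phi>] by (simp add: distr_op_def)
  then have "(\<Sum>\<alpha>\<in>multi_indices m. (\<Prod>i\<in>UNIV. (\<xi> $ i) ^ \<alpha> i) *\<^sub>R (a \<alpha> *v I)) = 0"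
    using summand by simp
  moreover have "op_symbol m a \<xi> *v I = (\<Sum>\<alpha>\<in>multi_indices m. (\<Prod>i\<in>UNIV. (\<xi> $ i) ^ \<alpha> i) *\<^sub>R (a \<alpha> *v I))"
  proof -
    have "linear (\<lambda>M :: real^'n^'k. M *v I)"
      by (rule linearI) (simp_all add: matrix_vector_mult_add_rdistrib scaleR_matrix_vector_assoc)
    from linear_sum[OF this] show ?thesis
      by (simp add: op_symbol_def scaleR_matrix_vector_assoc)
  qed
  ultimately show "op_symbol m a \<xi> *v (\<integral>x. cos (\<xi> \<bullet> x + \<tau>) *\<^sub>R v x \<partial>lebesgue) = 0"
    by (simp add: I_def)
qed

section \<open>The variation of a two-valued map\<close>

text \<open>The field \<open>\<psi> (b \<otimes> \<nu>)\<close> with the unit vector \<open>b\<close> in the direction \<open>A - B\<close> is tested; the constant part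
  \<open>B\<close> of \<open>f\<close> does not contribute.\<close>

lemma total_variation_dual:
  fixes f :: "real^'d::finite \<Rightarrow> real^'n::finite" and A B :: "real^'n"
  assumes \<Omega>: "open \<Omega>" and E: "E \<in> sets borel" "E \<subseteq> \<Omega>" and AB: "A \<noteq> B"
    and f: "AE x in lebesgue. x \<in> \<Omega> \<longrightarrow> f x = (if x \<in> E then A else B)"
    and fm: "f \<in> borel_measurable (lebesgue_on \<Omega>)"
    and tv: "total_variation \<Omega> f = ennreal T" "T \<ge> 0"
    and \<psi>: "\<psi> \<in> test_functions \<Omega>" "\<And>x. \<bar>\<psi> x\<bar> \<le> 1" and \<nu>: "norm \<nu> = 1"
  shows "(\<integral>x. indicator E x * dir_deriv \<nu> \<psi> x \<partial>lborel) \<le> T / norm (A - B)"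
proof -
  define b where "b = (A - B) /\<^sub>R norm (A - B)"
  have b: "norm b = 1" "(A - B) \<bullet> b = norm (A - B)"
    using AB by (auto simp: b_def dot_square_norm power2_eq_square)
  define M :: "real^'d^'n" where "M = (\<chi> j. b $ j *\<^sub>R \<nu>)"
  have M: "norm M = 1"
  proof -
    have "norm (M $ j) = norm (b $ j)" for j by (simp add: M_def \<nu>)
    then have "norm M = norm b" by (simp only: norm_vec_def[of M] norm_vec_def[of b])
    then show ?thesis using b(1) by simp
  qed
  define \<phi> where "\<phi> x = \<psi> x *\<^sub>R M" for x
  have sm: "smooth \<psi>" and comp: "compact (closure {x. \<psi> x \<noteq> 0})" and sub: "closure {x. \<psi> x \<noteq> 0} \<subseteq> \<Omega>"
    using \<psi>(1) unfolding test_functions_def by simp_all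
  have "{x. \<phi> x \<noteq> 0} = {x. \<psi> x \<noteq> 0}" using M by (auto simp: \<phi>_def)
  then have \<phi>t: "\<phi> \<in> test_functions \<Omega>"
    unfolding test_functions_def using comp sub smooth_scaleR_const(1)[OF sm, of M] by (simp add: \<phi>_def[abs_def])
  have \<phi>n: "\<forall>x. norm (\<phi> x) \<le> 1" using \<psi>(2) M by (simp add: \<phi>_def)
  let ?I = "integral\<^sup>L (lebesgue_on \<Omega>) (\<lambda>x. \<Sum>j\<in>UNIV. \<Sum>i\<in>UNIV. f x $ j * partial_deriv i \<phi> x $ j $ i)"
  have "ennreal ?I \<le> ennreal T"
    unfolding tv(1)[symmetric] total_variation_def by (rule SUP_upper) (use \<phi>t \<phi>n in auto)
  then have I_le: "?I \<le> T" using ennreal_le_iff[OF tv(2)] by blast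
  have integrand: "(\<Sum>j\<in>UNIV. \<Sum>i\<in>UNIV. f x $ j * partial_deriv i \<phi> x $ j $ i) = (f x \<bullet> b) * dir_deriv \<nu> \<psi> x" for x
  proof -
    have "partial_deriv i \<phi> x $ j $ i = partial_deriv i \<psi> x * (b $ j * \<nu> $ i)" for i j
      unfolding \<phi>_def smooth_scaleR_const(2)[OF sm] by (simp add: M_def)
    then show ?thesis
      by (simp add: inner_vec_def dir_deriv_def sum_product mult_ac) (rule sum.swap)
  qed
  have dd0: "dir_deriv \<nu> \<psi> x = 0" if "x \<notin> \<Omega>" for x
  proof -
    have "x \<notin> closure {x. \<psi> x \<noteq> 0}" using that sub by blast
    then show ?thesis unfolding dir_deriv_def by (simp add: partial_deriv_outside_support[of x \<psi>])
  qed
  have di: "integrable lborel (dir_deriv \<nu> \<psi>)"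
  proof -
    have "integrable lborel (partial_deriv i \<psi>)" for i
      using test_function_integrable(2)[OF test_functions_iterated_partial[OF \<psi>(1), of "[i]"]]
      by (simp add: iterated_partial_Cons)
    then show ?thesis unfolding dir_deriv_def[abs_def] by auto
  qed
  have [measurable]: "E \<in> sets borel" "\<Omega> \<in> sets borel" using E \<Omega> by auto
  have dm [measurable]: "dir_deriv \<nu> \<psi> \<in> borel_measurable borel" using di borel_measurable_integrable by fastforce
  have ei: "integrable lborel (\<lambda>x. indicator E x * dir_deriv \<nu> \<psi> x)"
    by (rule Bochner_Integration.integrable_bound[OF di]) (auto simp: indicator_def)
  have \<Omega>m: "\<Omega> \<inter> space lebesgue \<in> sets lebesgue" using \<Omega> by (auto intro: sets_completionI_sets)
  have "?I = (\<integral>x. indicator \<Omega> x *\<^sub>R ((f x \<bullet> b) * dir_deriv \<nu> \<psi> x) \<partial>lebesgue)"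
    unfolding integrand by (rule integral_restrict_space[OF \<Omega>m])
  also have "\<dots> = (\<integral>x. (B \<bullet> b) * dir_deriv \<nu> \<psi> x + norm (A - B) * (indicator E x * dir_deriv \<nu> \<psi> x) \<partial>lebesgue)"
  proof (rule integral_cong_AE)
    have dml: "dir_deriv \<nu> \<psi> \<in> borel_measurable lebesgue" by (rule measurable_completion) (simp add: dm)
    have "(\<lambda>x. f x \<bullet> b) \<in> borel_measurable (lebesgue_on \<Omega>)" using fm by measurable
    then have "(\<lambda>x. indicator \<Omega> x *\<^sub>R (f x \<bullet> b)) \<in> borel_measurable lebesgue"
      using borel_measurable_restrict_space_iff[OF \<Omega>m, of "\<lambda>x. f x \<bullet> b"] by simp
    then have "(\<lambda>x. (indicator \<Omega> x *\<^sub>R (f x \<bullet> b)) * dir_deriv \<nu> \<psi> x) \<in> borel_measurable lebesgue"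
      using dml by (rule borel_measurable_times)
    then show "(\<lambda>x. indicator \<Omega> x *\<^sub>R ((f x \<bullet> b) * dir_deriv \<nu> \<psi> x)) \<in> borel_measurable lebesgue"
      by (simp add: mult.assoc)
    show "(\<lambda>x. (B \<bullet> b) * dir_deriv \<nu> \<psi> x + norm (A - B) * (indicator E x * dir_deriv \<nu> \<psi> x)) \<in> borel_measurable lebesgue"
      by (rule measurable_completion) simp
    show "AE x in lebesgue. indicator \<Omega> x *\<^sub>R ((f x \<bullet> b) * dir_deriv \<nu> \<psi> x)
       = (B \<bullet> b) * dir_deriv \<nu> \<psi> x + norm (A - B) * (indicator E x * dir_deriv \<nu> \<psi> x)"
      using f
    proof eventually_elim
      case (elim x)
      have "A \<bullet> b = B \<bullet> b + norm (A - B)" using b(2) by (simp add: inner_diff_left)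
      then show ?case using elim dd0[of x] by (auto simp: indicator_def algebra_simps)
    qed
  qed
  also have "\<dots> = (\<integral>x. (B \<bullet> b) * dir_deriv \<nu> \<psi> x + norm (A - B) * (indicator E x * dir_deriv \<nu> \<psi> x) \<partial>lborel)"
    by (rule integral_completion) simp
  also have "\<dots> = norm (A - B) * (\<integral>x. indicator E x * dir_deriv \<nu> \<psi> x \<partial>lborel)"
    using di ei integral_dir_deriv_zero[OF \<psi>(1), of \<nu>] by simp
  finally show ?thesis using I_le AB by (simp add: field_simps)
qed

section \<open>The lower scaling bound\<close>

text \<open>The set where \<open>f = A\<close> is only Lebesgue measurable; it is replaced by a Borel set, because
  translation and Fubini arguments are carried out for Borel functions.\<close>

lemma phase_set:
  fixes f :: "real^'d::finite \<Rightarrow> real^'n::finite" and A B :: "real^'n"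
  assumes \<Omega>: "open \<Omega>" and fm: "f \<in> borel_measurable (lebesgue_on \<Omega>)"
    and f: "AE x in lebesgue_on \<Omega>. f x \<in> {A, B}"
  obtains E where "E \<in> sets borel" "E \<subseteq> \<Omega>" "AE x in lebesgue. x \<in> \<Omega> \<longrightarrow> f x = (if x \<in> E then A else B)"
proof -
  have \<Omega>m: "\<Omega> \<inter> space lebesgue \<in> sets lebesgue" using \<Omega> by (auto intro: sets_completionI_sets)
  define S where "S = {x \<in> \<Omega>. f x = A}"
  have "{x \<in> space (lebesgue_on \<Omega>). f x = A} \<in> sets (lebesgue_on \<Omega>)"
    using fm by measurable
  then have "S \<in> sets (lebesgue_on \<Omega>)" by (simp add: S_def)
  then have S: "S \<in> sets lebesgue" using sets_restrict_space_iff[OF \<Omega>m] by blast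
  then obtain g where g: "g \<in> borel_measurable lborel" "AE x in lborel. indicator S x = (g x :: real)"
    using completion_ex_borel_measurable_real[of "indicator S" lborel] by auto
  define E where "E = {x. g x = 1} \<inter> \<Omega>"
  have gm [measurable]: "g \<in> borel_measurable borel" using g(1) by simp
  have "{x. g x = 1} \<in> sets borel" by measurable
  then have E: "E \<in> sets borel" using \<Omega> by (auto simp: E_def)
  have "AE x in lebesgue. x \<in> \<Omega> \<longrightarrow> f x \<in> {A, B}"
    using f unfolding AE_restrict_space_iff[OF \<Omega>m] .
  moreover have "AE x in lebesgue. indicator S x = g x" by (rule AE_completion[OF g(2)])
  ultimately have "AE x in lebesgue. x \<in> \<Omega> \<longrightarrow> f x = (if x \<in> E then A else B)"
    by eventually_elim (auto simp: E_def S_def indicator_def split: if_splits)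
  then show ?thesis using that E by (auto simp: E_def)
qed

lemma norm_vec_square: "(norm (x :: real^'n::finite))\<^sup>2 = (\<Sum>i\<in>UNIV. (x $ i)\<^sup>2)"
  unfolding power2_norm_eq_inner inner_vec_def by (simp add: power2_eq_square)

text \<open>The functions \<open>w i\<close> are Borel representatives of the components of \<open>f - u\<close>, extended by zero.\<close>

lemma elastic_residual:
  fixes a :: "('d::finite \<Rightarrow> nat) \<Rightarrow> real^'n::finite^'k::finite" and A B :: "real^'n"
  assumes \<Omega>: "open \<Omega>" "bounded \<Omega>" "negligible (frontier \<Omega>)" and m: "m \<ge> 1"
    and E: "E \<in> sets borel" "E \<subseteq> \<Omega>" "AE x in lebesgue. x \<in> \<Omega> \<longrightarrow> f x = (if x \<in> E then A else B)"
    and u: "u \<in> admissible m a \<Omega> (lam *\<^sub>R A + (1 - lam) *\<^sub>R B)"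
    and fin: "(\<integral>\<^sup>+x. ennreal ((norm (u x - f x))\<^sup>2) \<partial>lebesgue_on \<Omega>) < \<infinity>"
  obtains w :: "'n \<Rightarrow> real^'d \<Rightarrow> real" where
    "\<And>i. integrable lborel (w i)" "\<And>i. integrable lborel (\<lambda>x. (w i x)\<^sup>2)"
    "(\<integral>\<^sup>+x. ennreal ((norm (u x - f x))\<^sup>2) \<partial>lebesgue_on \<Omega>) = ennreal (\<Sum>i\<in>UNIV. \<integral>x. (w i x)\<^sup>2 \<partial>lborel)"
    "\<And>\<xi>. op_symbol m a \<xi> *v (\<chi> i. cos_transform (w i) \<xi>)
        = cos_transform (two_phase lam \<Omega> E) \<xi> *\<^sub>R (op_symbol m a \<xi> *v (A - B))"
    "\<And>\<xi>. op_symbol m a \<xi> *v (\<chi> i. sin_transform (w i) \<xi>)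
        = sin_transform (two_phase lam \<Omega> E) \<xi> *\<^sub>R (op_symbol m a \<xi> *v (A - B))"
proof -
  define F where "F = lam *\<^sub>R A + (1 - lam) *\<^sub>R B"
  define v where "v = (\<lambda>x. indicator (closure \<Omega>) x *\<^sub>R (u x - F))"
  define \<theta> where "\<theta> = two_phase lam \<Omega> E"
  define W where "W x = \<theta> x *\<^sub>R (A - B) - v x" for x
  note pde = fourier_constraint[OF u[folded F_def] \<Omega>(2) m v_def]
  note \<theta>i = two_phase_integrable[OF \<Omega>(1,2) E(1,2), of lam, folded \<theta>_def]
  have \<theta>m [measurable]: "\<theta> \<in> borel_measurable borel" using \<theta>i(1) borel_measurable_integrable by fastforce
  have \<theta>l: "integrable lebesgue \<theta>" using \<theta>i(1) by (simp add: integrable_completion)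
  have Wi: "integrable lebesgue W"
    unfolding W_def using pde(1) \<theta>l by (intro Bochner_Integration.integrable_diff integrable_scaleR_left)
  have Wm: "W \<in> borel_measurable lebesgue" using Wi by (rule borel_measurable_integrable)
  have comp_i: "integrable lebesgue (\<lambda>x. W x $ i)" for i
    using integrable_bounded_linear[OF bounded_linear_vec_nth Wi] .
  have "\<exists>g. g \<in> borel_measurable borel \<and> (AE x in lborel. W x $ i = g x)" for i
    using completion_ex_borel_measurable_real[OF borel_measurable_integrable[OF comp_i[of i]]] by auto
  then obtain w where wm [measurable]: "\<And>i. w i \<in> borel_measurable borel"
    and w: "\<And>i. AE x in lborel. W x $ i = w i x" by metis
  have wl: "AE x in lebesgue. W x $ i = w i x" for i by (rule AE_completion[OF w])
  have w_int: "integrable lborel (w i)" for i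
  proof -
    have "integrable lebesgue (w i)"
      using integrable_cong_AE_imp[OF comp_i[of i], of "w i"] wl[of i] measurable_completion[of "w i" lborel borel] wm[of i]
      by (auto elim!: eventually_mono)
    then show ?thesis by (simp add: integrable_completion)
  qed
  \<comment> \<open>Up to a null set the residual is the misfit inside the domain and zero outside.\<close>
  have W_eq: "AE x in lebesgue. W x = indicator \<Omega> x *\<^sub>R (f x - u x)"
  proof -
    have "frontier \<Omega> \<in> null_sets lebesgue" using \<Omega>(3) negligible_iff_null_sets by blast
    then have "AE x in lebesgue. x \<notin> frontier \<Omega>" by (rule AE_not_in)
    then show ?thesis using E(3)
    proof eventually_elim
      case (elim x)
      show ?case
      proof (cases "x \<in> \<Omega>")
        case True
        then have "x \<in> closure \<Omega>" using closure_subset by blast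
        then show ?thesis using elim True
          by (cases "x \<in> E") (auto simp: W_def v_def \<theta>_def two_phase_def F_def algebra_simps)
      next
        case False
        then have "x \<notin> closure \<Omega>" using elim \<Omega>(1) by (simp add: frontier_def interior_open)
        moreover have "x \<notin> E" using False E(2) by blast
        ultimately show ?thesis using False by (simp add: W_def v_def \<theta>_def two_phase_def)
      qed
    qed
  qed
  have \<Omega>m: "\<Omega> \<inter> space lebesgue \<in> sets lebesgue" using \<Omega> by (auto intro: sets_completionI_sets)
  let ?e = "\<integral>\<^sup>+x. ennreal ((norm (u x - f x))\<^sup>2) \<partial>lebesgue_on \<Omega>"
  have "?e = (\<integral>\<^sup>+x. ennreal ((norm (u x - f x))\<^sup>2) * indicator \<Omega> x \<partial>lebesgue)"
    by (rule nn_integral_restrict_space[OF \<Omega>m])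
  also have "\<dots> = (\<integral>\<^sup>+x. ennreal (\<Sum>i\<in>UNIV. (w i x)\<^sup>2) \<partial>lebesgue)"
  proof (rule nn_integral_cong_AE)
    have "AE x in lebesgue. \<forall>i. W x $ i = w i x" by (rule AE_all_countable[THEN iffD2]) (use wl in blast)
    then show "AE x in lebesgue. ennreal ((norm (u x - f x))\<^sup>2) * indicator \<Omega> x = ennreal (\<Sum>i\<in>UNIV. (w i x)\<^sup>2)"
      using W_eq
    proof eventually_elim
      case (elim x)
      have "(\<Sum>i\<in>UNIV. (w i x)\<^sup>2) = (norm (W x))\<^sup>2"
        using elim(1) by (simp add: norm_vec_square)
      then show ?case by (simp add: elim(2) indicator_def norm_minus_commute)
    qed
  qed
  also have "\<dots> = (\<integral>\<^sup>+x. ennreal (\<Sum>i\<in>UNIV. (w i x)\<^sup>2) \<partial>lborel)" by (rule nn_integral_completion)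
  finally have e: "?e = (\<integral>\<^sup>+x. ennreal (\<Sum>i\<in>UNIV. (w i x)\<^sup>2) \<partial>lborel)" .
  have w2: "integrable lborel (\<lambda>x. (w i x)\<^sup>2)" for i
  proof (rule integrableI_bounded)
    have "(w i x)\<^sup>2 \<le> (\<Sum>i\<in>UNIV. (w i x)\<^sup>2)" for x
      by (rule member_le_sum[of i UNIV "\<lambda>i. (w i x)\<^sup>2"]) auto
    then have "(\<integral>\<^sup>+x. ennreal (norm ((w i x)\<^sup>2)) \<partial>lborel) \<le> ?e"
      unfolding e by (intro nn_integral_mono ennreal_leI) simp
    then show "(\<integral>\<^sup>+x. ennreal (norm ((w i x)\<^sup>2)) \<partial>lborel) < \<infinity>" using fin by (rule le_less_trans)
  qed simp
  have "?e = ennreal (\<integral>x. (\<Sum>i\<in>UNIV. (w i x)\<^sup>2) \<partial>lborel)"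
    unfolding e by (rule nn_integral_eq_integral) (use w2 in \<open>simp_all add: sum_nonneg\<close>)
  then have e_sum: "?e = ennreal (\<Sum>i\<in>UNIV. \<integral>x. (w i x)\<^sup>2 \<partial>lborel)" using w2 by simp
  have mode: "op_symbol m a \<xi> *v (\<chi> i. \<integral>x. cos (\<xi> \<bullet> x + \<tau>) * w i x \<partial>lborel)
      = (\<integral>x. cos (\<xi> \<bullet> x + \<tau>) * \<theta> x \<partial>lborel) *\<^sub>R (op_symbol m a \<xi> *v (A - B))" for \<xi> \<tau>
  proof -
    let ?c = "\<lambda>x. cos (\<xi> \<bullet> x + \<tau>)"
    have cm: "?c \<in> borel_measurable lebesgue" by (rule measurable_completion) simp
    have ci: "integrable lebesgue (\<lambda>x. ?c x *\<^sub>R h x)" if "integrable lebesgue h" for h :: "real^'d \<Rightarrow> 'z::{banach, second_countable_topology}"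
      by (rule Bochner_Integration.integrable_bound[OF that])
         (use cm that in \<open>auto intro!: borel_measurable_scaleR simp: mult_left_le_one_le\<close>)
    have "(\<integral>x. ?c x * w i x \<partial>lborel) = (\<integral>x. ?c x *\<^sub>R W x \<partial>lebesgue) $ i" for i
    proof -
      have "(\<integral>x. ?c x * w i x \<partial>lborel) = (\<integral>x. ?c x * w i x \<partial>lebesgue)"
        by (rule integral_completion[symmetric]) simp
      also have "\<dots> = (\<integral>x. (?c x *\<^sub>R W x) $ i \<partial>lebesgue)"
      proof (rule integral_cong_AE)
        show "(\<lambda>x. ?c x * w i x) \<in> borel_measurable lebesgue" by (rule measurable_completion) simp
        show "(\<lambda>x. (?c x *\<^sub>R W x) $ i) \<in> borel_measurable lebesgue"
          using integrable_bounded_linear[OF bounded_linear_vec_nth ci[OF Wi]] by (rule borel_measurable_integrable)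
        show "AE x in lebesgue. ?c x * w i x = (?c x *\<^sub>R W x) $ i"
          using wl[of i] by eventually_elim simp
      qed
      also have "\<dots> = (\<integral>x. ?c x *\<^sub>R W x \<partial>lebesgue) $ i"
        by (rule integral_bounded_linear[OF bounded_linear_vec_nth ci[OF Wi]])
      finally show ?thesis .
    qed
    then have "(\<chi> i. \<integral>x. ?c x * w i x \<partial>lborel) = (\<integral>x. ?c x *\<^sub>R W x \<partial>lebesgue)" by (simp add: vec_eq_iff)
    also have "\<dots> = (\<integral>x. (?c x *\<^sub>R \<theta> x) *\<^sub>R (A - B) - ?c x *\<^sub>R v x \<partial>lebesgue)"
      by (simp add: W_def scaleR_diff_right)
    also have "\<dots> = (\<integral>x. ?c x *\<^sub>R \<theta> x \<partial>lebesgue) *\<^sub>R (A - B) - (\<integral>x. ?c x *\<^sub>R v x \<partial>lebesgue)"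
      using ci[OF \<theta>l] ci[OF pde(1)]
      by (subst Bochner_Integration.integral_diff) (auto simp del: real_scaleR_def)
    also have "(\<integral>x. ?c x *\<^sub>R \<theta> x \<partial>lebesgue) = (\<integral>x. ?c x * \<theta> x \<partial>lborel)"
      by (simp, rule integral_completion) simp
    finally show ?thesis
      using pde(2)[of \<xi> \<tau>] by (simp add: matrix_vector_mult_diff_distrib matrix_vector_mult_scaleR)
  qed
  show ?thesis
  proof (rule that[of w])
    show "op_symbol m a \<xi> *v (\<chi> i. cos_transform (w i) \<xi>)
        = cos_transform (two_phase lam \<Omega> E) \<xi> *\<^sub>R (op_symbol m a \<xi> *v (A - B))" for \<xi>
      using mode[of \<xi> 0] by (simp add: cos_transform_def \<theta>_def)
    \<comment> \<open>The sine modes are cosine modes shifted by a quarter turn.\<close>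
    have "cos (y + - (pi / 2)) = sin y" for y :: real by (simp add: cos_diff)
    then show "op_symbol m a \<xi> *v (\<chi> i. sin_transform (w i) \<xi>)
        = sin_transform (two_phase lam \<Omega> E) \<xi> *\<^sub>R (op_symbol m a \<xi> *v (A - B))" for \<xi>
      using mode[of \<xi> "- (pi / 2)"] by (simp only: sin_transform_def \<theta>_def)
  qed (use w_int w2 e_sum in auto)
qed

lemma op_symbol_order_0: "op_symbol 0 a \<xi> = op_symbol 0 a \<zeta>"
proof -
  have "op_symbol 0 a \<xi> = op_symbol 0 a 0" for \<xi>
    using op_symbol_scale[of 0 a 0 \<xi>] by simp
  then show ?thesis by metis
qed

lemma open_measure_pos:
  fixes \<Omega> :: "'a::euclidean_space set"
  assumes "open \<Omega>" "bounded \<Omega>" "\<Omega> \<noteq> {}"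
  shows "measure lborel \<Omega> > 0"
proof -
  obtain x e where x: "x \<in> \<Omega>" "e > 0" "ball x e \<subseteq> \<Omega>" using assms openE by blast
  have "0 < measure lborel (ball x e)" using content_ball_pos[OF x(2)] by simp
  also have "\<dots> \<le> measure lborel \<Omega>"
    using x(3) assms by (intro measure_mono_fmeasurable bounded_fmeasurable) auto
  finally show ?thesis .
qed

lemma ennreal_le_INF_add:
  assumes "\<And>u. u \<in> S \<Longrightarrow> ennreal (X - y) \<le> g u" and "y \<ge> 0"
  shows "ennreal X \<le> (INF u\<in>S. g u) + ennreal y"
proof -
  have "ennreal X \<le> ennreal (X - y) + ennreal y"
    using assms(2) by (cases "y \<le> X") (auto simp: ennreal_plus[symmetric] ennreal_neg intro: ennreal_leI simp del: ennreal_plus)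
  also have "\<dots> \<le> (INF u\<in>S. g u) + ennreal y"
    by (intro add_right_mono INF_greatest assms(1))
  finally show ?thesis .
qed

theorem theorem3:
  fixes a :: "('d::finite \<Rightarrow> nat) \<Rightarrow> real^'n::finite^'k::finite"
    and A B :: "real^'n"
    and \<Omega> V :: "(real^'d) set"
    and p :: "real^'d \<Rightarrow> real"
    and m L :: nat
  assumes "CARD('d) \<ge> 2"
    and "open \<Omega>" and "bounded \<Omega>" and "\<Omega> \<noteq> {}" and "lipschitz_boundary \<Omega>"
    and "A - B \<in> wave_cone m a - supercompatible m a"
    and "p = (\<lambda>\<xi>. (norm (op_symbol m a \<xi> *v (A - B)))\<^sup>2)"
    and "max_vanishing_order p = enat L" and "L \<le> m"
    and "V = {\<xi>. p \<xi> = 0}"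
    and "\<exists>W. finite W \<and> (\<forall>S\<in>W. subspace S) \<and> V = \<Union>W"
  shows "\<exists>C::real. C > 0 \<and> (\<forall>lam::real. 0 < lam \<and> lam < 1 \<longrightarrow>
    (\<exists>e0::real. e0 > 0 \<and> (\<forall>\<epsilon>. 0 < \<epsilon> \<and> \<epsilon> < e0 \<longrightarrow>
      (INF f\<in>BV \<Omega> {A, B}. energy m a \<Omega> \<epsilon> f (lam *\<^sub>R A + (1 - lam) *\<^sub>R B))
        \<ge> ennreal (C * (min (1 - lam) lam)\<^sup>2 * \<epsilon> powr (2 * real L / (2 * real L + 1))))))"
proof -
  note \<Omega> = \<open>open \<Omega>\<close> \<open>bounded \<Omega>\<close>
  note p = \<open>p = (\<lambda>\<xi>. (norm (op_symbol m a \<xi> *v (A - B)))\<^sup>2)\<close>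
  note V = \<open>V = {\<xi>. p \<xi> = 0}\<close>
  have front: "negligible (frontier \<Omega>)"
    by (rule lipschitz_frontier_negligible) fact+
  obtain \<xi>0 where \<xi>0: "norm \<xi>0 = 1" "op_symbol m a \<xi>0 *v (A - B) = 0"
    using \<open>A - B \<in> wave_cone m a - supercompatible m a\<close> by (auto simp: wave_cone_def)
  obtain \<xi>1 where \<xi>1: "norm \<xi>1 = 1" "op_symbol m a \<xi>1 *v (A - B) \<noteq> 0"
    using \<open>A - B \<in> wave_cone m a - supercompatible m a\<close> by (auto simp: supercompatible_def)
  \<comment> \<open>A symbol of order zero is constant, and the wave cone would consist of supercompatible states.\<close>
  have m: "m \<ge> 1"
  proof (rule ccontr)
    assume "\<not> m \<ge> 1"
    then have "m = 0" by simp
    then show False using \<xi>0(2) \<xi>1(2) op_symbol_order_0[of a \<xi>0 \<xi>1] by metis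
  qed
  have AB: "A \<noteq> B" using \<xi>1(2) by auto
  define \<beta> where "\<beta> = norm (A - B)"
  have \<beta>: "\<beta> > 0" using AB by (simp add: \<beta>_def)
  have V1: "\<xi>0 \<in> V" "\<xi>1 \<notin> V" using \<xi>0 \<xi>1 by (auto simp: V p)
  obtain W where W: "finite W" "\<And>S. S \<in> W \<Longrightarrow> subspace S" "V = \<Union>W"
    using \<open>\<exists>W. finite W \<and> (\<forall>S\<in>W. subspace S) \<and> V = \<Union>W\<close> by blast
  have "\<Union>W \<noteq> UNIV" using V1(2) W(3) by blast
  then obtain N where N: "finite N" "\<And>\<nu>. \<nu> \<in> N \<Longrightarrow> norm \<nu> = 1" "\<And>v. v \<in> V \<Longrightarrow> \<exists>\<nu>\<in>N. v \<bullet> \<nu> = 0"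
    using subspaces_in_hyperplanes[OF W(1,2)] W(3) by metis
  have N_ne: "N \<noteq> {}" using N(3)[OF V1(1)] by blast
  have V_ne: "V \<noteq> {}" using V1(1) by blast
  obtain C1 where C1: "C1 > 0"
    "\<And>\<xi> t x X. \<xi> \<noteq> 0 \<Longrightarrow> 0 < t \<Longrightarrow> (\<And>\<nu>. \<nu> \<in> N \<Longrightarrow> t * norm \<xi> \<le> \<bar>\<xi> \<bullet> \<nu>\<bar>) \<Longrightarrow>
       op_symbol m a \<xi> *v X = x *\<^sub>R (op_symbol m a \<xi> *v (A - B)) \<Longrightarrow> t ^ (2 * L) * x\<^sup>2 \<le> C1 * (norm X)\<^sup>2"
    using symbol_lower_bound[OF p \<open>max_vanishing_order p = enat L\<close> V V_ne N(2,3)] by blast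
  obtain \<rho> where \<rho>: "\<rho> > 0" "\<Omega> \<subseteq> ball 0 \<rho>"
    using bounded_subset_ballD[OF \<Omega>(2), of 0] by blast
  obtain C2 where C2: "C2 > 0" and C2_est: "\<forall>R\<ge>1. \<forall>g (w :: 'n \<Rightarrow> real^'d \<Rightarrow> real).
     integrable lborel g \<longrightarrow> integrable lborel (\<lambda>x. (g x)\<^sup>2) \<longrightarrow> (\<forall>x. g x \<noteq> 0 \<longrightarrow> norm x < \<rho>) \<longrightarrow>
     (\<forall>i. integrable lborel (w i) \<and> integrable lborel (\<lambda>x. (w i x)\<^sup>2)) \<longrightarrow>
     (\<forall>\<xi> t. \<xi> \<noteq> 0 \<longrightarrow> 0 < t \<longrightarrow> (\<forall>\<nu>\<in>N. t * norm \<xi> \<le> \<bar>\<xi> \<bullet> \<nu>\<bar>) \<longrightarrow>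
        t ^ (2 * L) * spectrum g \<xi> \<le> C1 * (\<Sum>i\<in>UNIV. spectrum (w i) \<xi>)) \<longrightarrow>
     (\<integral>x. (g x)\<^sup>2 \<partial>lborel) \<le> C2 * R ^ (2 * L) * (\<Sum>i\<in>UNIV. \<integral>x. (w i x)\<^sup>2 \<partial>lborel)
        + (\<integral>z. gauss_kernel (1 / R\<^sup>2) z * shift_defect g z \<partial>lborel)"
    using degenerate_multiplier_estimate[OF N(1,2) N_ne \<rho>(1) less_imp_le[OF C1(1)], where 'i = 'n and L = L] by blast
  define \<kappa> where "\<kappa> = sqrt 2 ^ CARD('d)"
  have \<kappa>: "\<kappa> > 0" by (simp add: \<kappa>_def)
  define C3 where "C3 = C2 + \<kappa> / \<beta>"
  have C3: "C3 > 0" using C2 \<kappa> \<beta> by (simp add: C3_def add_pos_pos)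
  define \<mu> where "\<mu> = measure lborel \<Omega>"
  have \<mu>: "\<mu> > 0" unfolding \<mu>_def by (rule open_measure_pos) fact+
  let ?q = "2 * real L + 1"
  have scaling: "\<exists>e0>0. \<forall>\<epsilon>. 0 < \<epsilon> \<and> \<epsilon> < e0 \<longrightarrow>
      (INF f\<in>BV \<Omega> {A, B}. energy m a \<Omega> \<epsilon> f (lam *\<^sub>R A + (1 - lam) *\<^sub>R B))
        \<ge> ennreal (\<mu> / (2 * C3) * (min (1 - lam) lam)\<^sup>2 * \<epsilon> powr (2 * real L / ?q))"
    if lam: "0 < lam" "lam < 1" for lam
  proof -
    define M where "M = (min (1 - lam) lam)\<^sup>2 * \<mu>"
    have M: "M > 0" using lam \<mu> by (simp add: M_def)
    \<comment> \<open>The strip of width \<open>r\<close> and the threshold \<open>R0\<close> make the boundary terms at most half of \<open>M\<close>.\<close>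
    obtain r where r: "r > 0" "measure lborel (inner_strip \<Omega> r) < M / 8"
      using inner_strip_small[OF \<Omega>, of "M / 8"] M by auto
    define R0 where "R0 = max 1 (8 * \<mu> * \<kappa> / (r * M))"
    have R0: "R0 \<ge> 1" "8 * \<mu> * \<kappa> / (r * M) \<le> R0" by (auto simp: R0_def)
    define e0 where "e0 = R0 powr (- ?q)"
    show ?thesis
    proof (intro exI[of _ e0] conjI allI impI INF_greatest)
      show "e0 > 0" using R0 by (simp add: e0_def)
      fix \<epsilon> f assume \<epsilon>: "0 < \<epsilon> \<and> \<epsilon> < e0" and f: "f \<in> BV \<Omega> {A, B}"
      \<comment> \<open>The choice balances the weights: \<open>1 / R = \<epsilon> * R ^ (2 * L)\<close>.\<close>
      define R where "R = \<epsilon> powr (- 1 / ?q)"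
      have "(- ?q) * (- 1 / ?q) = 1" by (simp add: field_simps)
      then have "R0 = e0 powr (- 1 / ?q)" using R0 by (simp only: e0_def powr_powr powr_one)
      also have "\<dots> \<le> R" unfolding R_def using \<epsilon> by (intro powr_mono2') auto
      finally have R: "R0 \<le> R" .
      then have R1: "R \<ge> 1" "R > 0" using R0 by auto
      have RL: "R ^ (2 * L) = \<epsilon> powr (- (2 * real L / ?q))"
        using powr_realpow[OF R1(2), of "2 * L"] by (simp add: R_def powr_powr)
      have Rinv: "1 / R = \<epsilon> * R ^ (2 * L)"
      proof -
        have "\<epsilon> * R ^ (2 * L) = \<epsilon> powr (1 - 2 * real L / ?q)"
          using \<epsilon> by (simp add: RL powr_diff powr_minus divide_inverse)
        also have "1 - 2 * real L / ?q = 1 / ?q" by (simp add: field_simps)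
        finally show ?thesis using \<epsilon> by (simp add: R_def powr_minus_divide)
      qed
      have fm: "f \<in> borel_measurable (lebesgue_on \<Omega>)" and f_tv: "total_variation \<Omega> f < \<infinity>"
        and f_val: "AE x in lebesgue_on \<Omega>. f x \<in> {A, B}"
        using f by (auto simp: BV_def)
      define T where "T = enn2real (total_variation \<Omega> f)"
      have T: "total_variation \<Omega> f = ennreal T" "T \<ge> 0" using f_tv by (auto simp: T_def)
      obtain E where E: "E \<in> sets borel" "E \<subseteq> \<Omega>" "AE x in lebesgue. x \<in> \<Omega> \<longrightarrow> f x = (if x \<in> E then A else B)"
        using phase_set[OF \<Omega>(1) fm f_val] by blast
      define \<theta> where "\<theta> = two_phase lam \<Omega> E"
      have dual: "(\<integral>x. indicator E x * dir_deriv \<nu> \<psi> x \<partial>lborel) \<le> T / \<beta>"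
        if "\<psi> \<in> test_functions \<Omega>" "\<And>x. \<bar>\<psi> x\<bar> \<le> 1" "norm \<nu> = 1" for \<psi> \<nu>
        unfolding \<beta>_def by (rule total_variation_dual[OF \<Omega>(1) E(1,2) AB E(3) fm T that])
      have "(\<integral>z. gauss_kernel (1 / R\<^sup>2) z * shift_defect \<theta> z \<partial>lborel)
          \<le> 2 * (M / 8) + (T / \<beta> + 2 * \<mu> / r) * sqrt 2 ^ CARD('d) / R"
        unfolding \<theta>_def \<mu>_def
        by (rule two_phase_gauss_defect[OF E(1,2) \<Omega> _ lam dual r R1(2)]) (use T \<beta> in simp)
      also have "\<dots> = M / 4 + \<kappa> / \<beta> * (T / R) + 2 * \<mu> * \<kappa> / (r * R)"
        by (simp add: \<kappa>_def add_divide_distrib algebra_simps)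
      also have "2 * \<mu> * \<kappa> / (r * R) \<le> M / 4"
      proof -
        have "8 * \<mu> * \<kappa> / (r * M) \<le> R" using R0(2) R by simp
        then show ?thesis using r M R1 by (simp add: field_simps)
      qed
      finally have defect: "(\<integral>z. gauss_kernel (1 / R\<^sup>2) z * shift_defect \<theta> z \<partial>lborel)
          \<le> M / 2 + \<kappa> / \<beta> * (T / R)" by simp
      let ?X = "\<mu> / (2 * C3) * (min (1 - lam) lam)\<^sup>2 * \<epsilon> powr (2 * real L / ?q)"
      have elastic: "ennreal (?X - \<epsilon> * T) \<le> (\<integral>\<^sup>+x. ennreal ((norm (u x - f x))\<^sup>2) \<partial>lebesgue_on \<Omega>)"
        if u: "u \<in> admissible m a \<Omega> (lam *\<^sub>R A + (1 - lam) *\<^sub>R B)" for u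
      proof (cases "(\<integral>\<^sup>+x. ennreal ((norm (u x - f x))\<^sup>2) \<partial>lebesgue_on \<Omega>) < \<infinity>")
        case True
        from elastic_residual[OF \<Omega> front m E u True] obtain w :: "'n \<Rightarrow> real^'d \<Rightarrow> real" where
          w: "\<And>i. integrable lborel (w i)" "\<And>i. integrable lborel (\<lambda>x. (w i x)\<^sup>2)"
          and w_e: "(\<integral>\<^sup>+x. ennreal ((norm (u x - f x))\<^sup>2) \<partial>lebesgue_on \<Omega>) = ennreal (\<Sum>i\<in>UNIV. \<integral>x. (w i x)\<^sup>2 \<partial>lborel)"
          and w_c: "\<And>\<xi>. op_symbol m a \<xi> *v (\<chi> i. cos_transform (w i) \<xi>) = cos_transform \<theta> \<xi> *\<^sub>R (op_symbol m a \<xi> *v (A - B))"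
          and w_s: "\<And>\<xi>. op_symbol m a \<xi> *v (\<chi> i. sin_transform (w i) \<xi>) = sin_transform \<theta> \<xi> *\<^sub>R (op_symbol m a \<xi> *v (A - B))"
          unfolding \<theta>_def by blast
        define e where "e = (\<Sum>i\<in>UNIV. \<integral>x. (w i x)\<^sup>2 \<partial>lborel)"
        have e0: "e \<ge> 0" unfolding e_def by (intro sum_nonneg) simp
        have mult: "t ^ (2 * L) * spectrum \<theta> \<xi> \<le> C1 * (\<Sum>i\<in>UNIV. spectrum (w i) \<xi>)"
          if "\<xi> \<noteq> 0" "0 < t" "\<forall>\<nu>\<in>N. t * norm \<xi> \<le> \<bar>\<xi> \<bullet> \<nu>\<bar>" for \<xi> t
        proof -
          have "t ^ (2 * L) * (cos_transform \<theta> \<xi>)\<^sup>2 \<le> C1 * (\<Sum>i\<in>UNIV. (cos_transform (w i) \<xi>)\<^sup>2)"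
            using C1(2)[OF that(1,2) _ w_c[of \<xi>]] that(3) by (simp add: norm_vec_square)
          moreover have "t ^ (2 * L) * (sin_transform \<theta> \<xi>)\<^sup>2 \<le> C1 * (\<Sum>i\<in>UNIV. (sin_transform (w i) \<xi>)\<^sup>2)"
            using C1(2)[OF that(1,2) _ w_s[of \<xi>]] that(3) by (simp add: norm_vec_square)
          ultimately show ?thesis by (simp add: spectrum_def sum.distrib distrib_left)
        qed
        have supp: "\<forall>x. \<theta> x \<noteq> 0 \<longrightarrow> norm x < \<rho>"
          using \<rho>(2) E(2) by (auto simp: \<theta>_def two_phase_def indicator_def split: if_splits)
        have "(\<integral>x. (\<theta> x)\<^sup>2 \<partial>lborel) \<le> C2 * R ^ (2 * L) * (\<Sum>i\<in>UNIV. \<integral>x. (w i x)\<^sup>2 \<partial>lborel)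
            + (\<integral>z. gauss_kernel (1 / R\<^sup>2) z * shift_defect \<theta> z \<partial>lborel)"
          using C2_est[rule_format, OF R1(1), of \<theta> w] two_phase_integrable[OF \<Omega> E(1,2), of lam, folded \<theta>_def]
            supp w mult by blast
        moreover have "M \<le> (\<integral>x. (\<theta> x)\<^sup>2 \<partial>lborel)"
          unfolding M_def \<mu>_def \<theta>_def by (rule two_phase_square_ge[OF \<Omega> E(1,2) lam])
        ultimately have "M / 2 \<le> C2 * R ^ (2 * L) * e + \<kappa> / \<beta> * (T / R)"
          using defect unfolding e_def by linarith
        also have "T / R = R ^ (2 * L) * (\<epsilon> * T)" using Rinv by (simp add: divide_inverse mult_ac)
        also have "C2 * R ^ (2 * L) * e + \<kappa> / \<beta> * (R ^ (2 * L) * (\<epsilon> * T)) \<le> C3 * R ^ (2 * L) * (e + \<epsilon> * T)"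
        proof -
          have "0 \<le> C2 * (R ^ (2 * L) * (\<epsilon> * T))" "0 \<le> \<kappa> / \<beta> * (R ^ (2 * L) * e)"
            using C2 \<kappa> \<beta> R1 \<epsilon> T e0 by simp_all
          moreover have "(c + k) * P * (e + y) = c * P * e + k * (P * y) + (c * (P * y) + k * (P * e))"
            for c k P y :: real by (simp add: algebra_simps)
          ultimately show ?thesis unfolding C3_def by simp
        qed
        finally have "M / 2 \<le> C3 * R ^ (2 * L) * (e + \<epsilon> * T)" .
        then have "M / 2 / (C3 * R ^ (2 * L)) \<le> e + \<epsilon> * T"
          using C3 R1 by (simp add: divide_le_eq mult_ac)
        moreover have "M / 2 / (C3 * R ^ (2 * L)) = ?X"
        proof -
          have "k * b / 2 / (c * inverse P) = b / (2 * c) * k * P" for k b c P :: real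
            by (simp add: field_simps)
          then show ?thesis unfolding RL powr_minus M_def .
        qed
        ultimately have "?X - \<epsilon> * T \<le> e" by simp
        then show ?thesis unfolding w_e e_def by (rule ennreal_leI)
      next
        case False
        then show ?thesis by (simp add: less_top[symmetric])
      qed
      have "ennreal ?X \<le> (INF u\<in>admissible m a \<Omega> (lam *\<^sub>R A + (1 - lam) *\<^sub>R B).
          \<integral>\<^sup>+x. ennreal ((norm (u x - f x))\<^sup>2) \<partial>lebesgue_on \<Omega>) + ennreal (\<epsilon> * T)"
        by (rule ennreal_le_INF_add[OF elastic]) (use \<epsilon> T in auto)
      then show "ennreal ?X \<le> energy m a \<Omega> \<epsilon> f (lam *\<^sub>R A + (1 - lam) *\<^sub>R B)"
        using \<epsilon> T by (simp add: energy_def ennreal_mult)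
    qed
  qed
  show ?thesis
  proof (rule exI[of _ "\<mu> / (2 * C3)"], rule conjI)
    show "\<mu> / (2 * C3) > 0" using C3 \<mu> by simp
  qed (use scaling in blast)
qed

end
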